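(* Let $\mathbb{F}$ be a field with $\operatorname{char}\mathbb{F}\neq2$. Let $S=V_t(\mathfrak{g})=\mathbb{F}[y,t][x^{\pm1};\alpha]$, where $\alpha$ is the $\mathbb{F}$-automorphism of $\mathbb{F}[y,t]$ with $\alpha(y)=y+t$ and $\alpha(t)=t$, and let $\theta$ be the $\mathbb{F}$-automorphism of $S$ such that $\theta(x)=x^{-1}$, $\theta(y)=-y$ and $\theta(t)=t$. Let $T$ be the $\mathbb{F}$-algebra generated by $t,x_1,x_3$ and $x_2$ subject to the relations \begin{align*} x_it&=tx_i\quad\text{for } i=1,2,3,\\ x_1x_2&=x_2x_1-2tx_3x_1+3t^2x_2+2t^3x_3,\\ x_2x_3&=x_3x_2-tx_3^2+4t,\\ x_1x_3&=x_3x_1-t^2x_3-2tx_2. \end{align*} (i) $T$ is an iterated skew polynomial ring $\mathbb{F}[t,x_3][x_2;\delta][x_1;\sigma,\delta_1]$, where $\delta$ is a derivation of $\mathbb{F}[t,x_3]$, $\sigma$ is an automorphism of $\mathbb{F}[t,x_3][x_2;\delta]$ and $\delta_1$ is a $\sigma$-derivation of $\mathbb{F}[t,x_3][x_2;\delta]$. (ii) Let $g=(4-x_3^2)x_1+x_2^2+3tx_3x_2+t^2x_3^2+4t^2$. Then $g$ is a central element of $T$ and $T/gT$ is a domain. (iii) The fixed ring $S^\theta$ is isomorphic to $T/gT$.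
   Context: In the skew Laurent polynomial ring $R[x^{\pm1};\alpha]$ multiplication is determined by $xr=\alpha(r)x$ for $r\in R$; thus in $S$ one has $xy-yx=tx$ with $t$ central. In a skew polynomial ring $R[z;\sigma,\delta]$ (with $\sigma$ an automorphism and $\delta$ a left $\sigma$-derivation of $R$, i.e. $\delta$ is additive and $\delta(rs)=\sigma(r)\delta(s)+\delta(r)s$) one has $zr=\sigma(r)z+\delta(r)$; $R[z;\delta]$ means $R[z;\mathrm{id}_R,\delta]$. A domain is a not necessarily commutative nonzero ring without zero-divisors. $S^\theta$ is the subring of elements fixed by $\theta$; isomorphism is as $\mathbb{F}$-algebras. *)

theory Defs
  imports
    "HOL-Algebra.Algebraic_Closure_Type"
    "HOL-Algebra.QuotRing"
    "HOL-Computational_Algebra.Polynomial"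
    "HOL-Library.Poly_Mapping"
begin

section \<open>Noncommutative rings and algebras\<close>

text \<open>
  The base field is a type \<open>'a\<close> of class \<open>field\<close>. An algebra over it is a ring \<open>R\<close> together
  with its structure map \<open>\<eta> :: 'a \<Rightarrow> 'r\<close> (a ring homomorphism into the centre), so an algebra
  isomorphism is a ring isomorphism compatible with the structure maps.
\<close>

definition alg_iso ::
    "('a \<Rightarrow> 'r) \<Rightarrow> ('r, 'm) ring_scheme \<Rightarrow> ('a \<Rightarrow> 's) \<Rightarrow> ('s, 'n) ring_scheme \<Rightarrow> ('r \<Rightarrow> 's) set"
  where "alg_iso \<eta> R \<eta>' R' = {h \<in> ring_iso R R'. \<forall>c. h (\<eta> c) = \<eta>' c}"

text \<open>The locale \<open>domain\<close> of HOL-Algebra is restricted to commutative rings.\<close>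

definition nc_domain :: "('r, 'm) ring_scheme \<Rightarrow> bool"
  where "nc_domain R \<longleftrightarrow> ring R \<and> \<one>\<^bsub>R\<^esub> \<noteq> \<zero>\<^bsub>R\<^esub> \<and>
    (\<forall>a\<in>carrier R. \<forall>b\<in>carrier R. a \<otimes>\<^bsub>R\<^esub> b = \<zero>\<^bsub>R\<^esub> \<longrightarrow> a = \<zero>\<^bsub>R\<^esub> \<or> b = \<zero>\<^bsub>R\<^esub>)"

definition central :: "('r, 'm) ring_scheme \<Rightarrow> 'r \<Rightarrow> bool"
  where "central R z \<longleftrightarrow> z \<in> carrier R \<and> (\<forall>a\<in>carrier R. z \<otimes>\<^bsub>R\<^esub> a = a \<otimes>\<^bsub>R\<^esub> z)"

definition skew_derivation :: "('r, 'm) ring_scheme \<Rightarrow> ('r \<Rightarrow> 'r) \<Rightarrow> ('r \<Rightarrow> 'r) \<Rightarrow> bool"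
  where "skew_derivation R \<sigma> \<delta> \<longleftrightarrow> \<delta> \<in> carrier R \<rightarrow> carrier R \<and>
    (\<forall>r\<in>carrier R. \<forall>s\<in>carrier R.
      \<delta> (r \<oplus>\<^bsub>R\<^esub> s) = \<delta> r \<oplus>\<^bsub>R\<^esub> \<delta> s \<and>
      \<delta> (r \<otimes>\<^bsub>R\<^esub> s) = \<sigma> r \<otimes>\<^bsub>R\<^esub> \<delta> s \<oplus>\<^bsub>R\<^esub> \<delta> r \<otimes>\<^bsub>R\<^esub> s)"


section \<open>Skew polynomial and skew Laurent polynomial rings\<close>

text \<open>
  A (Laurent) polynomial \<open>\<Sum>n. r\<^sub>n z\<^sup>n\<close>, with coefficients on the left, is its coefficient function
  \<open>n \<mapsto> r\<^sub>n\<close>; the exponents \<open>n\<close> range over \<open>nat\<close> or \<open>int\<close>.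
\<close>

definition coeff_funs :: "('r, 'm) ring_scheme \<Rightarrow> ('i \<Rightarrow> 'r) set"
  where "coeff_funs R = {f. (\<forall>n. f n \<in> carrier R) \<and> finite {n. f n \<noteq> \<zero>\<^bsub>R\<^esub>}}"

definition skew_monom :: "('r, 'm) ring_scheme \<Rightarrow> 'r \<Rightarrow> 'i \<Rightarrow> 'i \<Rightarrow> 'r"
  where "skew_monom R r n = (\<lambda>m. if m = n then r else \<zero>\<^bsub>R\<^esub>)"

text \<open>
  Left multiplication by \<open>z\<close> in \<open>R[z; \<sigma>, \<delta>]\<close>: from \<open>z r = \<sigma>(r) z + \<delta>(r)\<close> one gets
  \<open>z (\<Sum>n. r\<^sub>n z\<^sup>n) = \<Sum>n. (\<sigma>(r\<^sub>n) z\<^sup>n\<^sup>+\<^sup>1 + \<delta>(r\<^sub>n) z\<^sup>n)\<close>. The product of \<open>f\<close> and \<open>g\<close> is then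
  \<open>\<Sum>i. f\<^sub>i (z\<^sup>i g)\<close>.
\<close>

definition skew_lmult ::
    "('r, 'm) ring_scheme \<Rightarrow> ('r \<Rightarrow> 'r) \<Rightarrow> ('r \<Rightarrow> 'r) \<Rightarrow> (nat \<Rightarrow> 'r) \<Rightarrow> nat \<Rightarrow> 'r"
  where "skew_lmult R \<sigma> \<delta> f n =
    (case n of 0 \<Rightarrow> \<delta> (f 0) | Suc m \<Rightarrow> \<sigma> (f m) \<oplus>\<^bsub>R\<^esub> \<delta> (f (Suc m)))"

definition skew_poly ::
    "('r, 'm) ring_scheme \<Rightarrow> ('r \<Rightarrow> 'r) \<Rightarrow> ('r \<Rightarrow> 'r) \<Rightarrow> (nat \<Rightarrow> 'r) ring"
  where "skew_poly R \<sigma> \<delta> = \<lparr>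
    carrier = coeff_funs R,
    monoid.mult = (\<lambda>f g n. \<Oplus>\<^bsub>R\<^esub>i\<in>{i. f i \<noteq> \<zero>\<^bsub>R\<^esub>}. f i \<otimes>\<^bsub>R\<^esub> (skew_lmult R \<sigma> \<delta> ^^ i) g n),
    one = skew_monom R \<one>\<^bsub>R\<^esub> 0,
    zero = (\<lambda>n. \<zero>\<^bsub>R\<^esub>),
    add = (\<lambda>f g n. f n \<oplus>\<^bsub>R\<^esub> g n)\<rparr>"

definition aut_power :: "('r, 'm) ring_scheme \<Rightarrow> ('r \<Rightarrow> 'r) \<Rightarrow> int \<Rightarrow> 'r \<Rightarrow> 'r"
  where "aut_power R \<alpha> i =
    (if 0 \<le> i then \<alpha> ^^ nat i else inv_into (carrier R) \<alpha> ^^ nat (- i))"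

text \<open>
  \<open>R[x\<^sup>\<plusminus>\<^sup>1; \<alpha>]\<close>, for an automorphism \<open>\<alpha>\<close> of \<open>R\<close>: since \<open>x r = \<alpha>(r) x\<close>, one has
  \<open>(r x\<^sup>i) (s x\<^sup>j) = r \<alpha>\<^sup>i(s) x\<^sup>i\<^sup>+\<^sup>j\<close> for all integers \<open>i\<close> and \<open>j\<close>.
\<close>

definition skew_laurent :: "('r, 'm) ring_scheme \<Rightarrow> ('r \<Rightarrow> 'r) \<Rightarrow> (int \<Rightarrow> 'r) ring"
  where "skew_laurent R \<alpha> = \<lparr>
    carrier = coeff_funs R,
    monoid.mult = (\<lambda>f g n. \<Oplus>\<^bsub>R\<^esub>i\<in>{i. f i \<noteq> \<zero>\<^bsub>R\<^esub>}. f i \<otimes>\<^bsub>R\<^esub> aut_power R \<alpha> i (g (n - i))),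
    one = skew_monom R \<one>\<^bsub>R\<^esub> 0,
    zero = (\<lambda>n. \<zero>\<^bsub>R\<^esub>),
    add = (\<lambda>f g n. f n \<oplus>\<^bsub>R\<^esub> g n)\<rparr>"


section \<open>The algebra \<open>S\<close>\<close>

text \<open>
  A polynomial ring in two commuting variables over the base field is the type \<open>'a poly poly\<close>.
  The inner variable \<open>[:[:0, 1:]:]\<close> is always \<open>t\<close>; the outer variable \<open>[:0, 1:]\<close> is \<open>y\<close> in
  \<open>\<F>[y,t]\<close> and \<open>x\<^sub>3\<close> in \<open>\<F>[t,x\<^sub>3]\<close>.
\<close>

abbreviation poly2 :: "'a::field poly poly ring"
  where "poly2 \<equiv> ring_of_type_algebra"

text \<open>The substitution \<open>y \<mapsto> y + t\<close>, \<open>t \<mapsto> t\<close>.\<close>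

definition alpha :: "'a::field poly poly \<Rightarrow> 'a poly poly"
  where "alpha p = pcompose p [:[:0, 1:], 1:]"

definition S_ring :: "(int \<Rightarrow> 'a::field poly poly) ring"
  where "S_ring = skew_laurent poly2 alpha"

definition S_const :: "'a::field \<Rightarrow> int \<Rightarrow> 'a poly poly"
  where "S_const c = skew_monom poly2 [:[:c:]:] 0"

definition S_t :: "int \<Rightarrow> 'a::field poly poly"
  where "S_t = skew_monom poly2 [:[:0, 1:]:] 0"

definition S_y :: "int \<Rightarrow> 'a::field poly poly"
  where "S_y = skew_monom poly2 [:0, 1:] 0"

definition S_x :: "int \<Rightarrow> 'a::field poly poly"
  where "S_x = skew_monom poly2 1 1"

definition S_x_inv :: "int \<Rightarrow> 'a::field poly poly"
  where "S_x_inv = skew_monom poly2 1 (- 1)"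

text \<open>
  The automorphism \<open>\<theta>\<close> of \<open>S\<close> prescribed by \<open>x \<mapsto> x\<^sup>-\<^sup>1\<close>, \<open>y \<mapsto> -y\<close>, \<open>t \<mapsto> t\<close> exists.
\<close>

lemma poly2_simps:
  "carrier poly2 = UNIV" "p \<otimes>\<^bsub>poly2\<^esub> q = p * q" "p \<oplus>\<^bsub>poly2\<^esub> q = p + q"
  "\<one>\<^bsub>poly2\<^esub> = 1" "\<zero>\<^bsub>poly2\<^esub> = 0"
  by (auto simp: ring_of_type_algebra_def)

lemma finsum_poly2: "finite A \<Longrightarrow> finsum poly2 f A = sum f A"
proof (induction A rule: finite_induct)
  case empty
  interpret ring poly2 by (rule ring_from_type_algebra)
  show ?case using finsum_empty by (simp add: poly2_simps)
next
  case (insert a A)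
  interpret ring poly2 by (rule ring_from_type_algebra)
  have "finsum poly2 f (insert a A) = f a \<oplus>\<^bsub>poly2\<^esub> finsum poly2 f A"
    by (rule finsum_insert) (use insert in \<open>auto simp: poly2_simps\<close>)
  then show ?case using insert by (simp add: poly2_simps)
qed

lemma theta_exists:
  "\<exists>\<theta> \<in> alg_iso S_const S_ring S_const (S_ring :: (int \<Rightarrow> 'a::field poly poly) ring).
     \<theta> S_x = S_x_inv \<and> \<theta> S_y = \<ominus>\<^bsub>S_ring\<^esub> S_y \<and> \<theta> S_t = S_t"
proof -
  define \<beta> :: "'a poly poly \<Rightarrow> 'a poly poly" where "\<beta> p = pcompose p [:- [:0, 1:], 1:]" for p
  define \<tau> :: "'a poly poly \<Rightarrow> 'a poly poly" where "\<tau> p = pcompose p [:0, - 1:]" for p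
  define \<theta> :: "(int \<Rightarrow> 'a poly poly) \<Rightarrow> int \<Rightarrow> 'a poly poly" where "\<theta> f n = \<tau> (f (- n))" for f n
  have ab: "alpha (\<beta> p) = p" "\<beta> (alpha p) = p" for p
    by (simp_all add: alpha_def \<beta>_def pcompose_pCons flip: pcompose_assoc)
  have inv: "inv_into UNIV alpha = \<beta>"
    by (rule inv_equality) (simp_all add: ab)
  have tt: "\<tau> (\<tau> p) = p" for p
    by (simp add: \<tau>_def pcompose_pCons flip: pcompose_assoc)
  have ta: "\<tau> (alpha p) = \<beta> (\<tau> p)" and tb: "\<tau> (\<beta> p) = alpha (\<tau> p)" for p
    by (simp_all add: \<tau>_def alpha_def \<beta>_def pcompose_pCons flip: pcompose_assoc)
  have ta': "\<tau> ((alpha ^^ k) p) = (\<beta> ^^ k) (\<tau> p)" and tb': "\<tau> ((\<beta> ^^ k) p) = (alpha ^^ k) (\<tau> p)" for k p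
    by (induction k) (simp_all add: ta tb)
  have pow: "\<tau> (aut_power poly2 alpha i p) = aut_power poly2 alpha (- i) (\<tau> p)" for i p
    by (simp add: aut_power_def poly2_simps inv ta' tb' nat_eq_iff)
  have t0: "\<tau> 0 = 0" "\<tau> 1 = 1" by (simp_all add: \<tau>_def one_pCons pcompose_pCons)
  have t0': "\<tau> p = 0 \<longleftrightarrow> p = 0" for p using tt t0 by metis
  have t_add: "\<tau> (p + q) = \<tau> p + \<tau> q" and t_mult: "\<tau> (p * q) = \<tau> p * \<tau> q" for p q
    by (simp_all add: \<tau>_def pcompose_add pcompose_mult)
  have t_sum: "\<tau> (sum f A) = (\<Sum>i\<in>A. \<tau> (f i))" for f and A :: "int set"
    by (induction A rule: infinite_finite_induct) (simp_all add: t0 t_add)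
  have thth: "\<theta> (\<theta> f) = f" for f by (simp add: \<theta>_def fun_eq_iff tt)
  have supp: "{n. \<theta> f n \<noteq> 0} = uminus ` {n. f n \<noteq> 0}" for f
    by (force simp: \<theta>_def t0' image_iff)
  have carr: "\<theta> f \<in> carrier S_ring" if "f \<in> carrier S_ring" for f
    using that supp[of f] by (simp add: S_ring_def skew_laurent_def coeff_funs_def poly2_simps)
  have mult: "\<theta> (f \<otimes>\<^bsub>S_ring\<^esub> g) = \<theta> f \<otimes>\<^bsub>S_ring\<^esub> \<theta> g" if "f \<in> carrier S_ring" for f g
  proof
    fix n
    have fin: "finite {n. f n \<noteq> 0}"
      using that by (simp add: S_ring_def skew_laurent_def coeff_funs_def poly2_simps)
    have fin': "finite {n. \<theta> f n \<noteq> 0}" unfolding supp using fin by simp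
    have "\<theta> (f \<otimes>\<^bsub>S_ring\<^esub> g) n
        = (\<Sum>i\<in>{n. f n \<noteq> 0}. \<tau> (f i) * aut_power poly2 alpha (- i) (\<tau> (g (- n - i))))"
      by (simp add: S_ring_def skew_laurent_def poly2_simps \<theta>_def finsum_poly2[OF fin] t_sum t_mult pow)
    also have "\<dots> = (\<Sum>j\<in>{n. \<theta> f n \<noteq> 0}. \<theta> f j * aut_power poly2 alpha j (\<theta> g (n - j)))"
      unfolding supp by (subst sum.reindex) (auto simp: \<theta>_def minus_diff_commute[of n] intro!: sum.cong)
    also have "\<dots> = (\<theta> f \<otimes>\<^bsub>S_ring\<^esub> \<theta> g) n"
      by (simp add: S_ring_def skew_laurent_def poly2_simps finsum_poly2[OF fin'])
    finally show "\<theta> (f \<otimes>\<^bsub>S_ring\<^esub> g) n = (\<theta> f \<otimes>\<^bsub>S_ring\<^esub> \<theta> g) n" .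
  qed
  have "\<theta> \<in> ring_hom S_ring S_ring"
    by (rule ring_hom_memI)
      (simp_all add: carr mult, simp_all add: S_ring_def skew_laurent_def skew_monom_def
        poly2_simps \<theta>_def fun_eq_iff t_add t0)
  moreover have "bij_betw \<theta> (carrier S_ring) (carrier S_ring)"
    by (rule bij_betw_byWitness[where f' = \<theta>]) (auto simp: thth carr)
  moreover have "\<theta> (S_const c) = S_const c" for c
    by (auto simp: \<theta>_def S_const_def skew_monom_def poly2_simps \<tau>_def)
  ultimately have iso: "\<theta> \<in> alg_iso S_const S_ring S_const S_ring"
    by (simp add: alg_iso_def ring_iso_def)
  have "\<ominus>\<^bsub>S_ring\<^esub> S_y = (\<lambda>n. - S_y n :: 'a poly poly)"
    unfolding a_inv_def m_inv_def
  proof (rule the_equality, goal_cases)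
    case 1
    then show ?case
      by (auto simp: S_ring_def skew_laurent_def S_y_def skew_monom_def coeff_funs_def poly2_simps
          fun_eq_iff)
  next
    case (2 g)
    then show ?case
      by (simp add: S_ring_def skew_laurent_def poly2_simps fun_eq_iff eq_neg_iff_add_eq_0 add.commute)
  qed
  moreover have "\<theta> S_y = (\<lambda>n. - S_y n)"
    by (auto simp: \<theta>_def S_y_def skew_monom_def poly2_simps \<tau>_def pcompose_pCons)
  moreover have "\<theta> S_x = S_x_inv"
    by (auto simp: \<theta>_def S_x_def S_x_inv_def skew_monom_def poly2_simps t0)
  moreover have "\<theta> S_t = S_t"
    by (auto simp: \<theta>_def S_t_def skew_monom_def poly2_simps \<tau>_def)
  ultimately show ?thesis using iso by (intro bexI[of _ \<theta>]) simp_all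
qed

definition fixed_ring :: "('r \<Rightarrow> 'r) \<Rightarrow> ('r, 'm) ring_scheme \<Rightarrow> ('r, 'm) ring_scheme"
  where "fixed_ring \<theta> R = R\<lparr>carrier := {s \<in> carrier R. \<theta> s = s}\<rparr>"


section \<open>The algebra \<open>T\<close>\<close>

text \<open>
  The free algebra on a set of generators is the monoid algebra of the free monoid of words,
  i.e. finitely supported functions from words to the base field with the convolution product
  of \<open>HOL-Library.Poly_Mapping\<close>.
\<close>

datatype 'g word = Word "'g list"

instantiation word :: (type) monoid_add
begin

definition zero_word :: "'g word"
  where "zero_word = Word []"

fun plus_word :: "'g word \<Rightarrow> 'g word \<Rightarrow> 'g word"
  where "plus_word (Word u) (Word v) = Word (u @ v)"

instance
proof
  fix a b c :: "'g word"
  show "a + b + c = a + (b + c)" by (cases a; cases b; cases c) simp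
  show "0 + a = a" by (cases a) (simp add: zero_word_def)
  show "a + 0 = a" by (cases a) (simp add: zero_word_def)
qed

end

datatype gen = Gen_t | Gen_x1 | Gen_x2 | Gen_x3

type_synonym 'a free_alg = "gen word \<Rightarrow>\<^sub>0 'a"

abbreviation free_ring :: "'a::field free_alg ring"
  where "free_ring \<equiv> ring_of_type_algebra"

definition free_const :: "'a::field \<Rightarrow> 'a free_alg"
  where "free_const c = Poly_Mapping.single 0 c"

definition free_gen :: "gen \<Rightarrow> 'a::field free_alg"
  where "free_gen v = Poly_Mapping.single (Word [v]) 1"

definition T_relators :: "'a::field free_alg set"
  where "T_relators =
    (let t = free_gen Gen_t; x1 = free_gen Gen_x1; x2 = free_gen Gen_x2; x3 = free_gen Gen_x3 in
      {x1 * t - t * x1,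
       x2 * t - t * x2,
       x3 * t - t * x3,
       x1 * x2 - (x2 * x1 - 2 * t * x3 * x1 + 3 * t ^ 2 * x2 + 2 * t ^ 3 * x3),
       x2 * x3 - (x3 * x2 - t * x3 ^ 2 + 4 * t),
       x1 * x3 - (x3 * x1 - t ^ 2 * x3 - 2 * t * x2)})"

definition T_ideal :: "'a::field free_alg set"
  where "T_ideal = genideal free_ring T_relators"

definition T_ring :: "'a::field free_alg set ring"
  where "T_ring = free_ring Quot T_ideal"

definition T_class :: "'a::field free_alg \<Rightarrow> 'a free_alg set"
  where "T_class p = T_ideal +>\<^bsub>free_ring\<^esub> p"

definition T_const :: "'a::field \<Rightarrow> 'a free_alg set"
  where "T_const c = T_class (free_const c)"

definition T_gen :: "gen \<Rightarrow> 'a::field free_alg set"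
  where "T_gen v = T_class (free_gen v)"

definition T_g :: "'a::field free_alg set"
  where "T_g =
    (let t = free_gen Gen_t; x1 = free_gen Gen_x1; x2 = free_gen Gen_x2; x3 = free_gen Gen_x3 in
      T_class ((4 - x3 ^ 2) * x1 + x2 ^ 2 + 3 * t * x3 * x2 + t ^ 2 * x3 ^ 2 + 4 * t ^ 2))"

definition gT :: "'a::field free_alg set set"
  where "gT = T_g <#\<^bsub>T_ring\<^esub> carrier T_ring"

definition TgT_ring :: "'a::field free_alg set set ring"
  where "TgT_ring = T_ring Quot gT"

definition TgT_const :: "'a::field \<Rightarrow> 'a free_alg set set"
  where "TgT_const c = gT +>\<^bsub>T_ring\<^esub> T_const c"

end

theory Submission
  imports Defs
begin

text \<open>
  In \<open>S\<close> put \<open>x\<^sub>3 = x + x\<^sup>-\<^sup>1\<close>, \<open>x\<^sub>2 = y (x - x\<^sup>-\<^sup>1)\<close> and \<open>x\<^sub>1 = y\<^sup>2\<close>; these are fixed by \<open>\<theta>\<close>, satisfy the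
  relations of \<open>T\<close> and kill \<open>g\<close>. Modulo \<open>g\<close> every element of \<open>T\<close> is a sum of terms
  \<open>a(x\<^sub>1) x\<^sub>3\<^sup>n\<close> and \<open>b(x\<^sub>1) x\<^sub>2 x\<^sub>3\<^sup>n\<close> with \<open>a, b\<close> over \<open>\<F>[t]\<close>. In \<open>S\<close> the coefficient of the top
  power of \<open>x\<close> has the form \<open>a(y\<^sup>2) + y b(y\<^sup>2)\<close>, so such a sum vanishes in \<open>S\<close> only if it is
  trivial; hence \<open>T/gT\<close> embeds in the domain \<open>S\<close>. The image is all of \<open>S\<^sup>\<theta>\<close>
  because \<open>x\<^sup>n + x\<^sup>-\<^sup>n\<close> and \<open>y (x\<^sup>n - x\<^sup>-\<^sup>n)\<close> satisfy a Chebyshev recursion, and because an element of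
  \<open>\<F>[y,t]\<close> that is invariant under \<open>y \<mapsto> -y\<close> is a polynomial in \<open>y\<^sup>2\<close> when \<open>2 \<noteq> 0\<close>.

  In \<open>A = \<F>[t,x\<^sub>3][x\<^sub>2;\<delta>]\<close> write \<open>g = w x\<^sub>1 + h\<close> with \<open>w = 4 - x\<^sub>3\<^sup>2\<close> and \<open>h \<in> A\<close>. If \<open>g\<close> is to be central,
  then \<open>w \<sigma>(a) = a w\<close> and \<open>w \<delta>\<^sub>1(a) = a h - h a\<close> for \<open>a \<in> A\<close>. Since \<open>w\<close> is left cancellable, these
  equations determine \<open>\<sigma>\<close> and \<open>\<delta>\<^sub>1\<close>, give their algebraic properties, and conversely
  make \<open>g\<close> central in \<open>A[x\<^sub>1;\<sigma>,\<delta>\<^sub>1]\<close>.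
\<close>

section \<open>Rings of coefficient functions\<close>

text \<open>T is given by generators and relations only, so nothing about its size is known in
  advance. For (i) homomorphisms in both directions settle this: the relations hold in the iterated
  ring, the universal property of each skew extension leads back to T, and the composites are the
  identity because they are so on generators. For (iii) the normal forms are shown to span modulo g
  inside T, while their independence is read off in S. The obstacle in (i) is
  \<open>\<delta>\<^sub>1\<close>: the relations give it only on generators, and it has to be
  extended to A as a \<sigma>-derivation. Taking its equation with h as a definition reduces
  existence to the generators; additivity and the twisted Leibniz rule then follow from uniqueness
  of solutions, the twist appearing when w is moved past an element of A. The order with x1 on the
  left and x3 on the right is chosen for S: there x1 is y^2 and x3^n has top term x^n, so top
  coefficients are visible without applying any power of the automorphism.\<close>

definition coeff_ring ::
    "('r, 'm) ring_scheme \<Rightarrow> ('i \<Rightarrow> ('i \<Rightarrow> 'r) \<Rightarrow> 'i \<Rightarrow> 'r) \<Rightarrow> ('i::zero \<Rightarrow> 'r) ring"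
  where "coeff_ring R L = \<lparr>
    carrier = coeff_funs R,
    monoid.mult = (\<lambda>f g n. \<Oplus>\<^bsub>R\<^esub>i\<in>{i. f i \<noteq> \<zero>\<^bsub>R\<^esub>}. f i \<otimes>\<^bsub>R\<^esub> L i g n),
    one = skew_monom R \<one>\<^bsub>R\<^esub> 0,
    zero = (\<lambda>n. \<zero>\<^bsub>R\<^esub>),
    add = (\<lambda>f g n. f n \<oplus>\<^bsub>R\<^esub> g n)\<rparr>"

text \<open>Both kinds of rings have the same product formula once \<open>L i\<close> is left
  multiplication by the i-th power of the variable. The exponents are \<open>nat\<close> in one case
  and \<open>int\<close> in the other, so the index type only has a zero.\<close>

lemma skew_poly_eq: "skew_poly R \<sigma> \<delta> = coeff_ring R (\<lambda>i. skew_lmult R \<sigma> \<delta> ^^ i)"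
  by (simp add: skew_poly_def coeff_ring_def)

lemma skew_laurent_eq:
  "skew_laurent R \<alpha> = coeff_ring R (\<lambda>i g n. aut_power R \<alpha> i (g (n - i)))"
  by (simp add: skew_laurent_def coeff_ring_def)

lemma coeff_ring_simps [simp]:
  "carrier (coeff_ring R L) = coeff_funs R"
  "\<zero>\<^bsub>coeff_ring R L\<^esub> = (\<lambda>n. \<zero>\<^bsub>R\<^esub>)"
  "\<one>\<^bsub>coeff_ring R L\<^esub> = skew_monom R \<one>\<^bsub>R\<^esub> 0"
  "f \<oplus>\<^bsub>coeff_ring R L\<^esub> g = (\<lambda>n. f n \<oplus>\<^bsub>R\<^esub> g n)"
  by (simp_all add: coeff_ring_def)

lemma coeff_funs_closed: "f \<in> coeff_funs R \<Longrightarrow> f n \<in> carrier R"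
  by (simp add: coeff_funs_def)

lemma coeff_funs_finite: "f \<in> coeff_funs R \<Longrightarrow> finite {n. f n \<noteq> \<zero>\<^bsub>R\<^esub>}"
  by (simp add: coeff_funs_def)

context ring
begin

lemma coeff_funs_zero: "(\<lambda>n. \<zero>) \<in> coeff_funs R"
  by (simp add: coeff_funs_def)

lemma coeff_funs_add:
  assumes "f \<in> coeff_funs R" "g \<in> coeff_funs R"
  shows "(\<lambda>n. f n \<oplus> g n) \<in> coeff_funs R"
proof -
  have "{n. f n \<oplus> g n \<noteq> \<zero>} \<subseteq> {n. f n \<noteq> \<zero>} \<union> {n. g n \<noteq> \<zero>}"
    by auto
  then show ?thesis
    using assms by (auto simp: coeff_funs_def intro: finite_subset)
qed

lemma coeff_funs_scale:
  assumes "r \<in> carrier R" "f \<in> coeff_funs R"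
  shows "(\<lambda>n. r \<otimes> f n) \<in> coeff_funs R"
proof -
  have "{n. r \<otimes> f n \<noteq> \<zero>} \<subseteq> {n. f n \<noteq> \<zero>}"
    using assms by auto
  then show ?thesis
    using assms by (auto simp: coeff_funs_def intro: finite_subset)
qed

lemma skew_monom_closed: "r \<in> carrier R \<Longrightarrow> skew_monom R r i \<in> coeff_funs R"
proof -
  assume "r \<in> carrier R"
  moreover have "{n. skew_monom R r i n \<noteq> \<zero>} \<subseteq> {i}"
    by (auto simp: skew_monom_def)
  ultimately show ?thesis
    by (auto simp: coeff_funs_def skew_monom_def intro: finite_subset)
qed

lemma skew_monom_zero: "skew_monom R \<zero> i = (\<lambda>n. \<zero>)"
  by (auto simp: skew_monom_def)

lemma skew_monom_add:
  "\<lbrakk>r \<in> carrier R; s \<in> carrier R\<rbrakk> \<Longrightarrow>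
    skew_monom R (r \<oplus> s) i = (\<lambda>n. skew_monom R r i n \<oplus> skew_monom R s i n)"
  by (auto simp: skew_monom_def)

text \<open>The support is emptied one point at a time. The step carries no freshness condition on
  i, which suits properties that are additive in f.\<close>

lemma coeff_funs_induct [consumes 1, case_names zero add]:
  assumes f: "f \<in> coeff_funs R"
    and zero: "P (\<lambda>n. \<zero>)"
    and add: "\<And>f r i. \<lbrakk>f \<in> coeff_funs R; r \<in> carrier R; P f\<rbrakk> \<Longrightarrow>
      P (\<lambda>n. f n \<oplus> skew_monom R r i n)"
  shows "P f"
proof -
  have "\<forall>f. f \<in> coeff_funs R \<and> {n. f n \<noteq> \<zero>} = A \<longrightarrow> P f" if "finite A" for A
    using that
  proof (induction A rule: finite_induct)
    case empty
    have "f = (\<lambda>n. \<zero>)" if "{n. f n \<noteq> \<zero>} = {}" for f :: "'b \<Rightarrow> 'a"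
      using that by auto
    then show ?case
      using zero by auto
  next
    case (insert i A)
    show ?case
    proof (intro allI impI, elim conjE)
      fix f
      assume f: "f \<in> coeff_funs R" "{n. f n \<noteq> \<zero>} = insert i A"
      have A: "{n. (f(i := \<zero>)) n \<noteq> \<zero>} = A"
        using f(2) insert.hyps by auto
      moreover have f': "f(i := \<zero>) \<in> coeff_funs R"
        unfolding coeff_funs_def A mem_Collect_eq
        using f(1) insert.hyps by (auto simp: coeff_funs_closed)
      ultimately have "P (f(i := \<zero>))"
        using insert.IH by blast
      then have "P (\<lambda>n. (f(i := \<zero>)) n \<oplus> skew_monom R (f i) i n)"
        using f' coeff_funs_closed[OF f(1)] by (intro add)
      moreover have "(\<lambda>n. (f(i := \<zero>)) n \<oplus> skew_monom R (f i) i n) = f"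
        using f(1) by (auto simp: skew_monom_def coeff_funs_closed)
      ultimately show "P f"
        by simp
    qed
  qed
  then show ?thesis
    using f coeff_funs_finite by blast
qed

lemma coeff_ring_abelian_group: "abelian_group (coeff_ring R L)"
proof (rule abelian_groupI)
  fix f
  assume "f \<in> carrier (coeff_ring R L)"
  then have f: "f \<in> coeff_funs R"
    by simp
  have "\<ominus> \<one> \<otimes> f n \<oplus> f n = \<zero>" for n
    using coeff_funs_closed[OF f] by (simp add: l_minus l_neg)
  moreover have "(\<lambda>n. \<ominus> \<one> \<otimes> f n) \<in> coeff_funs R"
    using f by (intro coeff_funs_scale) auto
  ultimately show "\<exists>g\<in>carrier (coeff_ring R L).
      g \<oplus>\<^bsub>coeff_ring R L\<^esub> f = \<zero>\<^bsub>coeff_ring R L\<^esub>"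
    by (intro bexI[of _ "\<lambda>n. \<ominus> \<one> \<otimes> f n"]) auto
qed (auto simp: coeff_funs_add coeff_funs_zero coeff_funs_closed a_ac)

lemma finsum_coeff_ring:
  assumes "finite A" "F \<in> A \<rightarrow> coeff_funs R"
  shows "finsum (coeff_ring R L) F A = (\<lambda>n. \<Oplus>i\<in>A. F i n)"
  using assms
proof (induction A rule: finite_induct)
  case empty
  interpret C: abelian_group "coeff_ring R L"
    by (rule coeff_ring_abelian_group)
  show ?case
    by (simp add: C.finsum_empty finsum_empty)
next
  case (insert a A)
  interpret C: abelian_group "coeff_ring R L"
    by (rule coeff_ring_abelian_group)
  have "F i n \<in> carrier R" if "i \<in> insert a A" for i n
    using insert.prems that by (intro coeff_funs_closed) auto
  then have "(\<Oplus>i\<in>insert a A. F i n) = F a n \<oplus> (\<Oplus>i\<in>A. F i n)" for n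
    using insert.hyps by (intro finsum_insert) auto
  then show ?case
    using insert by (subst C.finsum_insert) auto
qed

end

text \<open>
  If \<open>R\<close> acts on \<open>M\<close> and the index \<open>i\<close> acts as \<open>W i\<close>, then \<open>f\<close> acts as \<open>\<Sum>i. f i (W i m)\<close>. Taking \<open>M\<close> to be
  the ring of coefficient functions gives associativity of its product, taking \<open>M\<close> to be
  another ring gives the universal property of skew polynomial rings.
\<close>

locale coeff_action = R: ring R + M: abelian_group M
  for R :: "('r, 'x) ring_scheme" and M :: "('m, 'y) ring_scheme"
    and act :: "'r \<Rightarrow> 'm \<Rightarrow> 'm" and W :: "'i::zero \<Rightarrow> 'm \<Rightarrow> 'm" +
  assumes act_closed [simp]: "\<lbrakk>r \<in> carrier R; m \<in> carrier M\<rbrakk> \<Longrightarrow> act r m \<in> carrier M"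
    and act_add_left: "\<lbrakk>r \<in> carrier R; s \<in> carrier R; m \<in> carrier M\<rbrakk> \<Longrightarrow>
      act (r \<oplus>\<^bsub>R\<^esub> s) m = act r m \<oplus>\<^bsub>M\<^esub> act s m"
    and act_add_right: "\<lbrakk>r \<in> carrier R; m \<in> carrier M; m' \<in> carrier M\<rbrakk> \<Longrightarrow>
      act r (m \<oplus>\<^bsub>M\<^esub> m') = act r m \<oplus>\<^bsub>M\<^esub> act r m'"
    and act_mult: "\<lbrakk>r \<in> carrier R; s \<in> carrier R; m \<in> carrier M\<rbrakk> \<Longrightarrow>
      act (r \<otimes>\<^bsub>R\<^esub> s) m = act r (act s m)"
    and W_closed [simp]: "m \<in> carrier M \<Longrightarrow> W i m \<in> carrier M"
    and W_add: "\<lbrakk>m \<in> carrier M; m' \<in> carrier M\<rbrakk> \<Longrightarrow> W i (m \<oplus>\<^bsub>M\<^esub> m') = W i m \<oplus>\<^bsub>M\<^esub> W i m'"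
begin

definition eval :: "('i \<Rightarrow> 'r) \<Rightarrow> 'm \<Rightarrow> 'm"
  where "eval f m = (\<Oplus>\<^bsub>M\<^esub>i\<in>{i. f i \<noteq> \<zero>\<^bsub>R\<^esub>}. act (f i) (W i m))"

lemma act_zero_left [simp]: "m \<in> carrier M \<Longrightarrow> act \<zero>\<^bsub>R\<^esub> m = \<zero>\<^bsub>M\<^esub>"
  using act_add_left[of "\<zero>\<^bsub>R\<^esub>" "\<zero>\<^bsub>R\<^esub>" m] by (simp add: M.add.l_cancel_one')

lemma act_zero_right [simp]: "r \<in> carrier R \<Longrightarrow> act r \<zero>\<^bsub>M\<^esub> = \<zero>\<^bsub>M\<^esub>"
  using act_add_right[of r "\<zero>\<^bsub>M\<^esub>" "\<zero>\<^bsub>M\<^esub>"] by (simp add: M.add.l_cancel_one')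

lemma W_zero [simp]: "W i \<zero>\<^bsub>M\<^esub> = \<zero>\<^bsub>M\<^esub>"
  using W_add[of "\<zero>\<^bsub>M\<^esub>" "\<zero>\<^bsub>M\<^esub>" i] by (simp add: M.add.l_cancel_one')

lemma eval_superset:
  assumes "f \<in> coeff_funs R" "m \<in> carrier M" "finite A" "{i. f i \<noteq> \<zero>\<^bsub>R\<^esub>} \<subseteq> A"
  shows "eval f m = (\<Oplus>\<^bsub>M\<^esub>i\<in>A. act (f i) (W i m))"
  unfolding eval_def
  using assms by (intro M.add.finprod_mono_neutral_cong_left) (auto simp: coeff_funs_closed)

lemma eval_closed [simp]: "\<lbrakk>f \<in> coeff_funs R; m \<in> carrier M\<rbrakk> \<Longrightarrow> eval f m \<in> carrier M"
  unfolding eval_def by (intro M.finsum_closed) (auto simp: coeff_funs_closed)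

lemma eval_zero [simp]: "eval (\<lambda>n. \<zero>\<^bsub>R\<^esub>) m = \<zero>\<^bsub>M\<^esub>"
  by (simp add: eval_def)

lemma eval_add_left:
  assumes f: "f \<in> coeff_funs R" and g: "g \<in> coeff_funs R" and m: "m \<in> carrier M"
  shows "eval (\<lambda>n. f n \<oplus>\<^bsub>R\<^esub> g n) m = eval f m \<oplus>\<^bsub>M\<^esub> eval g m"
proof -
  define A where "A = {i. f i \<noteq> \<zero>\<^bsub>R\<^esub>} \<union> {i. g i \<noteq> \<zero>\<^bsub>R\<^esub>}"
  have A: "finite A" "{i. f i \<noteq> \<zero>\<^bsub>R\<^esub>} \<subseteq> A" "{i. g i \<noteq> \<zero>\<^bsub>R\<^esub>} \<subseteq> A"
    "{i. f i \<oplus>\<^bsub>R\<^esub> g i \<noteq> \<zero>\<^bsub>R\<^esub>} \<subseteq> A"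
    using f g by (auto simp: A_def coeff_funs_finite)
  have "eval (\<lambda>n. f n \<oplus>\<^bsub>R\<^esub> g n) m
      = (\<Oplus>\<^bsub>M\<^esub>i\<in>A. act (f i) (W i m) \<oplus>\<^bsub>M\<^esub> act (g i) (W i m))"
    using f g m A by (subst eval_superset[of _ _ A])
      (auto simp: R.coeff_funs_add coeff_funs_closed act_add_left intro!: M.finsum_cong')
  also have "\<dots> = eval f m \<oplus>\<^bsub>M\<^esub> eval g m"
    using f g m A by (subst M.finsum_addf) (auto simp: eval_superset[of _ _ A] coeff_funs_closed)
  finally show ?thesis .
qed

lemma eval_add_right:
  assumes f: "f \<in> coeff_funs R" and m: "m \<in> carrier M" "m' \<in> carrier M"
  shows "eval f (m \<oplus>\<^bsub>M\<^esub> m') = eval f m \<oplus>\<^bsub>M\<^esub> eval f m'"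
proof -
  have "eval f (m \<oplus>\<^bsub>M\<^esub> m')
      = (\<Oplus>\<^bsub>M\<^esub>i\<in>{i. f i \<noteq> \<zero>\<^bsub>R\<^esub>}. act (f i) (W i m) \<oplus>\<^bsub>M\<^esub> act (f i) (W i m'))"
    using f m unfolding eval_def
    by (intro M.finsum_cong') (auto simp: coeff_funs_closed W_add act_add_right)
  then show ?thesis
    using f m by (subst (asm) M.finsum_addf) (auto simp: eval_def coeff_funs_closed)
qed

lemma eval_monom [simp]:
  assumes "r \<in> carrier R" "m \<in> carrier M"
  shows "eval (skew_monom R r i) m = act r (W i m)"
proof -
  have "eval (skew_monom R r i) m = (\<Oplus>\<^bsub>M\<^esub>j\<in>{i}. act (skew_monom R r i j) (W j m))"
    using assms by (intro eval_superset R.skew_monom_closed) (auto simp: skew_monom_def)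
  then show ?thesis
    using assms by (simp add: M.finsum_insert M.finsum_empty skew_monom_def)
qed

lemma eval_scale:
  assumes r: "r \<in> carrier R" and f: "f \<in> coeff_funs R" and m: "m \<in> carrier M"
  shows "eval (\<lambda>n. r \<otimes>\<^bsub>R\<^esub> f n) m = act r (eval f m)"
  using f
proof (induction rule: R.coeff_funs_induct)
  case zero
  then show ?case
    using r m by simp
next
  case (add f s i)
  have "(\<lambda>n. r \<otimes>\<^bsub>R\<^esub> (f n \<oplus>\<^bsub>R\<^esub> skew_monom R s i n))
      = (\<lambda>n. r \<otimes>\<^bsub>R\<^esub> f n \<oplus>\<^bsub>R\<^esub> skew_monom R (r \<otimes>\<^bsub>R\<^esub> s) i n)"
    using r add by (auto simp: R.r_distr coeff_funs_closed skew_monom_def)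
  then show ?case
    using r m add by (simp add: eval_add_left R.coeff_funs_scale R.skew_monom_closed
        act_add_right act_mult)
qed

end

section \<open>Multiplication of coefficient functions as an action of the ring on itself\<close>

locale coeff_mult = R: ring R
  for R :: "('r, 'x) ring_scheme" and L :: "'i::zero \<Rightarrow> ('i \<Rightarrow> 'r) \<Rightarrow> 'i \<Rightarrow> 'r" +
  assumes L_closed: "f \<in> coeff_funs R \<Longrightarrow> L i f \<in> coeff_funs R"
    and L_add: "\<lbrakk>f \<in> coeff_funs R; g \<in> coeff_funs R\<rbrakk> \<Longrightarrow>
      L i (\<lambda>n. f n \<oplus>\<^bsub>R\<^esub> g n) = (\<lambda>n. L i f n \<oplus>\<^bsub>R\<^esub> L i g n)"
begin

abbreviation "C \<equiv> coeff_ring R L"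

sublocale C: abelian_group C
  by (rule R.coeff_ring_abelian_group)

text \<open>The product of f and g is the evaluation of f at g for this action. Closure and both
  distributive laws become instances of facts about actions, available before associativity is
  known.\<close>

sublocale self: coeff_action R C "\<lambda>r f n. r \<otimes>\<^bsub>R\<^esub> f n" L
  by unfold_locales
    (auto simp: R.coeff_funs_scale L_closed L_add R.l_distr R.r_distr R.m_assoc coeff_funs_closed)

lemma self_eval: "\<lbrakk>f \<in> coeff_funs R; g \<in> coeff_funs R\<rbrakk> \<Longrightarrow> self.eval f g = f \<otimes>\<^bsub>C\<^esub> g"
  unfolding self.eval_def
  by (subst R.finsum_coeff_ring)
    (auto simp: coeff_funs_finite coeff_funs_closed L_closed R.coeff_funs_scale coeff_ring_def)

lemma mult_closed: "\<lbrakk>f \<in> coeff_funs R; g \<in> coeff_funs R\<rbrakk> \<Longrightarrow> f \<otimes>\<^bsub>C\<^esub> g \<in> coeff_funs R"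
  using self.eval_closed[of f g] by (simp add: self_eval)

lemma mult_zero_left: "(\<lambda>n. \<zero>\<^bsub>R\<^esub>) \<otimes>\<^bsub>C\<^esub> g = (\<lambda>n. \<zero>\<^bsub>R\<^esub>)"
  by (simp add: coeff_ring_def)

lemma mult_add_left:
  "\<lbrakk>f \<in> coeff_funs R; f' \<in> coeff_funs R; g \<in> coeff_funs R\<rbrakk> \<Longrightarrow>
    (\<lambda>n. f n \<oplus>\<^bsub>R\<^esub> f' n) \<otimes>\<^bsub>C\<^esub> g = (\<lambda>n. (f \<otimes>\<^bsub>C\<^esub> g) n \<oplus>\<^bsub>R\<^esub> (f' \<otimes>\<^bsub>C\<^esub> g) n)"
  using self.eval_add_left[of f f' g] by (simp add: self_eval R.coeff_funs_add)

lemma mult_add_right: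
  "\<lbrakk>f \<in> coeff_funs R; g \<in> coeff_funs R; g' \<in> coeff_funs R\<rbrakk> \<Longrightarrow>
    f \<otimes>\<^bsub>C\<^esub> (\<lambda>n. g n \<oplus>\<^bsub>R\<^esub> g' n) = (\<lambda>n. (f \<otimes>\<^bsub>C\<^esub> g) n \<oplus>\<^bsub>R\<^esub> (f \<otimes>\<^bsub>C\<^esub> g') n)"
  using self.eval_add_right[of f g g'] by (simp add: self_eval R.coeff_funs_add)

lemma monom_mult:
  "\<lbrakk>r \<in> carrier R; g \<in> coeff_funs R\<rbrakk> \<Longrightarrow>
    skew_monom R r i \<otimes>\<^bsub>C\<^esub> g = (\<lambda>n. r \<otimes>\<^bsub>R\<^esub> L i g n)"
  using self.eval_monom[of r g i] by (simp add: self_eval R.skew_monom_closed)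

text \<open>Both sides are additive in f, so f may be a monomial r z^i; there the claim is the
  assumption on \<open>W i\<close>, scaled by r. The commutation rule of a particular ring enters
  through that assumption only.\<close>

lemma eval_mult:
  assumes "coeff_action R M act W"
    and W: "\<And>i g m. \<lbrakk>g \<in> coeff_funs R; m \<in> carrier M\<rbrakk> \<Longrightarrow>
      W i (coeff_action.eval R M act W g m) = coeff_action.eval R M act W (L i g) m"
    and f: "f \<in> coeff_funs R" and g: "g \<in> coeff_funs R" and m: "m \<in> carrier M"
  shows "coeff_action.eval R M act W (f \<otimes>\<^bsub>C\<^esub> g) m
    = coeff_action.eval R M act W f (coeff_action.eval R M act W g m)"
proof -
  interpret A: coeff_action R M act W
    by fact
  show ?thesis
    using f
  proof (induction rule: R.coeff_funs_induct)
    case zero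
    then show ?case
      using g m by (simp add: mult_zero_left)
  next
    case (add f r i)
    then show ?case
      using g m by (simp add: mult_add_left R.skew_monom_closed A.eval_add_left mult_closed
          monom_mult A.eval_scale L_closed W R.coeff_funs_scale)
  qed
qed

text \<open>Associativity is \<open>eval_mult\<close> for the ring acting on itself: its
  compatibility assumption turns into \<open>L_mult\<close>. The two unit laws come from
  \<open>L_0\<close> and \<open>L_one\<close>.\<close>

lemma coeff_ring_is_ring:
  assumes L_0: "\<And>f. f \<in> coeff_funs R \<Longrightarrow> L 0 f = f"
    and L_one: "\<And>i. L i (skew_monom R \<one>\<^bsub>R\<^esub> 0) = skew_monom R \<one>\<^bsub>R\<^esub> i"
    and L_mult: "\<And>i f g. \<lbrakk>f \<in> coeff_funs R; g \<in> coeff_funs R\<rbrakk> \<Longrightarrow>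
      L i (f \<otimes>\<^bsub>C\<^esub> g) = L i f \<otimes>\<^bsub>C\<^esub> g"
  shows "ring C"
proof (rule ringI)
  show "abelian_group C"
    by (rule C.abelian_group_axioms)
  have one_right: "f \<otimes>\<^bsub>C\<^esub> skew_monom R \<one>\<^bsub>R\<^esub> 0 = f" if "f \<in> coeff_funs R" for f
    using that
  proof (induction rule: R.coeff_funs_induct)
    case zero
    then show ?case
      by (rule mult_zero_left)
  next
    case (add f r i)
    then have "(\<lambda>n. r \<otimes>\<^bsub>R\<^esub> skew_monom R \<one>\<^bsub>R\<^esub> i n) = skew_monom R r i"
      by (auto simp: skew_monom_def)
    with add show ?case
      by (simp add: mult_add_left monom_mult R.skew_monom_closed L_one)
  qed
  show "monoid C"
  proof (rule monoidI)
    fix f g h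
    assume "f \<in> carrier C" "g \<in> carrier C" "h \<in> carrier C"
    moreover have "self.eval (f \<otimes>\<^bsub>C\<^esub> g) h = self.eval f (self.eval g h)"
      if "f \<in> coeff_funs R" "g \<in> coeff_funs R" "h \<in> coeff_funs R"
      using that by (intro eval_mult) (simp_all add: self.coeff_action_axioms self_eval L_mult L_closed)
    ultimately show "f \<otimes>\<^bsub>C\<^esub> g \<otimes>\<^bsub>C\<^esub> h = f \<otimes>\<^bsub>C\<^esub> (g \<otimes>\<^bsub>C\<^esub> h)"
      by (simp add: self_eval mult_closed)
  next
    fix f
    assume "f \<in> carrier C"
    then have f: "f \<in> coeff_funs R"
      by simp
    show "\<one>\<^bsub>C\<^esub> \<otimes>\<^bsub>C\<^esub> f = f"
      using f by (simp add: monom_mult L_0 coeff_funs_closed)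
    show "f \<otimes>\<^bsub>C\<^esub> \<one>\<^bsub>C\<^esub> = f"
      using f by (simp add: one_right)
  qed (simp_all add: mult_closed R.skew_monom_closed)
qed (simp_all add: mult_add_left mult_add_right)

end

section \<open>Skew polynomial rings\<close>

locale ore = R: ring R
  for R :: "('r, 'x) ring_scheme" and \<sigma> \<delta> :: "'r \<Rightarrow> 'r" +
  assumes sigma_hom: "\<sigma> \<in> ring_hom R R"
    and derivation: "skew_derivation R \<sigma> \<delta>"
begin

abbreviation "lm \<equiv> skew_lmult R \<sigma> \<delta>"

lemma sigma_closed [simp]: "r \<in> carrier R \<Longrightarrow> \<sigma> r \<in> carrier R"
  using sigma_hom by (rule ring_hom_closed)

lemma delta_closed [simp]: "r \<in> carrier R \<Longrightarrow> \<delta> r \<in> carrier R"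
  using derivation by (auto simp: skew_derivation_def)

lemma delta_add: "\<lbrakk>r \<in> carrier R; s \<in> carrier R\<rbrakk> \<Longrightarrow> \<delta> (r \<oplus>\<^bsub>R\<^esub> s) = \<delta> r \<oplus>\<^bsub>R\<^esub> \<delta> s"
  using derivation by (auto simp: skew_derivation_def)

lemma delta_mult: "\<lbrakk>r \<in> carrier R; s \<in> carrier R\<rbrakk> \<Longrightarrow>
    \<delta> (r \<otimes>\<^bsub>R\<^esub> s) = \<sigma> r \<otimes>\<^bsub>R\<^esub> \<delta> s \<oplus>\<^bsub>R\<^esub> \<delta> r \<otimes>\<^bsub>R\<^esub> s"
  using derivation by (auto simp: skew_derivation_def)

lemma sigma_add: "\<lbrakk>r \<in> carrier R; s \<in> carrier R\<rbrakk> \<Longrightarrow> \<sigma> (r \<oplus>\<^bsub>R\<^esub> s) = \<sigma> r \<oplus>\<^bsub>R\<^esub> \<sigma> s"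
  using sigma_hom by (rule ring_hom_add)

lemma sigma_mult: "\<lbrakk>r \<in> carrier R; s \<in> carrier R\<rbrakk> \<Longrightarrow> \<sigma> (r \<otimes>\<^bsub>R\<^esub> s) = \<sigma> r \<otimes>\<^bsub>R\<^esub> \<sigma> s"
  using sigma_hom by (rule ring_hom_mult)

lemma sigma_one [simp]: "\<sigma> \<one>\<^bsub>R\<^esub> = \<one>\<^bsub>R\<^esub>"
  using sigma_hom by (rule ring_hom_one)

lemma sigma_zero [simp]: "\<sigma> \<zero>\<^bsub>R\<^esub> = \<zero>\<^bsub>R\<^esub>"
  using sigma_add[of "\<zero>\<^bsub>R\<^esub>" "\<zero>\<^bsub>R\<^esub>"] by (simp add: R.add.l_cancel_one')

lemma delta_zero [simp]: "\<delta> \<zero>\<^bsub>R\<^esub> = \<zero>\<^bsub>R\<^esub>"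
  using delta_add[of "\<zero>\<^bsub>R\<^esub>" "\<zero>\<^bsub>R\<^esub>"] by (simp add: R.add.l_cancel_one')

lemma delta_one [simp]: "\<delta> \<one>\<^bsub>R\<^esub> = \<zero>\<^bsub>R\<^esub>"
  using delta_mult[of "\<one>\<^bsub>R\<^esub>" "\<one>\<^bsub>R\<^esub>"] by (simp add: R.add.l_cancel_one')

lemma lm_zero [simp]: "lm (\<lambda>n. \<zero>\<^bsub>R\<^esub>) = (\<lambda>n. \<zero>\<^bsub>R\<^esub>)"
  by (auto simp: skew_lmult_def split: nat.split)

lemma lm_add:
  assumes "f \<in> coeff_funs R" "g \<in> coeff_funs R"
  shows "lm (\<lambda>n. f n \<oplus>\<^bsub>R\<^esub> g n) = (\<lambda>n. lm f n \<oplus>\<^bsub>R\<^esub> lm g n)"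
proof
  fix n
  have "f m \<in> carrier R" "g m \<in> carrier R" for m
    using assms by (simp_all add: coeff_funs_closed)
  then show "lm (\<lambda>n. f n \<oplus>\<^bsub>R\<^esub> g n) n = lm f n \<oplus>\<^bsub>R\<^esub> lm g n"
    by (cases n) (simp_all add: skew_lmult_def delta_add sigma_add R.a_ac)
qed

lemma lm_monom:
  assumes "r \<in> carrier R"
  shows "lm (skew_monom R r i)
    = (\<lambda>n. skew_monom R (\<sigma> r) (Suc i) n \<oplus>\<^bsub>R\<^esub> skew_monom R (\<delta> r) i n)"
  using assms by (auto simp: skew_lmult_def skew_monom_def split: nat.split)

lemma lm_closed: "f \<in> coeff_funs R \<Longrightarrow> lm f \<in> coeff_funs R"
proof (induction rule: R.coeff_funs_induct)
  case zero
  then show ?case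
    by (simp add: R.coeff_funs_zero)
next
  case (add f r i)
  then show ?case
    by (simp add: lm_add lm_monom R.skew_monom_closed R.coeff_funs_add)
qed

lemma lm_power_closed: "f \<in> coeff_funs R \<Longrightarrow> (lm ^^ i) f \<in> coeff_funs R"
  by (induction i) (simp_all add: lm_closed)

lemma lm_power_one: "(lm ^^ i) (skew_monom R \<one>\<^bsub>R\<^esub> 0) = skew_monom R \<one>\<^bsub>R\<^esub> i"
proof (induction i)
  case (Suc i)
  have "lm (skew_monom R \<one>\<^bsub>R\<^esub> i) = skew_monom R \<one>\<^bsub>R\<^esub> (Suc i)"
    by (auto simp: lm_monom) (auto simp: skew_monom_def)
  with Suc show ?case
    by simp
qed simp

sublocale mult: coeff_mult R "\<lambda>i. lm ^^ i"
proof unfold_locales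
  fix f g :: "nat \<Rightarrow> 'r" and i
  assume "f \<in> coeff_funs R" "g \<in> coeff_funs R"
  then show "(lm ^^ i) (\<lambda>n. f n \<oplus>\<^bsub>R\<^esub> g n) = (\<lambda>n. (lm ^^ i) f n \<oplus>\<^bsub>R\<^esub> (lm ^^ i) g n)"
    by (induction i) (simp_all add: lm_add lm_power_closed)
qed (rule lm_power_closed)

abbreviation "P \<equiv> skew_poly R \<sigma> \<delta>"

lemma P_eq: "P = mult.C"
  by (rule skew_poly_eq)

text \<open>The assumption on w says that it commutes past scalars exactly as z does, so applying w
  to the value of g amounts to evaluating z g. With M the ring itself this gives associativity, with
  M a target ring the universal property.\<close>

lemma eval_lm:
  assumes "coeff_action R M act (\<lambda>i. w ^^ i)"
    and w: "\<And>r m. \<lbrakk>r \<in> carrier R; m \<in> carrier M\<rbrakk> \<Longrightarrow>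
      w (act r m) = act (\<sigma> r) (w m) \<oplus>\<^bsub>M\<^esub> act (\<delta> r) m"
    and g: "g \<in> coeff_funs R" and m: "m \<in> carrier M"
  shows "(w ^^ i) (coeff_action.eval R M act (\<lambda>i. w ^^ i) g m)
    = coeff_action.eval R M act (\<lambda>i. w ^^ i) ((lm ^^ i) g) m"
proof -
  interpret A: coeff_action R M act "\<lambda>i. w ^^ i"
    by fact
  have w_add: "w (m \<oplus>\<^bsub>M\<^esub> m') = w m \<oplus>\<^bsub>M\<^esub> w m'" if "m \<in> carrier M" "m' \<in> carrier M" for m m'
    using A.W_add[OF that, of 1] by simp
  have w_closed: "(w ^^ i) m \<in> carrier M" "w m \<in> carrier M" if "m \<in> carrier M" for m i
    using A.W_closed[OF that] A.W_closed[OF that, of 1] by simp_all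
  have step: "w (A.eval g m) = A.eval (lm g) m" if "g \<in> coeff_funs R" for g
    using that
  proof (induction rule: R.coeff_funs_induct)
    case zero
    then show ?case
      using A.W_zero[of 1] by simp
  next
    case (add f r i)
    then show ?case
      using m by (simp add: A.eval_add_left R.skew_monom_closed w_add w w_closed lm_add lm_closed
          lm_monom R.coeff_funs_add)
  qed
  show ?thesis
    using g by (induction i) (simp_all add: step lm_power_closed)
qed

lemma P_ring: "ring P"
  unfolding P_eq
proof (rule mult.coeff_ring_is_ring)
  fix i and f g :: "nat \<Rightarrow> 'r"
  assume fg: "f \<in> coeff_funs R" "g \<in> coeff_funs R"
  have "(lm ^^ i) (mult.self.eval f g) = mult.self.eval ((lm ^^ i) f) g"
  proof (rule eval_lm)
    fix r m
    assume r: "r \<in> carrier R" and "m \<in> carrier mult.C"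
    then have m: "m n \<in> carrier R" for n
      by (simp add: coeff_funs_closed)
    have "lm (\<lambda>n. r \<otimes>\<^bsub>R\<^esub> m n) n = \<sigma> r \<otimes>\<^bsub>R\<^esub> lm m n \<oplus>\<^bsub>R\<^esub> \<delta> r \<otimes>\<^bsub>R\<^esub> m n" for n
      using r m by (cases n) (simp_all add: skew_lmult_def delta_mult sigma_mult R.r_distr R.m_assoc R.a_ac)
    then show "lm (\<lambda>n. r \<otimes>\<^bsub>R\<^esub> m n)
        = (\<lambda>n. \<sigma> r \<otimes>\<^bsub>R\<^esub> lm m n) \<oplus>\<^bsub>mult.C\<^esub> (\<lambda>n. \<delta> r \<otimes>\<^bsub>R\<^esub> m n)"
      by (simp add: fun_eq_iff)
  qed (use fg in \<open>simp_all add: mult.self.coeff_action_axioms\<close>)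
  then show "(lm ^^ i) (f \<otimes>\<^bsub>mult.C\<^esub> g) = (lm ^^ i) f \<otimes>\<^bsub>mult.C\<^esub> g"
    using fg by (simp add: mult.self_eval lm_power_closed)
qed (simp_all add: lm_power_one)

sublocale P: ring P
  by (rule P_ring)

lemma P_simps:
  "carrier P = coeff_funs R"
  "\<zero>\<^bsub>P\<^esub> = (\<lambda>n. \<zero>\<^bsub>R\<^esub>)"
  "\<one>\<^bsub>P\<^esub> = skew_monom R \<one>\<^bsub>R\<^esub> 0"
  "f \<oplus>\<^bsub>P\<^esub> g = (\<lambda>n. f n \<oplus>\<^bsub>R\<^esub> g n)"
  by (simp_all add: P_eq)

lemma const_mult: "\<lbrakk>r \<in> carrier R; g \<in> coeff_funs R\<rbrakk> \<Longrightarrow>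
    skew_monom R r 0 \<otimes>\<^bsub>P\<^esub> g = (\<lambda>n. r \<otimes>\<^bsub>R\<^esub> g n)"
  by (simp add: P_eq mult.monom_mult)

lemma const_mult_monom: "\<lbrakk>r \<in> carrier R; s \<in> carrier R\<rbrakk> \<Longrightarrow>
    skew_monom R r 0 \<otimes>\<^bsub>P\<^esub> skew_monom R s i = skew_monom R (r \<otimes>\<^bsub>R\<^esub> s) i"
  by (auto simp: const_mult R.skew_monom_closed) (auto simp: skew_monom_def)

lemma var_mult: "g \<in> coeff_funs R \<Longrightarrow> skew_monom R \<one>\<^bsub>R\<^esub> (Suc 0) \<otimes>\<^bsub>P\<^esub> g = lm g"
  using lm_closed[of g] by (simp add: P_eq mult.monom_mult coeff_funs_closed)

lemma var_mult_const:
  "r \<in> carrier R \<Longrightarrow> skew_monom R \<one>\<^bsub>R\<^esub> 1 \<otimes>\<^bsub>P\<^esub> skew_monom R r 0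
    = skew_monom R (\<sigma> r) 0 \<otimes>\<^bsub>P\<^esub> skew_monom R \<one>\<^bsub>R\<^esub> 1 \<oplus>\<^bsub>P\<^esub> skew_monom R (\<delta> r) 0"
  by (simp add: var_mult R.skew_monom_closed lm_monom const_mult_monom P_simps)

text \<open>Coefficients stand on the left, so multiplying by z on the right only shifts exponents;
  \<sigma> and \<delta> are not involved.\<close>

lemma mult_var:
  "f \<in> coeff_funs R \<Longrightarrow>
    f \<otimes>\<^bsub>P\<^esub> skew_monom R \<one>\<^bsub>R\<^esub> (Suc 0) = (\<lambda>n. case n of 0 \<Rightarrow> \<zero>\<^bsub>R\<^esub> | Suc m \<Rightarrow> f m)"
proof (induction rule: R.coeff_funs_induct)
  case zero
  then show ?case
    by (auto simp: P_eq mult.mult_zero_left split: nat.split)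
next
  case (add f r i)
  have "(lm ^^ i) (skew_monom R \<one>\<^bsub>R\<^esub> (Suc 0)) = skew_monom R \<one>\<^bsub>R\<^esub> (Suc i)"
    using lm_power_one[of "Suc i"] lm_power_one[of 1] by (simp add: funpow_swap1)
  then show ?case
    using add by (simp add: P_eq mult.mult_add_left mult.monom_mult R.skew_monom_closed)
      (auto simp: fun_eq_iff skew_monom_def coeff_funs_closed split: nat.split)
qed

lemma const_hom: "(\<lambda>r. skew_monom R r 0) \<in> ring_hom R P"
  by (rule ring_hom_memI)
    (simp_all add: P_simps R.skew_monom_closed const_mult_monom R.skew_monom_add)

text \<open>The power z^i is reached by repeated left multiplication by z, and every element is a
  finite sum of terms r z^i. With H the set of elements that have a given property this becomes an
  induction rule.\<close>

lemma P_generated: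
  assumes const: "\<And>r. r \<in> carrier R \<Longrightarrow> skew_monom R r 0 \<in> H"
    and var: "skew_monom R \<one>\<^bsub>R\<^esub> 1 \<in> H"
    and add: "\<And>f g. \<lbrakk>f \<in> carrier P; g \<in> carrier P; f \<in> H; g \<in> H\<rbrakk> \<Longrightarrow> f \<oplus>\<^bsub>P\<^esub> g \<in> H"
    and mult: "\<And>f g. \<lbrakk>f \<in> carrier P; g \<in> carrier P; f \<in> H; g \<in> H\<rbrakk> \<Longrightarrow> f \<otimes>\<^bsub>P\<^esub> g \<in> H"
    and f: "f \<in> carrier P"
  shows "f \<in> H"
proof -
  have monom_one: "skew_monom R \<one>\<^bsub>R\<^esub> i \<in> H" for i
  proof (induction i)
    case 0
    then show ?case
      by (simp add: const)
  next
    case (Suc i)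
    have "skew_monom R \<one>\<^bsub>R\<^esub> 1 \<otimes>\<^bsub>P\<^esub> skew_monom R \<one>\<^bsub>R\<^esub> i \<in> H"
      using Suc by (intro mult var) (simp_all add: P_simps R.skew_monom_closed)
    then show ?case
      using lm_power_one[of "Suc i"] by (simp add: var_mult R.skew_monom_closed lm_power_one)
  qed
  have monom: "skew_monom R r i \<in> H" if "r \<in> carrier R" for r i
    using mult[OF _ _ const[OF that] monom_one, of i] that
    by (simp add: P_simps R.skew_monom_closed const_mult_monom)
  have "f \<in> coeff_funs R"
    using f by (simp add: P_simps)
  then show ?thesis
  proof (induction rule: R.coeff_funs_induct)
    case zero
    then show ?case
      using monom[of "\<zero>\<^bsub>R\<^esub>" 0] by (simp add: R.skew_monom_zero)
  next
    case (add f r i)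
    then show ?case
      using assms(3)[of f "skew_monom R r i"] monom[of r i]
      by (simp add: P_simps R.skew_monom_closed)
  qed
qed

text \<open>The centralizer of r is closed under sums and products and contains R. It contains z
  because z r = \<sigma>(r) z + \<delta>(r) = r z.\<close>

lemma const_central:
  assumes r: "r \<in> carrier R" "\<And>s. s \<in> carrier R \<Longrightarrow> s \<otimes>\<^bsub>R\<^esub> r = r \<otimes>\<^bsub>R\<^esub> s" "\<sigma> r = r" "\<delta> r = \<zero>\<^bsub>R\<^esub>"
    and f: "f \<in> carrier P"
  shows "f \<otimes>\<^bsub>P\<^esub> skew_monom R r 0 = skew_monom R r 0 \<otimes>\<^bsub>P\<^esub> f"
proof -
  let ?r = "skew_monom R r 0"
  have r_closed: "?r \<in> carrier P"
    using ring_hom_closed[OF const_hom] r(1) by blast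
  have "f \<in> {f. f \<otimes>\<^bsub>P\<^esub> ?r = ?r \<otimes>\<^bsub>P\<^esub> f}"
  proof (rule P_generated[OF _ _ _ _ f])
    fix s
    assume "s \<in> carrier R"
    then show "skew_monom R s 0 \<in> {f. f \<otimes>\<^bsub>P\<^esub> ?r = ?r \<otimes>\<^bsub>P\<^esub> f}"
      using r by (simp add: const_mult_monom)
  next
    show "skew_monom R \<one>\<^bsub>R\<^esub> 1 \<in> {f. f \<otimes>\<^bsub>P\<^esub> ?r = ?r \<otimes>\<^bsub>P\<^esub> f}"
      using r by (simp add: var_mult_const[simplified] const_mult_monom P_simps)
        (auto simp: skew_monom_def)
  next
    fix f g
    assume "f \<in> carrier P" "g \<in> carrier P" "f \<in> {f. f \<otimes>\<^bsub>P\<^esub> ?r = ?r \<otimes>\<^bsub>P\<^esub> f}"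
      "g \<in> {f. f \<otimes>\<^bsub>P\<^esub> ?r = ?r \<otimes>\<^bsub>P\<^esub> f}"
    then have *: "f \<in> carrier P" "g \<in> carrier P" "f \<otimes>\<^bsub>P\<^esub> ?r = ?r \<otimes>\<^bsub>P\<^esub> f"
      "g \<otimes>\<^bsub>P\<^esub> ?r = ?r \<otimes>\<^bsub>P\<^esub> g"
      by simp_all
    show "f \<oplus>\<^bsub>P\<^esub> g \<in> {f. f \<otimes>\<^bsub>P\<^esub> ?r = ?r \<otimes>\<^bsub>P\<^esub> f}"
      unfolding mem_Collect_eq P.l_distr[OF *(1,2) r_closed] P.r_distr[OF *(1,2) r_closed] *(3,4) ..
    have "f \<otimes>\<^bsub>P\<^esub> g \<otimes>\<^bsub>P\<^esub> ?r = f \<otimes>\<^bsub>P\<^esub> ?r \<otimes>\<^bsub>P\<^esub> g"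
      unfolding P.m_assoc[OF *(1,2) r_closed] P.m_assoc[OF *(1) r_closed *(2)] *(4) ..
    then show "f \<otimes>\<^bsub>P\<^esub> g \<in> {f. f \<otimes>\<^bsub>P\<^esub> ?r = ?r \<otimes>\<^bsub>P\<^esub> f}"
      unfolding mem_Collect_eq *(3) P.m_assoc[OF r_closed *(1,2)] .
  qed
  then show ?thesis
    by simp
qed

text \<open>This is the universal property: \<phi> makes Q an R-module on which z acts as left
  multiplication by w, and the homomorphism is evaluation at 1.\<close>

lemma hom_exists:
  assumes "ring Q" and phi: "\<phi> \<in> ring_hom R Q" and w: "w \<in> carrier Q"
    and comm: "\<And>r. r \<in> carrier R \<Longrightarrow> w \<otimes>\<^bsub>Q\<^esub> \<phi> r = \<phi> (\<sigma> r) \<otimes>\<^bsub>Q\<^esub> w \<oplus>\<^bsub>Q\<^esub> \<phi> (\<delta> r)"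
  obtains \<Phi> where "\<Phi> \<in> ring_hom P Q" "\<And>r. r \<in> carrier R \<Longrightarrow> \<Phi> (skew_monom R r 0) = \<phi> r"
    "\<Phi> (skew_monom R \<one>\<^bsub>R\<^esub> 1) = w"
proof -
  interpret Q: ring Q
    by fact
  have phi_closed [simp]: "\<phi> r \<in> carrier Q" if "r \<in> carrier R" for r
    using phi that by (rule ring_hom_closed)
  have w_closed [simp]: "(((\<otimes>\<^bsub>Q\<^esub>) w) ^^ i) m \<in> carrier Q" if "m \<in> carrier Q" for i m
    using that w by (induction i) auto
  have w_add: "(((\<otimes>\<^bsub>Q\<^esub>) w) ^^ i) (m \<oplus>\<^bsub>Q\<^esub> m') = (((\<otimes>\<^bsub>Q\<^esub>) w) ^^ i) m \<oplus>\<^bsub>Q\<^esub> (((\<otimes>\<^bsub>Q\<^esub>) w) ^^ i) m'"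
    if "m \<in> carrier Q" "m' \<in> carrier Q" for i m m'
    using that w by (induction i) (auto simp: Q.r_distr)
  have w_mult: "(((\<otimes>\<^bsub>Q\<^esub>) w) ^^ i) (m \<otimes>\<^bsub>Q\<^esub> m') = (((\<otimes>\<^bsub>Q\<^esub>) w) ^^ i) m \<otimes>\<^bsub>Q\<^esub> m'"
    if "m \<in> carrier Q" "m' \<in> carrier Q" for i m m'
    using that w by (induction i) (auto simp: Q.m_assoc)
  interpret A: coeff_action R Q "\<lambda>r m. \<phi> r \<otimes>\<^bsub>Q\<^esub> m" "\<lambda>i. ((\<otimes>\<^bsub>Q\<^esub>) w) ^^ i"
    by unfold_locales (auto simp: w_add ring_hom_add[OF phi] ring_hom_mult[OF phi]
        Q.l_distr Q.r_distr Q.m_assoc)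
  \<comment> \<open>Left multiplications by w and by values of \<phi> commute with right
    multiplication by m. This turns the composition law for evaluations into a product of
    values.\<close>
  have eval_one: "A.eval f m = A.eval f \<one>\<^bsub>Q\<^esub> \<otimes>\<^bsub>Q\<^esub> m" if "f \<in> coeff_funs R" "m \<in> carrier Q" for f m
    using that(1)
  proof (induction rule: R.coeff_funs_induct)
    case zero
    then show ?case
      using that by simp
  next
    case (add f r i)
    then show ?case
      using that(2) w_mult[of "\<one>\<^bsub>Q\<^esub>" m i] by (simp add: A.eval_add_left R.skew_monom_closed Q.l_distr Q.m_assoc)
  qed
  have eval_mult: "A.eval (f \<otimes>\<^bsub>P\<^esub> g) m = A.eval f (A.eval g m)"
    if "f \<in> coeff_funs R" "g \<in> coeff_funs R" "m \<in> carrier Q" for f g m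
    unfolding P_eq
  proof (rule mult.eval_mult[OF A.coeff_action_axioms _ that])
    fix i m and g :: "nat \<Rightarrow> 'r"
    assume "g \<in> coeff_funs R" "m \<in> carrier Q"
    then show "(((\<otimes>\<^bsub>Q\<^esub>) w) ^^ i) (A.eval g m) = A.eval ((lm ^^ i) g) m"
      using w by (intro eval_lm[OF A.coeff_action_axioms])
        (simp_all add: comm Q.l_distr flip: Q.m_assoc)
  qed
  show ?thesis
  proof (rule that)
    show "(\<lambda>f. A.eval f \<one>\<^bsub>Q\<^esub>) \<in> ring_hom P Q"
    proof (rule ring_hom_memI)
      fix f g
      assume "f \<in> carrier P" "g \<in> carrier P"
      then show "A.eval (f \<otimes>\<^bsub>P\<^esub> g) \<one>\<^bsub>Q\<^esub> = A.eval f \<one>\<^bsub>Q\<^esub> \<otimes>\<^bsub>Q\<^esub> A.eval g \<one>\<^bsub>Q\<^esub>"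
        by (simp add: P_simps eval_mult eval_one[of f "A.eval g \<one>\<^bsub>Q\<^esub>"])
    qed (simp_all add: P_simps A.eval_add_left ring_hom_one[OF phi])
  qed (use w in \<open>simp_all add: ring_hom_one[OF phi]\<close>)
qed

end

section \<open>The free algebra and its quotient \<open>T\<close>\<close>

lemma ring_of_type_simps [simp]:
  "carrier (ring_of_type_algebra :: 'b::ring_1 ring) = UNIV"
  "x \<otimes>\<^bsub>ring_of_type_algebra\<^esub> y = (x * y :: 'b)"
  "x \<oplus>\<^bsub>ring_of_type_algebra\<^esub> y = (x + y :: 'b)"
  "\<one>\<^bsub>ring_of_type_algebra\<^esub> = (1 :: 'b)"
  "\<zero>\<^bsub>ring_of_type_algebra\<^esub> = (0 :: 'b)"
  by (simp_all add: ring_of_type_algebra_def)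

lemma ring_of_type: "ring (ring_of_type_algebra :: 'b::ring_1 ring)"
proof -
  have "\<exists>y. x + y = 0" for x :: 'b
    using add.right_inverse by blast
  then show ?thesis
    unfolding ring_of_type_algebra_def using add.right_inverse
    by unfold_locales (auto simp: algebra_simps Units_def)
qed

lemma minus_ring_of_type:
  "a_minus (ring_of_type_algebra :: 'b::ring_1 ring) x y = x - y"
proof -
  interpret ring "ring_of_type_algebra :: 'b ring"
    by (rule ring_of_type)
  have "\<ominus>\<^bsub>ring_of_type_algebra\<^esub> y = - y"
    by (rule minus_equality) auto
  then show ?thesis
    by (simp add: a_minus_def)
qed

lemma poly_mapping_single_induct [case_names zero add]:
  assumes "P 0" "\<And>p k c. P p \<Longrightarrow> P (p + Poly_Mapping.single k c)"
  shows "P (p :: 'k \<Rightarrow>\<^sub>0 'b::comm_monoid_add)"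
proof (induction p rule: update_induct)
  case const
  then show ?case
    using assms(1) by simp
next
  case (update p k c)
  have "Poly_Mapping.update k c p = p + Poly_Mapping.single k c"
    using update.hyps
    by (intro poly_mapping_eqI) (auto simp: lookup_add lookup_single lookup_update in_keys_iff)
  then show ?case
    using update assms(2) by simp
qed

lemma free_const_simps [simp]:
  "free_const 0 = 0" "free_const 1 = 1" "free_const (numeral k) = numeral k"
  by (simp_all add: free_const_def)

lemma free_const_hom: "free_const \<in> ring_hom ring_of_type_algebra free_ring"
  by (rule ring_hom_memI) (simp_all add: free_const_def mult_single single_add)

lemma free_alg_induct [case_names const gen add mult]:
  fixes p :: "'a::field free_alg"
  assumes const: "\<And>c. P (free_const c)" and gen: "\<And>v. P (free_gen v)"
    and add: "\<And>p q. \<lbrakk>P p; P q\<rbrakk> \<Longrightarrow> P (p + q)" and mult: "\<And>p q. \<lbrakk>P p; P q\<rbrakk> \<Longrightarrow> P (p * q)"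
  shows "P p"
proof (induction p rule: poly_mapping_single_induct)
  case zero
  then show ?case
    using const[of 0] by simp
next
  case (add p k c)
  have word: "P (Poly_Mapping.single (Word l) 1)" for l
  proof (induction l)
    case Nil
    then show ?case
      using const[of 1] by (simp add: zero_word_def[symmetric])
  next
    case (Cons v l)
    have "(Poly_Mapping.single (Word (v # l)) 1 :: 'a free_alg)
        = free_gen v * Poly_Mapping.single (Word l) 1"
      by (simp add: free_gen_def mult_single)
    with Cons show ?case
      using mult[OF gen] by simp
  qed
  obtain l where l: "k = Word l"
    by (cases k)
  have "Poly_Mapping.single k c = free_const c * Poly_Mapping.single (Word l) 1"
    by (simp add: free_const_def mult_single l)
  then show ?case
    using add assms(3) mult[OF const word] by simp
qed

text \<open>The generators may take arbitrary values, but constants have to become central: in a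
  product of two terms the second coefficient must pass the first word.\<close>

locale free_eval = Q: ring Q for Q :: "('q, 'x) ring_scheme" (structure) +
  fixes \<eta> :: "'a::field \<Rightarrow> 'q" and gv :: "gen \<Rightarrow> 'q"
  assumes eta_hom: "\<eta> \<in> ring_hom ring_of_type_algebra Q"
    and eta_comm: "q \<in> carrier Q \<Longrightarrow> q \<otimes> \<eta> c = \<eta> c \<otimes> q"
    and X_closed [simp]: "gv v \<in> carrier Q"
begin

lemma eta_closed [simp]: "\<eta> c \<in> carrier Q"
  using ring_hom_closed[OF eta_hom] by simp

lemma eta_simps:
  "\<eta> (c + d) = \<eta> c \<oplus> \<eta> d" "\<eta> (c * d) = \<eta> c \<otimes> \<eta> d" "\<eta> 1 = \<one>"
  using ring_hom_add[OF eta_hom, of c d] ring_hom_mult[OF eta_hom, of c d]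
    ring_hom_one[OF eta_hom] by simp_all

fun word_val :: "gen word \<Rightarrow> 'q"
  where "word_val (Word l) = foldr (\<lambda>v q. gv v \<otimes> q) l \<one>"

lemma foldr_X: "q \<in> carrier Q \<Longrightarrow>
    foldr (\<lambda>v q. gv v \<otimes> q) l q = foldr (\<lambda>v q. gv v \<otimes> q) l \<one> \<otimes> q"
  and foldr_X_closed: "q \<in> carrier Q \<Longrightarrow> foldr (\<lambda>v q. gv v \<otimes> q) l q \<in> carrier Q"
proof -
  have closed: "foldr (\<lambda>v q. gv v \<otimes> q) l q \<in> carrier Q" if "q \<in> carrier Q" for l q
    using that by (induction l) auto
  show "q \<in> carrier Q \<Longrightarrow> foldr (\<lambda>v q. gv v \<otimes> q) l q \<in> carrier Q"
    by (rule closed)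
  show "q \<in> carrier Q \<Longrightarrow>
      foldr (\<lambda>v q. gv v \<otimes> q) l q = foldr (\<lambda>v q. gv v \<otimes> q) l \<one> \<otimes> q"
    by (induction l) (auto simp: Q.m_assoc closed)
qed

lemma word_val_closed [simp]: "word_val w \<in> carrier Q"
  by (cases w) (simp add: foldr_X_closed)

lemma word_val_add: "word_val (w + w') = word_val w \<otimes> word_val w'"
  by (cases w; cases w') (simp add: foldr_X[of "foldr _ _ _"] foldr_X_closed)

lemma word_val_zero [simp]: "word_val 0 = \<one>"
  by (simp add: zero_word_def)

text \<open>An element of the free algebra is a finitely supported function on words. With words as
  indices, acting by left multiplication by their values, the linear extension is the evaluation
  already available for coefficient functions.\<close>

interpretation A: coeff_action ring_of_type_algebra Q "\<lambda>c m. \<eta> c \<otimes> m" "\<lambda>w m. word_val w \<otimes> m"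
proof -
  interpret F: ring "ring_of_type_algebra :: 'a ring"
    by (rule ring_of_type)
  show "coeff_action (ring_of_type_algebra :: 'a ring) Q (\<lambda>c m. \<eta> c \<otimes> m) (\<lambda>w m. word_val w \<otimes> m)"
    by unfold_locales (auto simp: eta_simps Q.l_distr Q.r_distr Q.m_assoc)
qed

definition ev :: "'a free_alg \<Rightarrow> 'q"
  where "ev p = A.eval (Poly_Mapping.lookup p) \<one>"

lemma lookup_coeff_funs: "Poly_Mapping.lookup (p :: 'a free_alg) \<in> coeff_funs ring_of_type_algebra"
  by (simp add: coeff_funs_def)

lemma ev_closed [simp]: "ev p \<in> carrier Q"
  by (simp add: ev_def lookup_coeff_funs)

lemma ev_add [simp]: "ev (p + q) = ev p \<oplus> ev q"
proof -
  have "Poly_Mapping.lookup (p + q)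
      = (\<lambda>n. Poly_Mapping.lookup p n \<oplus>\<^bsub>ring_of_type_algebra\<^esub> Poly_Mapping.lookup q n)"
    by (auto simp: lookup_add)
  then show ?thesis
    unfolding ev_def by (subst A.eval_add_left[symmetric]) (auto simp: lookup_coeff_funs)
qed

lemma ev_single: "ev (Poly_Mapping.single w c) = \<eta> c \<otimes> word_val w"
proof -
  have "Poly_Mapping.lookup (Poly_Mapping.single w c) = skew_monom ring_of_type_algebra c w"
    by (auto simp: lookup_single skew_monom_def)
  then show ?thesis
    by (simp add: ev_def)
qed

lemma ev_zero [simp]: "ev 0 = \<zero>"
  using ev_add[of 0 0] by (simp add: Q.add.l_cancel_one')

lemma ev_mult [simp]: "ev (p * q) = ev p \<otimes> ev q"
proof (induction p rule: poly_mapping_single_induct)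
  case zero
  then show ?case
    by simp
next
  case (add p w c)
  have "ev (Poly_Mapping.single w c * q) = ev (Poly_Mapping.single w c) \<otimes> ev q"
  proof (induction q rule: poly_mapping_single_induct)
    case zero
    then show ?case
      by simp
  next
    case (add q w' c')
    have "\<eta> c \<otimes> word_val w \<otimes> (\<eta> c' \<otimes> word_val w')
        = \<eta> c \<otimes> (word_val w \<otimes> \<eta> c') \<otimes> word_val w'"
      by (simp add: Q.m_assoc)
    then have "ev (Poly_Mapping.single w c * Poly_Mapping.single w' c')
        = ev (Poly_Mapping.single w c) \<otimes> ev (Poly_Mapping.single w' c')"
      by (simp add: mult_single ev_single word_val_add eta_simps eta_comm[of "word_val w"] Q.m_assoc)
    with add show ?case
      by (simp add: distrib_left Q.r_distr)
  qed
  with add show ?case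
    by (simp add: distrib_right Q.l_distr)
qed

lemma ev_const [simp]: "ev (free_const c) = \<eta> c"
  by (simp add: free_const_def ev_single)

lemma ev_one [simp]: "ev 1 = \<one>"
  using ev_const[of 1] by (simp add: eta_simps)

lemma ev_numeral [simp]: "ev (numeral k) = \<eta> (numeral k)"
  using ev_const[of "numeral k"] by simp

lemma ev_gen [simp]: "ev (free_gen v) = gv v"
  by (simp add: free_gen_def ev_single eta_simps)

lemma ev_power2 [simp]: "ev (p ^ 2) = ev p \<otimes> ev p"
  by (simp add: power2_eq_square)

lemma ev_power3 [simp]: "ev (p ^ 3) = ev p \<otimes> (ev p \<otimes> ev p)"
  by (simp add: power3_eq_cube Q.m_assoc)

lemma ev_diff [simp]: "ev (p - q) = ev p \<ominus> ev q"
proof -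
  have "ev p = ev (p - q) \<oplus> ev q"
    using ev_add[of "p - q" q] by simp
  then show ?thesis
    by (simp add: Q.minus_eq Q.a_assoc Q.r_neg)
qed

lemma ev_hom: "ev \<in> ring_hom free_ring Q"
  by (rule ring_hom_memI) simp_all

end

interpretation free: ring "free_ring :: 'a::field free_alg ring"
  by (rule ring_of_type)

lemma ideal_T_ideal: "ideal (T_ideal :: 'a::field free_alg set) free_ring"
  unfolding T_ideal_def by (rule free.genideal_ideal) simp

interpretation T: ring "T_ring :: 'a::field free_alg set ring"
  unfolding T_ring_def by (rule ideal.quotient_is_ring[OF ideal_T_ideal])

lemma T_class_hom: "T_class \<in> ring_hom free_ring T_ring"
  unfolding T_class_def T_ring_def using ideal.rcos_ring_hom[OF ideal_T_ideal] by simp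

lemma T_class_closed [simp]: "T_class p \<in> carrier T_ring"
  using ring_hom_closed[OF T_class_hom] by simp

lemma T_class_simps:
  "T_class (p + q) = T_class p \<oplus>\<^bsub>T_ring\<^esub> T_class q"
  "T_class (p * q) = T_class p \<otimes>\<^bsub>T_ring\<^esub> T_class q"
  "T_class 1 = \<one>\<^bsub>T_ring\<^esub>"
  using ring_hom_add[OF T_class_hom, of p q] ring_hom_mult[OF T_class_hom, of p q]
    ring_hom_one[OF T_class_hom] by simp_all

lemma T_class_surj:
  assumes "x \<in> carrier T_ring"
  obtains p where "x = T_class p"
  using assms unfolding T_ring_def FactRing_def A_RCOSETS_def' T_class_def by auto

lemma T_class_eq_iff: "T_class p = T_class q \<longleftrightarrow> p - q \<in> T_ideal"
  using free.quotient_eq_iff_same_a_r_cos[OF ideal_T_ideal, of p q]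
  by (simp add: T_class_def minus_ring_of_type)

lemma T_class_zero: "T_class 0 = \<zero>\<^bsub>T_ring\<^esub>"
  using T_class_simps(1)[of 0 0] by (simp add: T.add.l_cancel_one')

lemma T_generated:
  assumes const: "\<And>c. T_const c \<in> H" and gen: "\<And>v. T_gen v \<in> H"
    and add: "\<And>x y. \<lbrakk>x \<in> carrier T_ring; y \<in> carrier T_ring; x \<in> H; y \<in> H\<rbrakk> \<Longrightarrow> x \<oplus>\<^bsub>T_ring\<^esub> y \<in> H"
    and mult: "\<And>x y. \<lbrakk>x \<in> carrier T_ring; y \<in> carrier T_ring; x \<in> H; y \<in> H\<rbrakk> \<Longrightarrow> x \<otimes>\<^bsub>T_ring\<^esub> y \<in> H"
    and x: "x \<in> carrier T_ring"
  shows "x \<in> H"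
proof -
  have "T_class p \<in> H" for p
    by (induction p rule: free_alg_induct)
      (use assms in \<open>auto simp: T_class_simps simp flip: T_const_def T_gen_def\<close>)
  then show ?thesis
    using x by (auto elim: T_class_surj)
qed

text \<open>Evaluation kills the relators, so its kernel is an ideal that contains
  \<open>T_ideal\<close>. In the assumptions each term of a relation stands on the side where its
  sign is positive, so that they can be checked in Q without subtraction; the relators are regrouped
  to match.\<close>

lemma (in free_eval) T_hom_exists:
  defines "t \<equiv> gv Gen_t" and "x1 \<equiv> gv Gen_x1" and "x2 \<equiv> gv Gen_x2" and "x3 \<equiv> gv Gen_x3"
  assumes t: "x1 \<otimes> t = t \<otimes> x1" "x2 \<otimes> t = t \<otimes> x2" "x3 \<otimes> t = t \<otimes> x3"
    and x12: "x1 \<otimes> x2 \<oplus> \<eta> 2 \<otimes> t \<otimes> x3 \<otimes> x1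
      = x2 \<otimes> x1 \<oplus> \<eta> 3 \<otimes> (t \<otimes> t) \<otimes> x2 \<oplus> \<eta> 2 \<otimes> (t \<otimes> (t \<otimes> t)) \<otimes> x3"
    and x23: "x2 \<otimes> x3 \<oplus> t \<otimes> (x3 \<otimes> x3) = x3 \<otimes> x2 \<oplus> \<eta> 4 \<otimes> t"
    and x13: "x1 \<otimes> x3 \<oplus> (t \<otimes> t \<otimes> x3 \<oplus> \<eta> 2 \<otimes> t \<otimes> x2) = x3 \<otimes> x1"
  obtains \<Phi> where "\<Phi> \<in> ring_hom T_ring Q" "\<And>p. \<Phi> (T_class p) = ev p"
proof -
  note defs = t_def x1_def x2_def x3_def
  have ev_eq: "ev (p - q) = \<zero>" if "ev p = ev q" for p q
    using that by (simp add: Q.minus_eq Q.r_neg)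
  define ft :: "'a free_alg" where "ft = free_gen Gen_t"
  define f1 :: "'a free_alg" where "f1 = free_gen Gen_x1"
  define f2 :: "'a free_alg" where "f2 = free_gen Gen_x2"
  define f3 :: "'a free_alg" where "f3 = free_gen Gen_x3"
  note fdefs = ft_def f1_def f2_def f3_def
  have relators: "T_relators = {f1 * ft - ft * f1, f2 * ft - ft * f2, f3 * ft - ft * f3,
      (f1 * f2 + 2 * ft * f3 * f1) - (f2 * f1 + 3 * ft ^ 2 * f2 + 2 * ft ^ 3 * f3),
      (f2 * f3 + ft * f3 ^ 2) - (f3 * f2 + 4 * ft),
      (f1 * f3 + (ft ^ 2 * f3 + 2 * ft * f2)) - f3 * f1}"
    by (simp add: T_relators_def Let_def fdefs algebra_simps)
  have "T_relators \<subseteq> a_kernel free_ring Q ev"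
    unfolding relators a_kernel_def' using t x12 x23 x13
    by (auto intro!: ev_eq simp del: ev_diff simp add: fdefs defs)
  moreover have "ideal (a_kernel free_ring Q ev) free_ring"
    by (rule ring_hom_ring.kernel_is_ideal) (unfold_locales, rule ev_hom)
  ultimately have "T_ideal \<subseteq> a_kernel free_ring Q ev"
    unfolding T_ideal_def by (intro free.genideal_minimal)
  then have ev_T: "ev p = ev q" if "T_class p = T_class q" for p q
    using that ev_add[of "p - q" q] unfolding T_class_eq_iff
    by (auto simp: a_kernel_def' simp del: ev_diff ev_add)
  \<comment> \<open>An arbitrary representative is chosen; \<open>ev_T\<close> makes the value
    independent of the choice.\<close>
  define \<Phi> :: "'a free_alg set \<Rightarrow> 'q" where "\<Phi> x = ev (SOME p. T_class p = x)" for x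
  have \<Phi>: "\<Phi> (T_class p) = ev p" for p
    unfolding \<Phi>_def by (rule ev_T) (rule someI, rule refl)
  have "\<Phi> \<in> ring_hom T_ring Q"
  proof (rule ring_hom_memI)
    fix x y :: "'a free_alg set"
    assume "x \<in> carrier T_ring" "y \<in> carrier T_ring"
    then obtain p q where xy: "x = T_class p" "y = T_class q"
      using T_class_surj by metis
    show "\<Phi> (x \<otimes>\<^bsub>T_ring\<^esub> y) = \<Phi> x \<otimes> \<Phi> y"
      by (simp add: xy \<Phi> flip: T_class_simps)
    show "\<Phi> (x \<oplus>\<^bsub>T_ring\<^esub> y) = \<Phi> x \<oplus> \<Phi> y"
      by (simp add: xy \<Phi> flip: T_class_simps)
    show "\<Phi> x \<in> carrier Q"
      by (simp add: xy \<Phi>)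
  qed (simp add: \<Phi> flip: T_class_simps)
  then show ?thesis
    using \<Phi> that by blast
qed

section \<open>The iterated skew polynomial ring\<close>

definition poly_ev :: "('q, 'x) ring_scheme \<Rightarrow> ('c::comm_ring_1 \<Rightarrow> 'q) \<Rightarrow> 'q \<Rightarrow> 'c poly \<Rightarrow> 'q"
  where "poly_ev Q \<eta> v p = fold_coeffs (\<lambda>a q. \<eta> a \<oplus>\<^bsub>Q\<^esub> q \<otimes>\<^bsub>Q\<^esub> v) p \<zero>\<^bsub>Q\<^esub>"

text \<open>Only additivity of \<eta> is assumed, because \<eta> is also used as b \<mapsto> b(x1)
  x2, which is not multiplicative. Powers of v stand to the right of the coefficients.\<close>

locale poly_eval = Q: ring Q for Q :: "('q, 'x) ring_scheme" (structure) +
  fixes \<eta> :: "'c::comm_ring_1 \<Rightarrow> 'q" and v :: 'q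
  assumes eta_closed [simp]: "\<eta> c \<in> carrier Q" and eta_add: "\<eta> (c + d) = \<eta> c \<oplus> \<eta> d"
    and v_closed [simp]: "v \<in> carrier Q"
begin

lemma eta_zero [simp]: "\<eta> 0 = \<zero>"
  using eta_add[of 0 0] by (simp add: Q.add.l_cancel_one')

lemma poly_ev_zero [simp]: "poly_ev Q \<eta> v 0 = \<zero>"
  by (simp add: poly_ev_def)

lemma poly_ev_pCons [simp]: "poly_ev Q \<eta> v (pCons a p) = \<eta> a \<oplus> poly_ev Q \<eta> v p \<otimes> v"
  by (cases "p = 0 \<and> a = 0") (auto simp: poly_ev_def)

lemma poly_ev_closed [simp]: "poly_ev Q \<eta> v p \<in> carrier Q"
  by (induction p) auto

lemma poly_ev_add [simp]: "poly_ev Q \<eta> v (p + q) = poly_ev Q \<eta> v p \<oplus> poly_ev Q \<eta> v q"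
  by (induction p q rule: poly_induct2) (auto simp: eta_add Q.l_distr Q.a_ac)

lemma poly_ev_smult:
  assumes "q \<in> carrier Q" "\<And>a. q \<otimes> \<eta> a = \<eta> (c * a)"
  shows "q \<otimes> poly_ev Q \<eta> v p = poly_ev Q \<eta> v (smult c p)"
  using assms by (induction p) (simp_all add: Q.r_distr flip: Q.m_assoc)

lemma poly_ev_hom:
  assumes eta: "\<eta> \<in> ring_hom ring_of_type_algebra Q" and comm: "\<And>c. v \<otimes> \<eta> c = \<eta> c \<otimes> v"
  shows "poly_ev Q \<eta> v \<in> ring_hom ring_of_type_algebra Q"
proof -
  have eta_mult: "\<eta> (c * d) = \<eta> c \<otimes> \<eta> d" for c d
    using ring_hom_mult[OF eta, of c d] by simp
  have smult: "poly_ev Q \<eta> v (smult a q) = \<eta> a \<otimes> poly_ev Q \<eta> v q" for a q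
    by (induction q) (auto simp: eta_mult Q.r_distr Q.m_assoc)
  have v_comm: "v \<otimes> poly_ev Q \<eta> v q = poly_ev Q \<eta> v q \<otimes> v" for q
    by (induction q) (auto simp: Q.r_distr Q.l_distr comm simp flip: Q.m_assoc)
  have "poly_ev Q \<eta> v (p * q) = poly_ev Q \<eta> v p \<otimes> poly_ev Q \<eta> v q" for p q
    by (induction p) (auto simp: smult Q.l_distr v_comm Q.m_assoc)
  then show ?thesis
    using ring_hom_one[OF eta] by (intro ring_hom_memI) (auto simp: one_pCons)
qed

lemma poly_ev_comm:
  assumes "q \<in> carrier Q" "\<And>c. q \<otimes> \<eta> c = \<eta> c \<otimes> q" "q \<otimes> v = v \<otimes> q"
  shows "q \<otimes> poly_ev Q \<eta> v p = poly_ev Q \<eta> v p \<otimes> q"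
proof (induction p)
  case (pCons a p)
  have "q \<otimes> (poly_ev Q \<eta> v p \<otimes> v) = poly_ev Q \<eta> v p \<otimes> (v \<otimes> q)"
    using assms(1) pCons by (simp add: assms(3)[symmetric] flip: Q.m_assoc)
  then show ?case
    using assms by (simp add: Q.l_distr Q.r_distr Q.m_assoc)
qed (use assms in simp)

end

text \<open>
  In \<open>'a poly poly\<close> the inner variable \<open>tt\<close> is always \<open>t\<close>; the outer variable \<open>xx\<close> is \<open>x\<^sub>3\<close> in \<open>A\<close>,
  \<open>x\<^sub>1\<close> in \<open>T_k\<close> and \<open>y\<close> in \<open>S\<close>.
\<close>

definition tt :: "'a::field poly poly" where "tt = [:[:0, 1:]:]"
definition xx :: "'a::field poly poly" where "xx = [:0, 1:]"
definition ww :: "'a::field poly poly" where "ww = 4 - xx * xx"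
text \<open>The relation for x2 x3 reads x2 x3 = x3 x2 + t (4 - x3^2). Hence the derivation sends x3
  to t w and t to 0, that is, it is t w d/dx3.\<close>

definition der :: "'a::field poly poly \<Rightarrow> 'a poly poly" where "der p = tt * ww * pderiv p"

lemma poly_poly_induct [case_names const t x add mult]:
  fixes p :: "'a::field poly poly"
  assumes const: "\<And>c. P [:[:c:]:]" and t: "P tt" and x: "P xx"
    and add: "\<And>p q. \<lbrakk>P p; P q\<rbrakk> \<Longrightarrow> P (p + q)" and mult: "\<And>p q. \<lbrakk>P p; P q\<rbrakk> \<Longrightarrow> P (p * q)"
  shows "P p"
proof -
  have inner: "P [:r:]" for r
  proof (induction r)
    case 0
    then show ?case
      using const[of 0] by simp
  next
    case (pCons a r)
    have "[:pCons a r:] = [:[:a:]:] + tt * [:r:]"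
      by (simp add: tt_def)
    then show ?case
      using add[OF const mult[OF t pCons.IH]] by simp
  qed
  show ?thesis
  proof (induction p)
    case 0
    then show ?case
      using const[of 0] by simp
  next
    case (pCons r p)
    have "pCons r p = [:r:] + xx * p"
      by (simp add: xx_def)
    then show ?case
      using add[OF inner mult[OF x pCons.IH]] by simp
  qed
qed

lemma ww_nonzero: "ww \<noteq> 0"
proof -
  have "coeff (ww :: 'a poly poly) 2 = - 1"
    by (simp add: ww_def xx_def numeral_poly numeral_2_eq_2)
  then show ?thesis
    by auto
qed

lemma pderiv_simps:
  "pderiv tt = 0" "pderiv xx = 1" "pderiv (numeral k :: 'a::field poly poly) = 0"
  "pderiv ww = - 2 * xx"
  by (simp_all add: tt_def xx_def ww_def pderiv_pCons pderiv_diff pderiv_mult numeral_poly)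

lemma der_simps:
  "der (p + q) = der p + der q" "der (p - q) = der p - der q" "der (- p) = - der p"
  "der (p * q) = p * der q + der p * q" "der 0 = 0" "der 1 = 0" "der (numeral k) = 0"
  "der tt = 0" "der xx = tt * ww" "der ww = - 2 * xx * (tt * ww)"
  by (simp_all add: der_def pderiv_add pderiv_diff pderiv_minus pderiv_mult pderiv_simps algebra_simps)

text \<open>
  The identity is written \<open>\<lambda>p. p\<close> because the simplifier rewrites \<open>id\<close> to it.
\<close>

lemma der_derivation: "skew_derivation poly2 (\<lambda>p. p) der"
  by (simp add: skew_derivation_def der_simps)

interpretation A: ore "poly2 :: 'a::field poly poly ring" "\<lambda>p. p" der
  by (intro ore.intro ore_axioms.intro ring_of_type der_derivation) (rule ring_hom_memI, simp_all)

section \<open>The ring A and computation with explicit elements\<close>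

abbreviation A_ring :: "(nat \<Rightarrow> 'a::field poly poly) ring"
  where "A_ring \<equiv> skew_poly poly2 (\<lambda>p. p) der"

definition A_c :: "'a::field poly poly \<Rightarrow> nat \<Rightarrow> 'a poly poly" where "A_c p = skew_monom poly2 p 0"
definition A_x :: "nat \<Rightarrow> 'a::field poly poly" where "A_x = skew_monom poly2 1 1"

text \<open>Elements of A are written \<open>coeff F\<close> with F an ordinary polynomial in x2.
  Explicit elements then become coefficient lists, although products in A differ from products of
  such polynomials.\<close>

lemma A_carrier: "carrier A_ring = range coeff"
proof -
  have "f \<in> range coeff" if "finite {n. f n \<noteq> 0}" for f :: "nat \<Rightarrow> 'b::zero poly poly"
  proof -
    have "\<forall>\<^sub>\<infinity>n. f n = 0"
      using that by (simp add: MOST_iff_cofinite)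
    then have "f = coeff (Abs_poly f)"
      by (simp add: Abs_poly_inverse)
    then show ?thesis
      by blast
  qed
  moreover have "finite {n. coeff p n \<noteq> 0}" for p :: "'b::zero poly poly poly"
    using MOST_coeff_eq_0[of p] by (simp add: MOST_iff_cofinite)
  ultimately show ?thesis
    by (auto simp: A.P_simps coeff_funs_def)
qed

lemma A_c_coeff: "A_c p = coeff [:p:]"
  by (auto simp: A_c_def skew_monom_def coeff_pCons split: nat.split)

lemma A_x_coeff: "A_x = coeff [:0, 1:]"
  by (auto simp: A_x_def skew_monom_def coeff_pCons split: nat.split)

lemma A_coeff_closed [simp]: "coeff F \<in> carrier A_ring"
  by (simp add: A_carrier)

lemma A_coeff_add: "coeff F \<oplus>\<^bsub>A_ring\<^esub> coeff G = coeff (F + G)"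
  by (simp add: A.P_simps fun_eq_iff)

lemma A_coeff_zero: "\<zero>\<^bsub>A_ring\<^esub> = coeff 0"
  by (simp add: A.P_simps fun_eq_iff)

lemma A_coeff_const_mult: "coeff [:p:] \<otimes>\<^bsub>A_ring\<^esub> coeff G = coeff (smult p G)"
  using A_coeff_closed[of G]
  by (simp add: A_c_coeff[symmetric] A_c_def A.const_mult A.P_simps fun_eq_iff)

lemma A_coeff_var_mult: "coeff [:0, 1:] \<otimes>\<^bsub>A_ring\<^esub> coeff G = coeff (pCons 0 G + map_poly der G)"
proof -
  have "A_x \<otimes>\<^bsub>A_ring\<^esub> coeff G = skew_lmult poly2 (\<lambda>p. p) der (coeff G)"
    using A_coeff_closed[of G] A.var_mult[of "coeff G"] by (simp add: A_x_def A.P_simps)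
  also have "\<dots> = coeff (pCons 0 G + map_poly der G)"
    by (auto simp: skew_lmult_def coeff_pCons coeff_map_poly der_simps split: nat.split)
  finally show ?thesis
    by (simp add: A_x_coeff)
qed

text \<open>With the left factor written as p + F x2, the product is p G + F (x2 G), where x2 G is G
  shifted by one plus the coefficientwise derivation of G. As rewrite rules this computes products
  of explicit elements.\<close>

lemma A_coeff_mult:
  "coeff 0 \<otimes>\<^bsub>A_ring\<^esub> coeff G = coeff 0"
  "coeff (pCons p F) \<otimes>\<^bsub>A_ring\<^esub> coeff G
    = coeff (smult p G) \<oplus>\<^bsub>A_ring\<^esub> coeff F \<otimes>\<^bsub>A_ring\<^esub> coeff (pCons 0 G + map_poly der G)"
proof -
  have shift: "coeff F \<otimes>\<^bsub>A_ring\<^esub> coeff [:0, 1:] = coeff (pCons 0 F)"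
    using A_coeff_closed[of F] A.mult_var[of "coeff F"]
    by (simp add: A_x_coeff[symmetric] A_x_def A.P_simps) (simp add: fun_eq_iff coeff_pCons)
  have id: "coeff (pCons p F) = coeff [:p:] \<oplus>\<^bsub>A_ring\<^esub> coeff F \<otimes>\<^bsub>A_ring\<^esub> coeff [:0, 1:]"
    by (simp add: shift A_coeff_add)
  show "coeff 0 \<otimes>\<^bsub>A_ring\<^esub> coeff G = coeff 0"
    using A.P.l_null[OF A_coeff_closed[of G]] by (simp add: A_coeff_zero)
  show "coeff (pCons p F) \<otimes>\<^bsub>A_ring\<^esub> coeff G
    = coeff (smult p G) \<oplus>\<^bsub>A_ring\<^esub> coeff F \<otimes>\<^bsub>A_ring\<^esub> coeff (pCons 0 G + map_poly der G)"
    by (simp add: id A.P.l_distr A_coeff_const_mult A.P.m_assoc A_coeff_var_mult)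
qed

lemma A_induct [consumes 1, case_names const var add mult]:
  assumes "f \<in> carrier A_ring"
    and "\<And>p. P (A_c p)" and "P A_x"
    and "\<And>f g. \<lbrakk>f \<in> carrier A_ring; g \<in> carrier A_ring; P f; P g\<rbrakk> \<Longrightarrow> P (f \<oplus>\<^bsub>A_ring\<^esub> g)"
    and "\<And>f g. \<lbrakk>f \<in> carrier A_ring; g \<in> carrier A_ring; P f; P g\<rbrakk> \<Longrightarrow> P (f \<otimes>\<^bsub>A_ring\<^esub> g)"
  shows "P f"
  using A.P_generated[of "Collect P" f] assms by (simp add: A_c_def A_x_def)

lemma A_c_hom: "A_c \<in> ring_hom poly2 A_ring"
  unfolding A_c_def by (rule A.const_hom)

lemma A_closed [simp]: "A_c p \<in> carrier A_ring" "A_x \<in> carrier A_ring"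
  by (simp_all add: A_c_coeff A_x_coeff)

lemmas A_calc = A_coeff_mult A_coeff_add map_poly_pCons der_simps

section \<open>The automorphism of A\<close>

text \<open>Since k lies in the commutative ring \<F>[t,x3], the element x2 + k satisfies the same
  commutation rule with that ring as x2 does.\<close>

lemma A_shift_exists:
  obtains S where "S \<in> ring_hom A_ring A_ring" "\<And>p. S (A_c p) = A_c p" "S A_x = coeff [:k, 1:]"
proof -
  have comm: "coeff [:k, 1:] \<otimes>\<^bsub>A_ring\<^esub> A_c p
      = A_c p \<otimes>\<^bsub>A_ring\<^esub> coeff [:k, 1:] \<oplus>\<^bsub>A_ring\<^esub> A_c (der p)" for p
    by (simp add: A_c_coeff A_calc) (simp add: algebra_simps)
  show ?thesis
    by (rule A.hom_exists[of A_ring A_c "coeff [:k, 1:]"])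
      (use that comm in \<open>simp_all add: A.P_ring A_c_hom A_c_def A_x_def\<close>)
qed

text \<open>The shift is forced by w: x2 w = w x2 + \<delta>(w) = w (x2 - 2 t x3). The same factor
  stands before x1 in the relation for x1 x2.\<close>

definition A_sigma :: "(nat \<Rightarrow> 'a::field poly poly) \<Rightarrow> nat \<Rightarrow> 'a poly poly"
  where "A_sigma = (SOME S. S \<in> ring_hom A_ring A_ring \<and> (\<forall>p. S (A_c p) = A_c p) \<and>
    S A_x = coeff [:- (2 * tt * xx), 1:])"

lemma A_sigma:
  "A_sigma \<in> ring_hom A_ring A_ring" "A_sigma (A_c p) = A_c p"
  "A_sigma A_x = coeff [:- (2 * tt * xx), 1:]"
proof -
  have "\<exists>S. S \<in> ring_hom A_ring A_ring \<and> (\<forall>p. S (A_c p) = A_c p) \<and>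
    S A_x = coeff [:- (2 * tt * xx), 1:]"
    using A_shift_exists[of "- (2 * tt * xx)"] by metis
  from someI_ex[OF this]
  show "A_sigma \<in> ring_hom A_ring A_ring" "A_sigma (A_c p) = A_c p"
    "A_sigma A_x = coeff [:- (2 * tt * xx), 1:]"
    unfolding A_sigma_def by blast+
qed

lemma A_sigma_closed [simp]: "f \<in> carrier A_ring \<Longrightarrow> A_sigma f \<in> carrier A_ring"
  using A_sigma(1) by (rule ring_hom_closed)

lemma A_sigma_iso: "A_sigma \<in> ring_iso A_ring (A_ring :: (nat \<Rightarrow> 'b::field poly poly) ring)"
proof -
  obtain S :: "(nat \<Rightarrow> 'b::field poly poly) \<Rightarrow> nat \<Rightarrow> 'b poly poly" where S: "S \<in> ring_hom A_ring A_ring" "\<And>p. S (A_c p) = A_c p"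
    "S A_x = coeff [:2 * tt * xx, 1:]"
    using A_shift_exists by blast
  have split: "coeff [:p, 1:] = A_c p \<oplus>\<^bsub>A_ring\<^esub> A_x" for p :: "'b::field poly poly"
    by (simp add: A_c_coeff A_x_coeff A_coeff_add)
  \<comment> \<open>Shifts by -k and by k cancel on x2. The fact is stated for arbitrary k because
    it is used with \<open>A_sigma\<close> in either position.\<close>
  have inv: "S1 (S2 f) = f"
    if S1: "S1 \<in> ring_hom A_ring A_ring" "\<And>p. S1 (A_c p) = A_c p" "S1 A_x = coeff [:k, 1:]"
      and S2: "S2 \<in> ring_hom A_ring A_ring" "\<And>p. S2 (A_c p) = A_c p" "S2 A_x = coeff [:- k, 1:]"
      and f: "f \<in> carrier A_ring"
    for S1 S2 :: "(nat \<Rightarrow> 'b::field poly poly) \<Rightarrow> nat \<Rightarrow> 'b poly poly" and k f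
    using f
  proof (induction rule: A_induct)
    case var
    have "S1 (S2 A_x) = A_c (- k) \<oplus>\<^bsub>A_ring\<^esub> coeff [:k, 1:]"
      by (simp add: S2 split ring_hom_add[OF S1(1)] S1(2)) (simp add: S1(3) split)
    then show ?case
      by (simp add: A_c_coeff A_x_coeff A_coeff_add)
  next
    case (add f g)
    then show ?case
      by (simp add: ring_hom_add[OF S1(1)] ring_hom_add[OF S2(1)] ring_hom_closed[OF S2(1)])
  next
    case (mult f g)
    then show ?case
      by (simp add: ring_hom_mult[OF S1(1)] ring_hom_mult[OF S2(1)] ring_hom_closed[OF S2(1)])
  qed (simp add: S1 S2)
  have "bij_betw A_sigma (carrier A_ring) (carrier (A_ring :: (nat \<Rightarrow> 'b::field poly poly) ring))"
  proof (rule bij_betw_byWitness[where f' = S])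
    show "\<forall>f\<in>carrier A_ring. S (A_sigma f) = f"
      using inv[OF S A_sigma] by blast
    show "\<forall>f\<in>carrier A_ring. A_sigma (S f) = f"
      using inv[OF A_sigma S(1,2)] S(3) by simp
    show "A_sigma ` carrier A_ring \<subseteq> carrier (A_ring :: (nat \<Rightarrow> 'b poly poly) ring)"
      by (intro image_subsetI A_sigma_closed)
    show "S ` carrier A_ring \<subseteq> carrier A_ring"
      by (intro image_subsetI ring_hom_closed[OF S(1)])
  qed
  then show ?thesis
    using A_sigma(1) by (simp add: ring_iso_def)
qed

section \<open>Commutation with w and h, and the skew derivation of A\<close>

definition A_w :: "nat \<Rightarrow> 'a::field poly poly" where "A_w = A_c ww"

definition A_h :: "nat \<Rightarrow> 'a::field poly poly"
  where "A_h = coeff [:tt\<^sup>2 * xx\<^sup>2 + 4 * tt\<^sup>2, 3 * tt * xx, 1:]"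

lemma A_wh_closed [simp]: "A_w \<in> carrier A_ring" "A_h \<in> carrier A_ring"
  by (simp_all add: A_w_def A_h_def)

text \<open>Left multiplication by w multiplies every coefficient by a nonzero element of the domain
  \<F>[t,x3].\<close>

lemma A_w_cancel:
  assumes "A_w \<otimes>\<^bsub>A_ring\<^esub> f = A_w \<otimes>\<^bsub>A_ring\<^esub> g" "f \<in> carrier A_ring" "g \<in> carrier A_ring"
  shows "f = g"
proof -
  obtain F G where FG: "f = coeff F" "g = coeff G"
    using assms(2,3) by (auto simp: A_carrier)
  have "smult ww F = smult ww G"
    using assms(1) by (simp add: FG A_w_def A_c_coeff A_coeff_const_mult coeff_inject)
  then show ?thesis
    using smult_cancel[OF ww_nonzero] FG by metis
qed

text \<open>The property passes to products, f g w = f w \<sigma>(g) = w \<sigma>(f) \<sigma>(g), so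
  that only the generators require a computation.\<close>

lemma A_w_normal: "f \<in> carrier A_ring \<Longrightarrow> f \<otimes>\<^bsub>A_ring\<^esub> A_w = A_w \<otimes>\<^bsub>A_ring\<^esub> A_sigma f"
proof (induction rule: A_induct)
  case (const p)
  have "A_c p \<otimes>\<^bsub>A_ring\<^esub> A_w = A_w \<otimes>\<^bsub>A_ring\<^esub> A_c p"
    unfolding A_w_def A_c_coeff A_coeff_const_mult by (simp add: mult.commute)
  then show ?case
    by (simp only: A_sigma)
next
  case var
  have "A_x \<otimes>\<^bsub>A_ring\<^esub> A_w = A_w \<otimes>\<^bsub>A_ring\<^esub> coeff [:- (2 * tt * xx), 1:]"
    unfolding A_w_def A_c_coeff A_x_coeff by (simp add: A_calc) (simp add: algebra_simps)
  then show ?case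
    by (simp only: A_sigma)
next
  case (add f g)
  then show ?case
    by (simp add: ring_hom_add[OF A_sigma(1)] A.P.l_distr A.P.r_distr)
next
  case (mult f g)
  have "f \<otimes>\<^bsub>A_ring\<^esub> g \<otimes>\<^bsub>A_ring\<^esub> A_w = f \<otimes>\<^bsub>A_ring\<^esub> A_w \<otimes>\<^bsub>A_ring\<^esub> A_sigma g"
    using mult(1,2,4) by (simp add: A.P.m_assoc)
  also have "\<dots> = A_w \<otimes>\<^bsub>A_ring\<^esub> A_sigma f \<otimes>\<^bsub>A_ring\<^esub> A_sigma g"
    by (simp only: mult(3))
  finally show ?case
    using mult(1,2) by (simp add: ring_hom_mult[OF A_sigma(1)] A.P.m_assoc)
qed

text \<open>The equation is w d = f h - h f written without subtraction. Cancelling w makes d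
  unique.\<close>

definition A_delta :: "(nat \<Rightarrow> 'a::field poly poly) \<Rightarrow> nat \<Rightarrow> 'a poly poly"
  where "A_delta f = (THE d. d \<in> carrier A_ring \<and>
    f \<otimes>\<^bsub>A_ring\<^esub> A_h = A_h \<otimes>\<^bsub>A_ring\<^esub> f \<oplus>\<^bsub>A_ring\<^esub> A_w \<otimes>\<^bsub>A_ring\<^esub> d)"

lemma A_delta_unique:
  assumes "d \<in> carrier A_ring" "f \<in> carrier A_ring"
    "f \<otimes>\<^bsub>A_ring\<^esub> A_h = A_h \<otimes>\<^bsub>A_ring\<^esub> f \<oplus>\<^bsub>A_ring\<^esub> A_w \<otimes>\<^bsub>A_ring\<^esub> d"
  shows "A_delta f = d"
  unfolding A_delta_def
proof (rule the_equality)
  fix d'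
  assume "d' \<in> carrier A_ring \<and>
    f \<otimes>\<^bsub>A_ring\<^esub> A_h = A_h \<otimes>\<^bsub>A_ring\<^esub> f \<oplus>\<^bsub>A_ring\<^esub> A_w \<otimes>\<^bsub>A_ring\<^esub> d'"
  then have d': "d' \<in> carrier A_ring"
    and "A_h \<otimes>\<^bsub>A_ring\<^esub> f \<oplus>\<^bsub>A_ring\<^esub> A_w \<otimes>\<^bsub>A_ring\<^esub> d'
      = A_h \<otimes>\<^bsub>A_ring\<^esub> f \<oplus>\<^bsub>A_ring\<^esub> A_w \<otimes>\<^bsub>A_ring\<^esub> d"
    using assms(3) by simp_all
  then have "A_w \<otimes>\<^bsub>A_ring\<^esub> d' = A_w \<otimes>\<^bsub>A_ring\<^esub> d"
    using assms(1,2) A.P.add.l_cancel[of "A_h \<otimes>\<^bsub>A_ring\<^esub> f" "A_w \<otimes>\<^bsub>A_ring\<^esub> d'"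
      "A_w \<otimes>\<^bsub>A_ring\<^esub> d"] by simp
  then show "d' = d"
    using d' assms(1) by (rule A_w_cancel)
qed (use assms in simp)

text \<open>
  Where \<open>\<delta>\<^sub>1\<close> comes from on \<open>\<F>[t,x\<^sub>3]\<close>: as \<open>\<delta>(p) = t w p'\<close>, the commutator \<open>p h - h p = - 2 \<delta>(p) x\<^sub>2 - \<delta>\<^sup>2(p) - 3 t x\<^sub>3 \<delta>(p)\<close>
  is divisible by \<open>w\<close>.
\<close>

lemma A_h_const:
  "A_c p \<otimes>\<^bsub>A_ring\<^esub> A_h = A_h \<otimes>\<^bsub>A_ring\<^esub> A_c p \<oplus>\<^bsub>A_ring\<^esub> A_w \<otimes>\<^bsub>A_ring\<^esub>
    coeff [:- tt\<^sup>2 * (ww * pderiv (pderiv p) + xx * pderiv p), - 2 * tt * pderiv p:]"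
  unfolding A_w_def A_h_def A_c_coeff
  by (simp add: A_coeff_mult A_coeff_add map_poly_pCons der_def pderiv_add pderiv_diff
      pderiv_minus pderiv_mult pderiv_simps power2_eq_square) (simp add: algebra_simps)

text \<open>The commutator x2 h - h x2 applies \<delta> to the coefficients of h: it is \<delta>(3 t
  x3) x2 + \<delta>(t^2 x3^2) = w (3 t^2 x2 + 2 t^3 x3). This reproduces the terms of the relation
  for x1 x2 that do not contain x1.\<close>

lemma A_h_var:
  "A_x \<otimes>\<^bsub>A_ring\<^esub> A_h = A_h \<otimes>\<^bsub>A_ring\<^esub> A_x \<oplus>\<^bsub>A_ring\<^esub> A_w \<otimes>\<^bsub>A_ring\<^esub>
    coeff [:2 * tt ^ 3 * xx, 3 * tt\<^sup>2:]"
  unfolding A_w_def A_h_def A_c_coeff A_x_coeff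
  by (simp add: A_calc power2_eq_square power3_eq_cube) (simp add: algebra_simps)

lemma A_delta_const:
  "A_delta (A_c p)
    = coeff [:- tt\<^sup>2 * (ww * pderiv (pderiv p) + xx * pderiv p), - 2 * tt * pderiv p:]"
  by (rule A_delta_unique) (simp_all add: A_h_const)

lemma A_delta_var: "A_delta A_x = coeff [:2 * tt ^ 3 * xx, 3 * tt\<^sup>2:]"
  by (rule A_delta_unique) (simp_all add: A_h_var)

lemma A_delta_add_aux:
  assumes "f \<in> carrier A_ring" "g \<in> carrier A_ring" "d \<in> carrier A_ring" "e \<in> carrier A_ring"
    "f \<otimes>\<^bsub>A_ring\<^esub> A_h = A_h \<otimes>\<^bsub>A_ring\<^esub> f \<oplus>\<^bsub>A_ring\<^esub> A_w \<otimes>\<^bsub>A_ring\<^esub> d"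
    "g \<otimes>\<^bsub>A_ring\<^esub> A_h = A_h \<otimes>\<^bsub>A_ring\<^esub> g \<oplus>\<^bsub>A_ring\<^esub> A_w \<otimes>\<^bsub>A_ring\<^esub> e"
  shows "(f \<oplus>\<^bsub>A_ring\<^esub> g) \<otimes>\<^bsub>A_ring\<^esub> A_h
    = A_h \<otimes>\<^bsub>A_ring\<^esub> (f \<oplus>\<^bsub>A_ring\<^esub> g) \<oplus>\<^bsub>A_ring\<^esub> A_w \<otimes>\<^bsub>A_ring\<^esub> (d \<oplus>\<^bsub>A_ring\<^esub> e)"
  using assms by (simp add: A.P.l_distr A.P.r_distr A.P.a_ac)

text \<open>Here f g h = f (h g + w e) = (h f + w d) g + (f w) e, and moving w to the left of f
  replaces f by \<sigma>(f). This is where the twist in the Leibniz rule comes from.\<close>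

lemma A_delta_mult_aux:
  assumes "f \<in> carrier A_ring" "g \<in> carrier A_ring" "d \<in> carrier A_ring" "e \<in> carrier A_ring"
    "f \<otimes>\<^bsub>A_ring\<^esub> A_h = A_h \<otimes>\<^bsub>A_ring\<^esub> f \<oplus>\<^bsub>A_ring\<^esub> A_w \<otimes>\<^bsub>A_ring\<^esub> d"
    "g \<otimes>\<^bsub>A_ring\<^esub> A_h = A_h \<otimes>\<^bsub>A_ring\<^esub> g \<oplus>\<^bsub>A_ring\<^esub> A_w \<otimes>\<^bsub>A_ring\<^esub> e"
  shows "(f \<otimes>\<^bsub>A_ring\<^esub> g) \<otimes>\<^bsub>A_ring\<^esub> A_h
    = A_h \<otimes>\<^bsub>A_ring\<^esub> (f \<otimes>\<^bsub>A_ring\<^esub> g) \<oplus>\<^bsub>A_ring\<^esub> A_w \<otimes>\<^bsub>A_ring\<^esub>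
      (A_sigma f \<otimes>\<^bsub>A_ring\<^esub> e \<oplus>\<^bsub>A_ring\<^esub> d \<otimes>\<^bsub>A_ring\<^esub> g)"
proof -
  have "f \<otimes>\<^bsub>A_ring\<^esub> g \<otimes>\<^bsub>A_ring\<^esub> A_h
      = f \<otimes>\<^bsub>A_ring\<^esub> A_h \<otimes>\<^bsub>A_ring\<^esub> g \<oplus>\<^bsub>A_ring\<^esub> f \<otimes>\<^bsub>A_ring\<^esub> A_w \<otimes>\<^bsub>A_ring\<^esub> e"
    using assms(1-4) by (simp add: A.P.m_assoc assms(6) A.P.r_distr)
  also have "\<dots> = (A_h \<otimes>\<^bsub>A_ring\<^esub> f \<oplus>\<^bsub>A_ring\<^esub> A_w \<otimes>\<^bsub>A_ring\<^esub> d) \<otimes>\<^bsub>A_ring\<^esub> g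
      \<oplus>\<^bsub>A_ring\<^esub> A_w \<otimes>\<^bsub>A_ring\<^esub> A_sigma f \<otimes>\<^bsub>A_ring\<^esub> e"
    using assms(1) by (simp add: assms(5) A_w_normal)
  finally show ?thesis
    using assms(1-4) by (simp add: A.P.m_assoc A.P.l_distr A.P.r_distr A.P.a_ac)
qed

text \<open>Solutions d are explicit on generators and are carried to sums and products by the two
  auxiliary lemmas; uniqueness identifies them with the chosen value.\<close>

lemma A_delta:
  assumes "f \<in> carrier A_ring"
  shows A_delta_closed: "A_delta f \<in> carrier A_ring"
    and A_delta_h: "f \<otimes>\<^bsub>A_ring\<^esub> A_h
      = A_h \<otimes>\<^bsub>A_ring\<^esub> f \<oplus>\<^bsub>A_ring\<^esub> A_w \<otimes>\<^bsub>A_ring\<^esub> A_delta f"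
proof -
  have "\<exists>d. d \<in> carrier A_ring \<and>
    f \<otimes>\<^bsub>A_ring\<^esub> A_h = A_h \<otimes>\<^bsub>A_ring\<^esub> f \<oplus>\<^bsub>A_ring\<^esub> A_w \<otimes>\<^bsub>A_ring\<^esub> d"
    using assms
  proof (induction rule: A_induct)
    case (const p)
    then show ?case
      by (intro exI conjI, rule A_coeff_closed, rule A_h_const)
  next
    case var
    then show ?case
      by (intro exI conjI, rule A_coeff_closed, rule A_h_var)
  next
    case (add f g)
    then show ?case
      by (elim exE conjE) (intro exI conjI, erule (1) A.P.a_closed, erule (5) A_delta_add_aux)
  next
    case (mult f g)
    then obtain d e where "d \<in> carrier A_ring" "e \<in> carrier A_ring"
      "f \<otimes>\<^bsub>A_ring\<^esub> A_h = A_h \<otimes>\<^bsub>A_ring\<^esub> f \<oplus>\<^bsub>A_ring\<^esub> A_w \<otimes>\<^bsub>A_ring\<^esub> d"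
      "g \<otimes>\<^bsub>A_ring\<^esub> A_h = A_h \<otimes>\<^bsub>A_ring\<^esub> g \<oplus>\<^bsub>A_ring\<^esub> A_w \<otimes>\<^bsub>A_ring\<^esub> e"
      by blast
    note A_delta_mult_aux[OF mult(1,2) this]
    moreover have "A_sigma f \<otimes>\<^bsub>A_ring\<^esub> e \<oplus>\<^bsub>A_ring\<^esub> d \<otimes>\<^bsub>A_ring\<^esub> g \<in> carrier A_ring"
      using mult(1,2) \<open>d \<in> _\<close> \<open>e \<in> _\<close> by simp
    ultimately show ?case
      by (intro exI conjI)
  qed
  then show "A_delta f \<in> carrier A_ring" "f \<otimes>\<^bsub>A_ring\<^esub> A_h
      = A_h \<otimes>\<^bsub>A_ring\<^esub> f \<oplus>\<^bsub>A_ring\<^esub> A_w \<otimes>\<^bsub>A_ring\<^esub> A_delta f"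
    using A_delta_unique[OF _ assms] by auto
qed

text \<open>In each law the right-hand side solves the equation that defines the left-hand side, and
  solutions are unique.\<close>

lemma A_delta_derivation: "skew_derivation A_ring A_sigma A_delta"
  unfolding skew_derivation_def
proof (intro conjI ballI)
  fix f g :: "nat \<Rightarrow> 'a poly poly"
  assume fg: "f \<in> carrier A_ring" "g \<in> carrier A_ring"
  note d = A_delta_closed[OF fg(1)] A_delta_closed[OF fg(2)]
    A_delta_h[OF fg(1)] A_delta_h[OF fg(2)]
  show "A_delta (f \<oplus>\<^bsub>A_ring\<^esub> g) = A_delta f \<oplus>\<^bsub>A_ring\<^esub> A_delta g"
    by (rule A_delta_unique[OF _ _ A_delta_add_aux[OF fg d]]) (use fg d in simp_all)
  show "A_delta (f \<otimes>\<^bsub>A_ring\<^esub> g)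
      = A_sigma f \<otimes>\<^bsub>A_ring\<^esub> A_delta g \<oplus>\<^bsub>A_ring\<^esub> A_delta f \<otimes>\<^bsub>A_ring\<^esub> g"
    by (rule A_delta_unique[OF _ _ A_delta_mult_aux[OF fg d]]) (use fg d in simp_all)
qed (simp add: A_delta_closed)

section \<open>The ring B and the homomorphism from T\<close>

interpretation B: ore "A_ring :: (nat \<Rightarrow> 'a::field poly poly) ring" A_sigma A_delta
  by (intro ore.intro ore_axioms.intro A.P_ring A_sigma A_delta_derivation)

abbreviation B_ring :: "(nat \<Rightarrow> nat \<Rightarrow> 'a::field poly poly) ring"
  where "B_ring \<equiv> skew_poly A_ring A_sigma A_delta"

definition B_c :: "(nat \<Rightarrow> 'a::field poly poly) \<Rightarrow> nat \<Rightarrow> nat \<Rightarrow> 'a poly poly"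
  where "B_c f = skew_monom A_ring f 0"

definition B_x :: "nat \<Rightarrow> nat \<Rightarrow> 'a::field poly poly"
  where "B_x = skew_monom A_ring \<one>\<^bsub>A_ring\<^esub> 1"

lemma B_c_hom: "B_c \<in> ring_hom A_ring B_ring"
  unfolding B_c_def by (rule B.const_hom)

lemma B_c_simps:
  assumes "f \<in> carrier A_ring" "g \<in> carrier A_ring"
  shows "B_c f \<otimes>\<^bsub>B_ring\<^esub> B_c g = B_c (f \<otimes>\<^bsub>A_ring\<^esub> g)"
    "B_c f \<oplus>\<^bsub>B_ring\<^esub> B_c g = B_c (f \<oplus>\<^bsub>A_ring\<^esub> g)"
  using ring_hom_mult[OF B_c_hom assms] ring_hom_add[OF B_c_hom assms] by simp_all

lemma B_c_closed [simp]: "f \<in> carrier A_ring \<Longrightarrow> B_c f \<in> carrier B_ring"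
  using B_c_hom by (rule ring_hom_closed)

lemma B_x_closed [simp]: "B_x \<in> carrier B_ring"
  unfolding B_x_def by (simp add: B.P_simps A.P.skew_monom_closed)

lemma B_x_mult: "f \<in> carrier A_ring \<Longrightarrow>
    B_x \<otimes>\<^bsub>B_ring\<^esub> B_c f = B_c (A_sigma f) \<otimes>\<^bsub>B_ring\<^esub> B_x \<oplus>\<^bsub>B_ring\<^esub> B_c (A_delta f)"
  unfolding B_c_def B_x_def by (rule B.var_mult_const)

lemma B_induct [consumes 1, case_names const var add mult]:
  assumes "f \<in> carrier B_ring"
    and "\<And>a. a \<in> carrier A_ring \<Longrightarrow> P (B_c a)" and "P B_x"
    and "\<And>f g. \<lbrakk>f \<in> carrier B_ring; g \<in> carrier B_ring; P f; P g\<rbrakk> \<Longrightarrow> P (f \<oplus>\<^bsub>B_ring\<^esub> g)"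
    and "\<And>f g. \<lbrakk>f \<in> carrier B_ring; g \<in> carrier B_ring; P f; P g\<rbrakk> \<Longrightarrow> P (f \<otimes>\<^bsub>B_ring\<^esub> g)"
  shows "P f"
  using B.P_generated[of "Collect P" f] assms by (simp add: B_c_def B_x_def)

lemma A_c_simps:
  "A_c p \<otimes>\<^bsub>A_ring\<^esub> A_c q = A_c (p * q)" "A_c p \<oplus>\<^bsub>A_ring\<^esub> A_c q = A_c (p + q)"
  using ring_hom_mult[OF A_c_hom, of p q] ring_hom_add[OF A_c_hom, of p q] by simp_all

lemma A_delta_const_zero: "pderiv p = 0 \<Longrightarrow> A_delta (A_c p) = \<zero>\<^bsub>A_ring\<^esub>"
  by (simp add: A_delta_const A_coeff_zero)

text \<open>A vanishing derivative makes both \<delta> and \<open>\<delta>\<^sub>1\<close> vanish on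
  p. The condition covers t and the constants of the base field at once.\<close>

lemma A_central:
  assumes "pderiv p = 0" "f \<in> carrier A_ring"
  shows "f \<otimes>\<^bsub>A_ring\<^esub> A_c p = A_c p \<otimes>\<^bsub>A_ring\<^esub> f"
  unfolding A_c_def using assms by (intro A.const_central) (simp_all add: der_def mult.commute)

lemma B_central:
  assumes "pderiv p = 0" "f \<in> carrier B_ring"
  shows "f \<otimes>\<^bsub>B_ring\<^esub> B_c (A_c p) = B_c (A_c p) \<otimes>\<^bsub>B_ring\<^esub> f"
  unfolding B_c_def using assms
  by (intro B.const_central A_closed A_central A_sigma A_delta_const_zero)

fun B_gen :: "gen \<Rightarrow> nat \<Rightarrow> nat \<Rightarrow> 'a::field poly poly"
  where
    "B_gen Gen_t = B_c (A_c tt)"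
  | "B_gen Gen_x1 = B_x"
  | "B_gen Gen_x2 = B_c A_x"
  | "B_gen Gen_x3 = B_c (A_c xx)"

definition B_const :: "'a::field \<Rightarrow> nat \<Rightarrow> nat \<Rightarrow> 'a poly poly"
  where "B_const c = B_c (A_c [:[:c:]:])"

lemma pderiv_const: "pderiv [:a:] = 0"
  by (simp add: pderiv_pCons)

interpretation B: free_eval B_ring B_const B_gen
proof (intro free_eval.intro free_eval_axioms.intro B.P_ring)
  have "(\<lambda>c. [:[:c:]:]) \<in> ring_hom ring_of_type_algebra poly2"
    by (rule ring_hom_memI) (simp_all add: one_pCons)
  then have "B_c \<circ> (A_c \<circ> (\<lambda>c. [:[:c:]:])) \<in> ring_hom ring_of_type_algebra B_ring"
    by (rule ring_hom_trans[OF ring_hom_trans[OF _ A_c_hom] B_c_hom])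
  then show "B_const \<in> ring_hom ring_of_type_algebra B_ring"
    by (simp add: B_const_def[abs_def] comp_def)
  show "B_gen v \<in> carrier B_ring" for v
    by (cases v) simp_all
  show "q \<otimes>\<^bsub>B_ring\<^esub> B_const c = B_const c \<otimes>\<^bsub>B_ring\<^esub> q" if "q \<in> carrier B_ring" for q c
    unfolding B_const_def using that by (intro B_central pderiv_const)
qed

lemma B_const_numeral: "B_const (numeral k) = B_c (A_c (numeral k))"
  by (simp add: B_const_def numeral_poly)

lemma B_relations:
  fixes t x1 x2 x3 :: "nat \<Rightarrow> nat \<Rightarrow> 'a::field poly poly"
  defines "t \<equiv> B_gen Gen_t" and "x1 \<equiv> B_gen Gen_x1" and "x2 \<equiv> B_gen Gen_x2" and "x3 \<equiv> B_gen Gen_x3"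
  shows "x1 \<otimes>\<^bsub>B_ring\<^esub> t = t \<otimes>\<^bsub>B_ring\<^esub> x1" "x2 \<otimes>\<^bsub>B_ring\<^esub> t = t \<otimes>\<^bsub>B_ring\<^esub> x2"
      "x3 \<otimes>\<^bsub>B_ring\<^esub> t = t \<otimes>\<^bsub>B_ring\<^esub> x3"
    and "x1 \<otimes>\<^bsub>B_ring\<^esub> x2 \<oplus>\<^bsub>B_ring\<^esub> B_const 2 \<otimes>\<^bsub>B_ring\<^esub> t \<otimes>\<^bsub>B_ring\<^esub> x3 \<otimes>\<^bsub>B_ring\<^esub> x1
      = x2 \<otimes>\<^bsub>B_ring\<^esub> x1 \<oplus>\<^bsub>B_ring\<^esub> B_const 3 \<otimes>\<^bsub>B_ring\<^esub> (t \<otimes>\<^bsub>B_ring\<^esub> t) \<otimes>\<^bsub>B_ring\<^esub> x2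
        \<oplus>\<^bsub>B_ring\<^esub> B_const 2 \<otimes>\<^bsub>B_ring\<^esub> (t \<otimes>\<^bsub>B_ring\<^esub> (t \<otimes>\<^bsub>B_ring\<^esub> t)) \<otimes>\<^bsub>B_ring\<^esub> x3"
    and "x2 \<otimes>\<^bsub>B_ring\<^esub> x3 \<oplus>\<^bsub>B_ring\<^esub> t \<otimes>\<^bsub>B_ring\<^esub> (x3 \<otimes>\<^bsub>B_ring\<^esub> x3)
      = x3 \<otimes>\<^bsub>B_ring\<^esub> x2 \<oplus>\<^bsub>B_ring\<^esub> B_const 4 \<otimes>\<^bsub>B_ring\<^esub> t"
    and "x1 \<otimes>\<^bsub>B_ring\<^esub> x3 \<oplus>\<^bsub>B_ring\<^esub> (t \<otimes>\<^bsub>B_ring\<^esub> t \<otimes>\<^bsub>B_ring\<^esub> x3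
        \<oplus>\<^bsub>B_ring\<^esub> B_const 2 \<otimes>\<^bsub>B_ring\<^esub> t \<otimes>\<^bsub>B_ring\<^esub> x2) = x3 \<otimes>\<^bsub>B_ring\<^esub> x1"
proof -
  show "x1 \<otimes>\<^bsub>B_ring\<^esub> t = t \<otimes>\<^bsub>B_ring\<^esub> x1" "x2 \<otimes>\<^bsub>B_ring\<^esub> t = t \<otimes>\<^bsub>B_ring\<^esub> x2"
    "x3 \<otimes>\<^bsub>B_ring\<^esub> t = t \<otimes>\<^bsub>B_ring\<^esub> x3"
    by (simp_all add: t_def x1_def x2_def x3_def B_central pderiv_simps)
  show "x2 \<otimes>\<^bsub>B_ring\<^esub> x3 \<oplus>\<^bsub>B_ring\<^esub> t \<otimes>\<^bsub>B_ring\<^esub> (x3 \<otimes>\<^bsub>B_ring\<^esub> x3)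
      = x3 \<otimes>\<^bsub>B_ring\<^esub> x2 \<oplus>\<^bsub>B_ring\<^esub> B_const 4 \<otimes>\<^bsub>B_ring\<^esub> t"
    by (simp add: t_def x2_def x3_def B_const_numeral B_c_simps A_c_coeff A_x_coeff A_calc)
      (simp add: ww_def algebra_simps)
  \<comment> \<open>The two terms of the relation that end in x1 have coefficients \<sigma>(x2) and
    2 t x3, which add up to x2.\<close>
  have split: "coeff [:- (2 * tt * xx), 1:] \<oplus>\<^bsub>A_ring\<^esub> A_c (2 * tt * xx) = A_x"
    by (simp add: A_c_coeff A_x_coeff A_coeff_add)
  have "x1 \<otimes>\<^bsub>B_ring\<^esub> x2 \<oplus>\<^bsub>B_ring\<^esub> B_const 2 \<otimes>\<^bsub>B_ring\<^esub> t \<otimes>\<^bsub>B_ring\<^esub> x3 \<otimes>\<^bsub>B_ring\<^esub> x1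
      = (B_c (coeff [:- (2 * tt * xx), 1:]) \<otimes>\<^bsub>B_ring\<^esub> B_x
        \<oplus>\<^bsub>B_ring\<^esub> B_c (A_c (2 * tt * xx)) \<otimes>\<^bsub>B_ring\<^esub> B_x)
        \<oplus>\<^bsub>B_ring\<^esub> B_c (coeff [:2 * tt ^ 3 * xx, 3 * tt\<^sup>2:])"
    by (simp add: t_def x1_def x2_def x3_def B_const_numeral B_c_simps A_c_simps B_x_mult
        A_sigma A_delta_var B.P.a_ac)
  also have "\<dots> = B_c A_x \<otimes>\<^bsub>B_ring\<^esub> B_x \<oplus>\<^bsub>B_ring\<^esub> B_c (coeff [:2 * tt ^ 3 * xx, 3 * tt\<^sup>2:])"
    by (subst B.P.l_distr[symmetric]) (simp_all add: B_c_simps split)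
  also have "coeff [:2 * tt ^ 3 * xx, 3 * tt\<^sup>2:]
      = A_c (3 * (tt * tt)) \<otimes>\<^bsub>A_ring\<^esub> A_x \<oplus>\<^bsub>A_ring\<^esub> A_c (2 * (tt * (tt * tt)) * xx)"
    by (simp add: A_c_coeff A_x_coeff A_calc power2_eq_square power3_eq_cube algebra_simps)
  finally show "x1 \<otimes>\<^bsub>B_ring\<^esub> x2 \<oplus>\<^bsub>B_ring\<^esub> B_const 2 \<otimes>\<^bsub>B_ring\<^esub> t \<otimes>\<^bsub>B_ring\<^esub> x3 \<otimes>\<^bsub>B_ring\<^esub> x1
      = x2 \<otimes>\<^bsub>B_ring\<^esub> x1 \<oplus>\<^bsub>B_ring\<^esub> B_const 3 \<otimes>\<^bsub>B_ring\<^esub> (t \<otimes>\<^bsub>B_ring\<^esub> t) \<otimes>\<^bsub>B_ring\<^esub> x2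
        \<oplus>\<^bsub>B_ring\<^esub> B_const 2 \<otimes>\<^bsub>B_ring\<^esub> (t \<otimes>\<^bsub>B_ring\<^esub> (t \<otimes>\<^bsub>B_ring\<^esub> t)) \<otimes>\<^bsub>B_ring\<^esub> x3"
    by (simp add: t_def x1_def x2_def x3_def B_const_numeral B_c_simps A_c_simps B.P.a_assoc)
  \<comment> \<open>The value of \<open>\<delta>\<^sub>1\<close> at x3 is - t^2 x3 - 2 t x2, the
    negative of what was moved to the left side of the relation for x1 x3.\<close>
  have "A_delta (A_c xx) \<oplus>\<^bsub>A_ring\<^esub> (A_c (tt * tt * xx)
      \<oplus>\<^bsub>A_ring\<^esub> A_c (2 * tt) \<otimes>\<^bsub>A_ring\<^esub> A_x) = (\<zero>\<^bsub>A_ring\<^esub> :: nat \<Rightarrow> 'a poly poly)"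
    unfolding A_delta_const by (simp add: A_c_coeff A_x_coeff A_calc A_coeff_zero pderiv_simps
        power2_eq_square pderiv_const flip: one_pCons)
  then have "B_c (A_delta (A_c xx) \<oplus>\<^bsub>A_ring\<^esub> (A_c (tt * tt * xx)
      \<oplus>\<^bsub>A_ring\<^esub> A_c (2 * tt) \<otimes>\<^bsub>A_ring\<^esub> A_x)) = (\<zero>\<^bsub>B_ring\<^esub> :: nat \<Rightarrow> nat \<Rightarrow> 'a poly poly)"
    by (simp only: ring_hom_zero[OF B_c_hom A.P_ring B.P_ring])
  then show "x1 \<otimes>\<^bsub>B_ring\<^esub> x3 \<oplus>\<^bsub>B_ring\<^esub> (t \<otimes>\<^bsub>B_ring\<^esub> t \<otimes>\<^bsub>B_ring\<^esub> x3
        \<oplus>\<^bsub>B_ring\<^esub> B_const 2 \<otimes>\<^bsub>B_ring\<^esub> t \<otimes>\<^bsub>B_ring\<^esub> x2) = x3 \<otimes>\<^bsub>B_ring\<^esub> x1"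
    by (simp add: t_def x1_def x2_def x3_def B_const_numeral B_c_simps A_c_simps B_x_mult
        A_sigma A_delta_closed B.P.a_assoc)
qed

lemma T_to_B:
  obtains \<phi> where "\<phi> \<in> ring_hom T_ring B_ring" "\<And>p. \<phi> (T_class p) = B.ev p"
  using B.T_hom_exists[OF B_relations] by blast

section \<open>Commutation rules in T and the homomorphism from B\<close>

lemma T_relation:
  assumes "p - q \<in> T_relators"
  shows "T_class p = T_class q"
  unfolding T_class_eq_iff T_ideal_def using free.genideal_self[of T_relators] assms by auto

lemma T_relations:
  fixes t x1 x2 x3 :: "'a::field free_alg"
  defines "t \<equiv> free_gen Gen_t" and "x1 \<equiv> free_gen Gen_x1" and "x2 \<equiv> free_gen Gen_x2"
    and "x3 \<equiv> free_gen Gen_x3"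
  shows "T_class (x1 * t) = T_class (t * x1)" "T_class (x2 * t) = T_class (t * x2)"
    "T_class (x3 * t) = T_class (t * x3)"
    and "T_class (x1 * x2)
      = T_class (x2 * x1 - 2 * t * x3 * x1 + 3 * t ^ 2 * x2 + 2 * t ^ 3 * x3)"
    and "T_class (x2 * x3) = T_class (x3 * x2 - t * x3 ^ 2 + 4 * t)"
    and "T_class (x1 * x3) = T_class (x3 * x1 - t ^ 2 * x3 - 2 * t * x2)"
  by (rule T_relation; simp add: T_relators_def Let_def t_def x1_def x2_def x3_def)+

lemma T_induct [consumes 1, case_names const gen add mult]:
  assumes "x \<in> carrier T_ring"
    and "\<And>c. P (T_const c)" and "\<And>v. P (T_gen v)"
    and "\<And>x y. \<lbrakk>x \<in> carrier T_ring; y \<in> carrier T_ring; P x; P y\<rbrakk> \<Longrightarrow> P (x \<oplus>\<^bsub>T_ring\<^esub> y)"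
    and "\<And>x y. \<lbrakk>x \<in> carrier T_ring; y \<in> carrier T_ring; P x; P y\<rbrakk> \<Longrightarrow> P (x \<otimes>\<^bsub>T_ring\<^esub> y)"
  shows "P x"
  using T_generated[of "Collect P" x] assms by simp

lemma T_gen_closed [simp]: "T_gen v \<in> carrier T_ring" "T_const c \<in> carrier T_ring"
  by (simp_all add: T_gen_def T_const_def)

lemma T_const_hom: "T_const \<in> ring_hom ring_of_type_algebra T_ring"
proof -
  have *: "T_const = T_class \<circ> free_const"
    by (auto simp: T_const_def)
  show ?thesis
    unfolding * by (rule ring_hom_trans[OF free_const_hom T_class_hom])
qed

lemma T_const_comm:
  assumes "x \<in> carrier T_ring"
  shows "x \<otimes>\<^bsub>T_ring\<^esub> T_const c = T_const c \<otimes>\<^bsub>T_ring\<^esub> x"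
proof -
  obtain p where p: "x = T_class p"
    using assms by (rule T_class_surj)
  have "p * free_const c = free_const c * p"
  proof (induction p rule: poly_mapping_single_induct)
    case (add p k d)
    have "Poly_Mapping.single k d * free_const c = free_const c * Poly_Mapping.single k d"
      by (simp add: free_const_def mult_single mult.commute)
    with add show ?case
      by (simp add: distrib_left distrib_right)
  qed simp
  then show ?thesis
    by (simp add: p T_const_def flip: T_class_simps)
qed

lemma T_t_comm:
  assumes "x \<in> carrier T_ring"
  shows "x \<otimes>\<^bsub>T_ring\<^esub> T_gen Gen_t = T_gen Gen_t \<otimes>\<^bsub>T_ring\<^esub> x"
  using assms
proof (induction rule: T_induct)
  case (const c)
  then show ?case
    by (simp add: T_const_comm)
next
  case (gen v)
  then show ?case
    by (cases v) (simp_all add: T_gen_def T_relations flip: T_class_simps)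
next
  case (add x y)
  then show ?case
    by (simp add: T.l_distr T.r_distr)
next
  case (mult x y)
  have "x \<otimes>\<^bsub>T_ring\<^esub> y \<otimes>\<^bsub>T_ring\<^esub> T_gen Gen_t = x \<otimes>\<^bsub>T_ring\<^esub> T_gen Gen_t \<otimes>\<^bsub>T_ring\<^esub> y"
    using mult(1,2,4) by (simp add: T.m_assoc)
  also have "\<dots> = T_gen Gen_t \<otimes>\<^bsub>T_ring\<^esub> (x \<otimes>\<^bsub>T_ring\<^esub> y)"
    using mult(1,2) unfolding mult(3) by (simp add: T.m_assoc)
  finally show ?case .
qed

definition T_u :: "'a::field poly \<Rightarrow> 'a free_alg set"
  where "T_u = poly_ev T_ring T_const (T_gen Gen_t)"

interpretation T_u: poly_eval T_ring T_const "T_gen Gen_t"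
  by unfold_locales (use ring_hom_add[OF T_const_hom] in simp_all)

lemma T_u_hom: "T_u \<in> ring_hom ring_of_type_algebra T_ring"
  unfolding T_u_def using T_const_hom by (rule T_u.poly_ev_hom) (simp add: T_const_comm)

lemma T_u_comm: "x \<in> carrier T_ring \<Longrightarrow> x \<otimes>\<^bsub>T_ring\<^esub> T_u c = T_u c \<otimes>\<^bsub>T_ring\<^esub> x"
  unfolding T_u_def by (rule T_u.poly_ev_comm) (simp_all add: T_const_comm T_t_comm)

text \<open>Since t is central, a polynomial in t and one further variable can be evaluated at any
  v. The value x3 serves the map from A, the value x1 the normal forms modulo g.\<close>

definition T_pv :: "'a::field free_alg set \<Rightarrow> 'a poly poly \<Rightarrow> 'a free_alg set"
  where "T_pv v = poly_ev T_ring T_u v"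

lemma T_pv_eval: "v \<in> carrier T_ring \<Longrightarrow> poly_eval T_ring T_u v"
  by (simp add: poly_eval_def poly_eval_axioms_def T.ring_axioms
      ring_hom_closed[OF T_u_hom] ring_hom_add[OF T_u_hom, simplified])

lemma T_pv_hom: "v \<in> carrier T_ring \<Longrightarrow> T_pv v \<in> ring_hom poly2 T_ring"
  unfolding T_pv_def by (rule poly_eval.poly_ev_hom[OF T_pv_eval T_u_hom]) (simp_all add: T_u_comm)

lemma T_pv_closed [simp]: "v \<in> carrier T_ring \<Longrightarrow> T_pv v p \<in> carrier T_ring"
  using ring_hom_closed[OF T_pv_hom] by simp

lemma T_pv_simps:
  assumes "v \<in> carrier T_ring"
  shows "T_pv v (p + q) = T_pv v p \<oplus>\<^bsub>T_ring\<^esub> T_pv v q" "T_pv v (p * q) = T_pv v p \<otimes>\<^bsub>T_ring\<^esub> T_pv v q"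
    "T_pv v [:[:c:]:] = T_const c" "T_pv v tt = T_gen Gen_t" "T_pv v xx = v"
proof -
  interpret poly_eval T_ring T_u v
    using assms by (rule T_pv_eval)
  show "T_pv v (p + q) = T_pv v p \<oplus>\<^bsub>T_ring\<^esub> T_pv v q" "T_pv v (p * q) = T_pv v p \<otimes>\<^bsub>T_ring\<^esub> T_pv v q"
    using ring_hom_add[OF T_pv_hom[OF assms]] ring_hom_mult[OF T_pv_hom[OF assms]] by simp_all
  have zero_one: "T_u 0 = \<zero>\<^bsub>T_ring\<^esub>" "T_u 1 = \<one>\<^bsub>T_ring\<^esub>" "T_const 1 = \<one>\<^bsub>T_ring\<^esub>"
    by (simp add: T_u_def)
      (simp_all add: ring_hom_one[OF T_u_hom, simplified] ring_hom_one[OF T_const_hom, simplified])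
  have T_u: "T_u [:c:] = T_const c" "T_u [:0, 1:] = T_gen Gen_t" for c
    by (simp_all add: T_u_def zero_one)
  show "T_pv v [:[:c:]:] = T_const c" "T_pv v tt = T_gen Gen_t" "T_pv v xx = v"
    using assms by (simp_all add: T_pv_def tt_def xx_def T_u zero_one)
qed

text \<open>These rules move values of polynomials into single classes of the free algebra, where
  signs and numerals are handled by ordinary ring arithmetic.\<close>

lemma T_pv_lift:
  "v \<in> carrier T_ring \<Longrightarrow> T_pv v (numeral k) = T_class (numeral k)"
  "\<lbrakk>v \<in> carrier T_ring; T_pv v p = T_class a; T_pv v q = T_class b\<rbrakk> \<Longrightarrow>
    T_pv v (p - q) = T_class (a - b)"
  "\<lbrakk>v \<in> carrier T_ring; T_pv v p = T_class a\<rbrakk> \<Longrightarrow> T_pv v (- p) = T_class (- a)"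
proof -
  assume v: "v \<in> carrier T_ring"
  show "T_pv v (numeral k) = T_class (numeral k)"
    using T_pv_simps(3)[OF v, of "numeral k"] by (simp add: T_const_def numeral_poly)
  have diff: "T_pv v (p - q) = T_class (a - b)" if "T_pv v p = T_class a" "T_pv v q = T_class b" for p q a b
  proof -
    have "T_pv v (p - q) \<oplus>\<^bsub>T_ring\<^esub> T_pv v q = T_class (a - b) \<oplus>\<^bsub>T_ring\<^esub> T_class b"
      unfolding T_pv_simps(1)[OF v, symmetric] that(2)[symmetric]
      by (simp add: that T_class_simps(1)[symmetric])
    then show ?thesis
      using v by (simp add: that T.add.r_cancel)
  qed
  show "T_pv v (p - q) = T_class (a - b)" if "T_pv v p = T_class a" "T_pv v q = T_class b"
    by (rule diff[OF that])
  have "T_pv v 0 = T_class 0"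
    using T_pv_simps(3)[OF v, of 0] by (simp add: T_const_def)
  then show "T_pv v (- p) = T_class (- a)" if "T_pv v p = T_class a"
    using diff[OF _ that, of 0 0] by simp
qed

lemma numeral_comm: "p * numeral k = numeral k * (p :: 'r::ring_1)"
  by (metis mult_of_nat_commute of_nat_numeral)

abbreviation T_p3 :: "'a::field poly poly \<Rightarrow> 'a free_alg set"
  where "T_p3 \<equiv> T_pv (T_gen Gen_x3)"

text \<open>The rule passes from p and q to p q by the Leibniz rule, so it has to be checked only on
  constants, t and x3; on x3 it is the relation for x2 x3.\<close>

lemma T_x2_comm:
  fixes p :: "'a::field poly poly"
  shows "T_gen Gen_x2 \<otimes>\<^bsub>T_ring\<^esub> T_p3 p
    = T_p3 p \<otimes>\<^bsub>T_ring\<^esub> T_gen Gen_x2 \<oplus>\<^bsub>T_ring\<^esub> T_p3 (der p)"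
proof (induction p rule: poly_poly_induct)
  case (const c)
  have "T_p3 0 = \<zero>\<^bsub>T_ring\<^esub>"
    using T_pv_simps(3)[of "T_gen Gen_x3" 0] by simp
  then show ?case
    by (simp add: T_pv_simps T_const_comm der_def pderiv_const)
next
  case t
  have "T_p3 0 = \<zero>\<^bsub>T_ring\<^esub>"
    using T_pv_simps(3)[of "T_gen Gen_x3" 0] by simp
  then show ?case
    by (simp add: T_pv_simps T_t_comm der_simps)
next
  case x
  have "T_p3 ww = T_class (4 - free_gen Gen_x3 * free_gen Gen_x3 :: 'a free_alg)"
    unfolding ww_def by (rule T_pv_lift) (simp_all add: T_pv_lift T_pv_simps T_class_simps T_gen_def)
  then show ?case
    by (simp only: der_simps T_pv_simps T_gen_closed)
      (simp add: T_gen_def T_relations power2_eq_square numeral_comm algebra_simps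
        flip: T_class_simps)
next
  case (add p q)
  then show ?case
    by (simp add: T_pv_simps der_simps T.l_distr T.r_distr T.a_ac)
next
  case (mult p q)
  have "T_gen Gen_x2 \<otimes>\<^bsub>T_ring\<^esub> T_p3 (p * q)
      = T_gen Gen_x2 \<otimes>\<^bsub>T_ring\<^esub> T_p3 p \<otimes>\<^bsub>T_ring\<^esub> T_p3 q"
    by (simp add: T_pv_simps T.m_assoc)
  also have "\<dots> = T_p3 p \<otimes>\<^bsub>T_ring\<^esub> (T_gen Gen_x2 \<otimes>\<^bsub>T_ring\<^esub> T_p3 q)
      \<oplus>\<^bsub>T_ring\<^esub> T_p3 (der p) \<otimes>\<^bsub>T_ring\<^esub> T_p3 q"
    unfolding mult(1) by (simp add: T.l_distr T.m_assoc)
  also have "\<dots> = T_p3 (p * q) \<otimes>\<^bsub>T_ring\<^esub> T_gen Gen_x2 \<oplus>\<^bsub>T_ring\<^esub> T_p3 (der (p * q))"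
    unfolding mult(2) by (simp add: T_pv_simps der_simps T.r_distr T.m_assoc T.a_assoc)
  finally show ?case .
qed

lemma A_to_T:
  obtains \<iota> where "\<iota> \<in> ring_hom A_ring T_ring" "\<And>p. \<iota> (A_c p) = T_p3 p" "\<iota> A_x = T_gen Gen_x2"
proof (rule A.hom_exists[OF T.ring_axioms T_pv_hom[OF T_gen_closed(1)] T_gen_closed(1)])
  show "T_gen Gen_x2 \<otimes>\<^bsub>T_ring\<^esub> T_p3 r = T_p3 r \<otimes>\<^bsub>T_ring\<^esub> T_gen Gen_x2 \<oplus>\<^bsub>T_ring\<^esub> T_p3 (der r)"
    for r
    by (rule T_x2_comm)
qed (rule that, assumption, simp_all add: A_c_def A_x_def)

text \<open>The universal property is used twice, for A and then for B. The second use needs the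
  commutation rule H of x1 with all of A; because \<open>A_delta\<close> is a skew derivation, H
  passes to sums and products, and on x2 and x3 it is a defining relation of T.\<close>

lemma B_to_T:
  obtains \<psi> where "\<psi> \<in> ring_hom B_ring T_ring" "\<And>p. \<psi> (B_c (A_c p)) = T_p3 p"
    "\<psi> (B_c A_x) = T_gen Gen_x2" "\<psi> B_x = T_gen Gen_x1"
proof -
  obtain \<iota> :: "(nat \<Rightarrow> 'a poly poly) \<Rightarrow> 'a free_alg set"
    where hom: "\<iota> \<in> ring_hom A_ring T_ring" and vals: "\<And>p. \<iota> (A_c p) = T_p3 p" "\<iota> A_x = T_gen Gen_x2"
    using A_to_T by blast
  have closed [simp]: "\<iota> f \<in> carrier T_ring" if "f \<in> carrier A_ring" for f
    using hom that by (rule ring_hom_closed)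
  \<comment> \<open>The values of \<sigma> and \<open>\<delta>\<^sub>1\<close> on the generators
    have degree at most 1 in x2, so this formula covers all of them.\<close>
  have linear: "\<iota> (coeff [:p, q:]) = T_p3 p \<oplus>\<^bsub>T_ring\<^esub> T_p3 q \<otimes>\<^bsub>T_ring\<^esub> T_gen Gen_x2" for p q
  proof -
    have "coeff [:p, q:] = A_c p \<oplus>\<^bsub>A_ring\<^esub> A_c q \<otimes>\<^bsub>A_ring\<^esub> A_x"
      by (simp add: A_c_coeff A_x_coeff A_calc)
    then show ?thesis
      by (simp add: ring_hom_add[OF hom] ring_hom_mult[OF hom] vals)
  qed
  define x1 :: "'a free_alg set" where "x1 = T_gen Gen_x1"
  have x1 [simp]: "x1 \<in> carrier T_ring"
    by (simp add: x1_def)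
  define H where "H f \<longleftrightarrow> x1 \<otimes>\<^bsub>T_ring\<^esub> \<iota> f
    = \<iota> (A_sigma f) \<otimes>\<^bsub>T_ring\<^esub> x1 \<oplus>\<^bsub>T_ring\<^esub> \<iota> (A_delta f)" for f
  have H_add: "H (f \<oplus>\<^bsub>A_ring\<^esub> g)" if "f \<in> carrier A_ring" "g \<in> carrier A_ring" "H f" "H g" for f g
    using that unfolding H_def by (simp add: ring_hom_add[OF hom] B.sigma_add B.delta_add
        A_delta_closed T.l_distr T.r_distr T.a_ac)
  have H_mult: "H (f \<otimes>\<^bsub>A_ring\<^esub> g)" if fg: "f \<in> carrier A_ring" "g \<in> carrier A_ring" and "H f" "H g" for f g
  proof -
    have "x1 \<otimes>\<^bsub>T_ring\<^esub> \<iota> (f \<otimes>\<^bsub>A_ring\<^esub> g) = x1 \<otimes>\<^bsub>T_ring\<^esub> \<iota> f \<otimes>\<^bsub>T_ring\<^esub> \<iota> g"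
      using fg by (simp add: ring_hom_mult[OF hom] T.m_assoc)
    also have "\<dots> = \<iota> (A_sigma f) \<otimes>\<^bsub>T_ring\<^esub> (x1 \<otimes>\<^bsub>T_ring\<^esub> \<iota> g) \<oplus>\<^bsub>T_ring\<^esub> \<iota> (A_delta f) \<otimes>\<^bsub>T_ring\<^esub> \<iota> g"
      using fg unfolding \<open>H f\<close>[unfolded H_def] by (simp add: T.l_distr T.m_assoc A_delta_closed)
    also have "\<dots> = \<iota> (A_sigma (f \<otimes>\<^bsub>A_ring\<^esub> g)) \<otimes>\<^bsub>T_ring\<^esub> x1 \<oplus>\<^bsub>T_ring\<^esub> \<iota> (A_delta (f \<otimes>\<^bsub>A_ring\<^esub> g))"
      using fg unfolding \<open>H g\<close>[unfolded H_def]
      by (simp add: ring_hom_mult[OF hom] ring_hom_add[OF hom] B.sigma_mult B.delta_mult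
          A_delta_closed T.r_distr T.m_assoc T.a_assoc)
    finally show ?thesis
      by (simp add: H_def)
  qed
  have H_const: "H (A_c p)" for p
  proof (induction p rule: poly_poly_induct)
    case (const c)
    then show ?case
      using ring_hom_zero[OF hom A.P_ring T.ring_axioms]
      by (simp add: H_def vals T_pv_simps A_sigma A_delta_const_zero pderiv_const T_const_comm)
  next
    case t
    then show ?case
      using ring_hom_zero[OF hom A.P_ring T.ring_axioms]
      by (simp add: H_def vals T_pv_simps A_sigma A_delta_const_zero pderiv_simps T_t_comm)
  next
    case x
    have "T_p3 (- (tt * tt * xx))
        = T_class (- (free_gen Gen_t * free_gen Gen_t * free_gen Gen_x3) :: 'a free_alg)"
      "T_p3 (- (2 * tt)) = T_class (- (2 * free_gen Gen_t) :: 'a free_alg)"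
      by (rule T_pv_lift; simp add: T_pv_lift T_pv_simps T_class_simps T_gen_def)+
    then show ?case
      unfolding H_def A_delta_const A_sigma vals linear
      by (simp add: pderiv_simps pderiv_const power2_eq_square T_pv_simps x1_def flip: one_pCons)
        (simp add: T_gen_def T_relations power2_eq_square algebra_simps flip: T_class_simps)
  next
    case (add p q)
    then show ?case
      using H_add[of "A_c p" "A_c q"] by (simp add: A_c_simps)
  next
    case (mult p q)
    then show ?case
      using H_mult[of "A_c p" "A_c q"] by (simp add: A_c_simps)
  qed
  have H_var: "H A_x"
  proof -
    note lift = T_pv_lift T_pv_simps T_class_simps T_gen_def power2_eq_square power3_eq_cube
    have "T_p3 (- (2 * tt * xx)) = T_class (- (2 * free_gen Gen_t * free_gen Gen_x3) :: 'a free_alg)"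
      by (rule T_pv_lift) (simp_all add: lift)
    moreover have "T_p3 1 = T_class (1 :: 'a free_alg)"
      using ring_hom_one[OF T_pv_hom[OF T_gen_closed(1), where ?'a = 'a]] by (simp add: T_class_simps)
    moreover have "T_p3 (2 * tt ^ 3 * xx) = T_class (2 * free_gen Gen_t ^ 3 * free_gen Gen_x3 :: 'a free_alg)"
      by (simp add: lift)
    moreover have "T_p3 (3 * tt\<^sup>2) = T_class (3 * free_gen Gen_t ^ 2 :: 'a free_alg)"
      by (simp add: lift)
    ultimately show ?thesis
      unfolding H_def A_delta_var A_sigma vals linear x1_def
      by simp (simp add: T_gen_def T_relations algebra_simps flip: T_class_simps)
  qed
  have H: "H f" if "f \<in> carrier A_ring" for f
    using that by (induction rule: A_induct) (simp_all add: H_const H_var H_add H_mult)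
  show ?thesis
  proof (rule B.hom_exists[OF T.ring_axioms hom x1])
    show "x1 \<otimes>\<^bsub>T_ring\<^esub> \<iota> r = \<iota> (A_sigma r) \<otimes>\<^bsub>T_ring\<^esub> x1 \<oplus>\<^bsub>T_ring\<^esub> \<iota> (A_delta r)"
      if "r \<in> carrier A_ring" for r
      using H[OF that] by (simp add: H_def)
  qed (rule that, assumption, simp_all add: B_c_def B_x_def vals x1_def)
qed

lemma T_iso_B:
  obtains \<phi> :: "'a::field free_alg set \<Rightarrow> nat \<Rightarrow> nat \<Rightarrow> 'a poly poly"
  where "\<phi> \<in> ring_iso T_ring B_ring" "\<And>p. \<phi> (T_class p) = B.ev p"
proof -
  obtain \<phi> :: "'a free_alg set \<Rightarrow> nat \<Rightarrow> nat \<Rightarrow> 'a poly poly"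
    where \<phi>: "\<phi> \<in> ring_hom T_ring B_ring" and \<phi>_class: "\<And>p. \<phi> (T_class p) = B.ev p"
    using T_to_B by blast
  obtain \<psi> :: "(nat \<Rightarrow> nat \<Rightarrow> 'a poly poly) \<Rightarrow> 'a free_alg set"
    where \<psi>: "\<psi> \<in> ring_hom B_ring T_ring" and \<psi>_vals: "\<And>p. \<psi> (B_c (A_c p)) = T_p3 p"
    "\<psi> (B_c A_x) = T_gen Gen_x2" "\<psi> B_x = T_gen Gen_x1"
    using B_to_T by blast
  have phi_gen: "\<phi> (T_gen v) = B_gen v" and phi_const: "\<phi> (T_const c) = B_const c" for v c
    by (simp_all add: T_gen_def T_const_def \<phi>_class)
  have left: "\<psi> (\<phi> x) = x" if "x \<in> carrier T_ring" for x
    using that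
  proof (induction rule: T_induct)
    case (const c)
    then show ?case
      by (simp add: phi_const B_const_def \<psi>_vals T_pv_simps)
  next
    case (gen v)
    then show ?case
      by (cases v) (simp_all add: phi_gen \<psi>_vals T_pv_simps)
  next
    case (add x y)
    then show ?case
      by (simp add: ring_hom_add[OF \<phi>] ring_hom_add[OF \<psi>] ring_hom_closed[OF \<phi>])
  next
    case (mult x y)
    then show ?case
      by (simp add: ring_hom_mult[OF \<phi>] ring_hom_mult[OF \<psi>] ring_hom_closed[OF \<phi>])
  qed
  have sums: "\<phi> (\<psi> (f \<oplus>\<^bsub>B_ring\<^esub> g)) = f \<oplus>\<^bsub>B_ring\<^esub> g" "\<phi> (\<psi> (f \<otimes>\<^bsub>B_ring\<^esub> g)) = f \<otimes>\<^bsub>B_ring\<^esub> g"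
    if "f \<in> carrier B_ring" "g \<in> carrier B_ring" "\<phi> (\<psi> f) = f" "\<phi> (\<psi> g) = g" for f g
    using that
    by (simp_all add: ring_hom_add[OF \<phi>] ring_hom_add[OF \<psi>] ring_hom_mult[OF \<phi>]
        ring_hom_mult[OF \<psi>] ring_hom_closed[OF \<psi>])
  have right_c: "\<phi> (\<psi> (B_c (A_c p))) = B_c (A_c p)" for p
  proof (induction p rule: poly_poly_induct)
    case (const c)
    then show ?case
      by (simp add: \<psi>_vals T_pv_simps phi_const B_const_def)
  next
    case (add p q)
    then show ?case
      using sums(1)[of "B_c (A_c p)" "B_c (A_c q)"] by (simp add: B_c_simps A_c_simps)
  next
    case (mult p q)
    then show ?case
      using sums(2)[of "B_c (A_c p)" "B_c (A_c q)"] by (simp add: B_c_simps A_c_simps)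
  qed (simp_all add: \<psi>_vals T_pv_simps phi_gen)
  have right_A: "\<phi> (\<psi> (B_c f)) = B_c f" if "f \<in> carrier A_ring" for f
    using that
  proof (induction rule: A_induct)
    case (add f g)
    then show ?case
      using sums(1)[of "B_c f" "B_c g"] by (simp add: B_c_simps)
  next
    case (mult f g)
    then show ?case
      using sums(2)[of "B_c f" "B_c g"] by (simp add: B_c_simps)
  qed (simp_all add: right_c[unfolded \<psi>_vals] \<psi>_vals phi_gen)
  have right: "\<phi> (\<psi> f) = f" if "f \<in> carrier B_ring" for f
    using that by (induction rule: B_induct) (simp_all add: right_A \<psi>_vals phi_gen sums)
  have "bij_betw \<phi> (carrier T_ring) (carrier B_ring)"
    using left right ring_hom_closed[OF \<phi>] ring_hom_closed[OF \<psi>]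
    by (intro bij_betw_byWitness[where f' = \<psi>] ballI image_subsetI)
  then have "\<phi> \<in> ring_iso T_ring B_ring"
    using \<phi> by (simp add: ring_iso_def)
  then show ?thesis
    using \<phi>_class that by blast
qed

theorem T_iterated_skew_poly:
  "\<exists>(\<delta> :: 'a::field poly poly \<Rightarrow> 'a poly poly) \<sigma> \<delta>\<^sub>1 A B \<phi>.
        skew_derivation poly2 id \<delta> \<and>
        A = skew_poly poly2 id \<delta> \<and>
        \<sigma> \<in> ring_iso A A \<and>
        skew_derivation A \<sigma> \<delta>\<^sub>1 \<and>
        B = skew_poly A \<sigma> \<delta>\<^sub>1 \<and>
        \<phi> \<in> alg_iso T_const T_ring (\<lambda>c. skew_monom A (skew_monom poly2 [:[:c:]:] 0) 0) B \<and>
        \<phi> (T_gen Gen_t) = skew_monom A (skew_monom poly2 [:[:0, 1:]:] 0) 0 \<and>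
        \<phi> (T_gen Gen_x3) = skew_monom A (skew_monom poly2 [:0, 1:] 0) 0 \<and>
        \<phi> (T_gen Gen_x2) = skew_monom A (skew_monom poly2 1 1) 0 \<and>
        \<phi> (T_gen Gen_x1) = skew_monom A \<one>\<^bsub>A\<^esub> 1"
proof -
  obtain \<phi> :: "'a free_alg set \<Rightarrow> nat \<Rightarrow> nat \<Rightarrow> 'a poly poly"
    where \<phi>: "\<phi> \<in> ring_iso T_ring B_ring" "\<And>p. \<phi> (T_class p) = B.ev p"
    using T_iso_B by blast
  have id: "(id :: 'a poly poly \<Rightarrow> _) = (\<lambda>p. p)"
    by auto
  have phi_gen: "\<phi> (T_gen v) = B_gen v" and phi_const: "\<phi> (T_const c) = B_const c" for v c
    by (simp_all add: T_gen_def T_const_def \<phi>(2))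
  note defs = B_c_def A_c_def tt_def xx_def A_x_def B_x_def
  show ?thesis
    unfolding id
  proof (rule exI[of _ der], rule exI[of _ A_sigma], rule exI[of _ A_delta], rule exI[of _ A_ring],
      rule exI[of _ B_ring], rule exI[of _ \<phi>], intro conjI refl der_derivation A_sigma_iso A_delta_derivation)
    show "\<phi> \<in> alg_iso T_const T_ring
        (\<lambda>c. skew_monom A_ring (skew_monom poly2 [:[:c:]:] 0) 0) B_ring"
      using \<phi>(1) by (simp add: alg_iso_def phi_const B_const_def defs)
  qed (simp_all add: phi_gen, simp_all add: defs)
qed

section \<open>Centrality of g\<close>

text \<open>For a in A, g a = w \<sigma>(a) x1 + w \<open>\<delta>\<^sub>1\<close>(a) + h a, which
  the two defining equations turn into a w x1 + a h. Commuting with x1 comes down to \<sigma>(w) =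
  w, \<open>\<delta>\<^sub>1\<close>(h) = 0 and \<sigma>(h) + \<open>\<delta>\<^sub>1\<close>(w) =
  h.\<close>

lemma B_g_central:
  assumes "f \<in> carrier B_ring"
  shows "(B_c A_w \<otimes>\<^bsub>B_ring\<^esub> B_x \<oplus>\<^bsub>B_ring\<^esub> B_c A_h) \<otimes>\<^bsub>B_ring\<^esub> f
    = f \<otimes>\<^bsub>B_ring\<^esub> (B_c A_w \<otimes>\<^bsub>B_ring\<^esub> B_x \<oplus>\<^bsub>B_ring\<^esub> B_c A_h)"
proof -
  define g :: "nat \<Rightarrow> nat \<Rightarrow> 'a poly poly"
    where "g = B_c A_w \<otimes>\<^bsub>B_ring\<^esub> B_x \<oplus>\<^bsub>B_ring\<^esub> B_c A_h"
  have g: "g \<in> carrier B_ring"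
    by (simp add: g_def)
  have A: "g \<otimes>\<^bsub>B_ring\<^esub> B_c a = B_c a \<otimes>\<^bsub>B_ring\<^esub> g" if a: "a \<in> carrier A_ring" for a
  proof -
    have "g \<otimes>\<^bsub>B_ring\<^esub> B_c a
        = B_c A_w \<otimes>\<^bsub>B_ring\<^esub> (B_x \<otimes>\<^bsub>B_ring\<^esub> B_c a) \<oplus>\<^bsub>B_ring\<^esub> B_c (A_h \<otimes>\<^bsub>A_ring\<^esub> a)"
      using a by (simp add: g_def B.P.l_distr B.P.m_assoc B_c_simps)
    also have "\<dots> = B_c A_w \<otimes>\<^bsub>B_ring\<^esub> B_c (A_sigma a) \<otimes>\<^bsub>B_ring\<^esub> B_x
        \<oplus>\<^bsub>B_ring\<^esub> (B_c A_w \<otimes>\<^bsub>B_ring\<^esub> B_c (A_delta a) \<oplus>\<^bsub>B_ring\<^esub> B_c (A_h \<otimes>\<^bsub>A_ring\<^esub> a))"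
      using a unfolding B_x_mult[OF a]
      by (simp add: A_delta_closed B.P.r_distr B.P.m_assoc B.P.a_assoc del: B_c_simps)
    also have "\<dots> = B_c (a \<otimes>\<^bsub>A_ring\<^esub> A_w) \<otimes>\<^bsub>B_ring\<^esub> B_x \<oplus>\<^bsub>B_ring\<^esub> B_c (a \<otimes>\<^bsub>A_ring\<^esub> A_h)"
      using a by (simp add: A_delta_closed B_c_simps A_w_normal A_delta_h A.P.a_comm)
    also have "\<dots> = B_c a \<otimes>\<^bsub>B_ring\<^esub> g"
      using a by (simp add: g_def B.P.r_distr flip: B.P.m_assoc) (simp add: B_c_simps)
    finally show ?thesis .
  qed
  have x: "g \<otimes>\<^bsub>B_ring\<^esub> B_x = B_x \<otimes>\<^bsub>B_ring\<^esub> g"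
  proof -
    have sigma_w: "A_sigma A_w = A_w"
      by (simp add: A_w_def A_sigma)
    \<comment> \<open>As h commutes with itself, 0 solves the equation for
      \<open>\<delta>\<^sub>1\<close>(h).\<close>
    have delta_h: "A_delta A_h = \<zero>\<^bsub>A_ring\<^esub>"
      by (rule A_delta_unique) simp_all
    \<comment> \<open>After multiplication by w the sum is h w + (w h - h w) = w h; then w is
      cancelled.\<close>
    have "A_w \<otimes>\<^bsub>A_ring\<^esub> (A_sigma A_h \<oplus>\<^bsub>A_ring\<^esub> A_delta A_w)
        = A_h \<otimes>\<^bsub>A_ring\<^esub> A_w \<oplus>\<^bsub>A_ring\<^esub> A_w \<otimes>\<^bsub>A_ring\<^esub> A_delta A_w"
      by (simp add: A.P.r_distr A_delta_closed A_w_normal)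
    also have "\<dots> = A_w \<otimes>\<^bsub>A_ring\<^esub> A_h"
      by (simp only: A_delta_h[OF A_wh_closed(1)])
    finally have h: "A_sigma A_h \<oplus>\<^bsub>A_ring\<^esub> A_delta A_w = A_h"
      by (rule A_w_cancel) (simp_all add: A_delta_closed)
    have "B_x \<otimes>\<^bsub>B_ring\<^esub> g = B_x \<otimes>\<^bsub>B_ring\<^esub> B_c A_w \<otimes>\<^bsub>B_ring\<^esub> B_x \<oplus>\<^bsub>B_ring\<^esub> B_x \<otimes>\<^bsub>B_ring\<^esub> B_c A_h"
      by (simp add: g_def B.P.r_distr B.P.m_assoc)
    also have "\<dots> = B_c A_w \<otimes>\<^bsub>B_ring\<^esub> B_x \<otimes>\<^bsub>B_ring\<^esub> B_x
        \<oplus>\<^bsub>B_ring\<^esub> (B_c (A_sigma A_h) \<otimes>\<^bsub>B_ring\<^esub> B_x \<oplus>\<^bsub>B_ring\<^esub> B_c (A_delta A_w) \<otimes>\<^bsub>B_ring\<^esub> B_x)"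
      using ring_hom_zero[OF B_c_hom[where ?'a = 'a] A.P_ring B.P_ring]
      by (simp add: B_x_mult sigma_w delta_h A_delta_closed B.P.l_distr B.P.a_ac)
    also have "\<dots> = g \<otimes>\<^bsub>B_ring\<^esub> B_x"
      by (subst B.P.l_distr[symmetric])
        (simp_all add: A_delta_closed B_c_simps h g_def B.P.l_distr)
    finally show ?thesis ..
  qed
  have "g \<otimes>\<^bsub>B_ring\<^esub> f = f \<otimes>\<^bsub>B_ring\<^esub> g"
    using assms
  proof (induction rule: B_induct)
    case (add f h)
    then show ?case
      using g by (simp add: B.P.l_distr B.P.r_distr)
  next
    case (mult f h)
    have "g \<otimes>\<^bsub>B_ring\<^esub> (f \<otimes>\<^bsub>B_ring\<^esub> h) = g \<otimes>\<^bsub>B_ring\<^esub> f \<otimes>\<^bsub>B_ring\<^esub> h"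
      using mult(1,2) g by (simp add: B.P.m_assoc)
    also have "\<dots> = f \<otimes>\<^bsub>B_ring\<^esub> (g \<otimes>\<^bsub>B_ring\<^esub> h)"
      using mult(1,2) g unfolding mult(3) by (simp add: B.P.m_assoc)
    also have "\<dots> = f \<otimes>\<^bsub>B_ring\<^esub> h \<otimes>\<^bsub>B_ring\<^esub> g"
      using mult(1,2) g unfolding mult(4) by (simp add: B.P.m_assoc)
    finally show ?case .
  qed (simp_all add: A x)
  then show ?thesis
    by (simp add: g_def)
qed

theorem T_g_central: "central (T_ring :: 'a::field free_alg set ring) T_g"
proof -
  obtain \<phi> :: "'a free_alg set \<Rightarrow> nat \<Rightarrow> nat \<Rightarrow> 'a poly poly"
    where iso: "\<phi> \<in> ring_iso T_ring B_ring" and \<phi>: "\<And>p. \<phi> (T_class p) = B.ev p"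
    using T_iso_B by blast
  have hom: "\<phi> \<in> ring_hom T_ring B_ring" and inj: "inj_on \<phi> (carrier T_ring)"
    using iso by (auto simp: ring_iso_def bij_betw_def)
  have "B_c (A_c 4) = B_c A_w \<oplus>\<^bsub>B_ring\<^esub> (B_c (A_c (xx * xx)) :: nat \<Rightarrow> nat \<Rightarrow> 'a poly poly)"
    by (simp add: B_c_simps A_w_def A_c_simps ww_def)
  then have w: "B_c (A_c 4) \<ominus>\<^bsub>B_ring\<^esub> B_c (A_c (xx * xx)) = (B_c A_w :: nat \<Rightarrow> nat \<Rightarrow> 'a poly poly)"
    by (simp add: B.P.minus_eq B.P.a_assoc B.P.r_neg del: B_c_simps)
  have h: "A_h = A_x \<otimes>\<^bsub>A_ring\<^esub> A_x \<oplus>\<^bsub>A_ring\<^esub> (A_c (3 * tt * xx) \<otimes>\<^bsub>A_ring\<^esub> A_x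
      \<oplus>\<^bsub>A_ring\<^esub> (A_c (tt * tt * (xx * xx)) \<oplus>\<^bsub>A_ring\<^esub> A_c (4 * (tt * tt))))"
    by (simp add: A_h_def A_c_coeff A_x_coeff A_calc power2_eq_square)
  have "\<phi> T_g = B_c A_w \<otimes>\<^bsub>B_ring\<^esub> B_x \<oplus>\<^bsub>B_ring\<^esub> B_c A_h"
    unfolding h
    by (simp add: T_g_def Let_def \<phi> B_const_numeral w B_c_simps A_c_simps(1) B.P.a_assoc A.P.a_assoc)
  then have comm: "\<phi> T_g \<otimes>\<^bsub>B_ring\<^esub> \<phi> x = \<phi> x \<otimes>\<^bsub>B_ring\<^esub> \<phi> T_g" if "x \<in> carrier T_ring" for x
    using that B_g_central[OF ring_hom_closed[OF hom]] by simp
  have g: "T_g \<in> carrier (T_ring :: 'a free_alg set ring)"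
    by (simp add: T_g_def Let_def)
  show ?thesis
    unfolding central_def
  proof (intro conjI ballI g)
    fix x :: "'a free_alg set"
    assume x: "x \<in> carrier T_ring"
    have "\<phi> (T_g \<otimes>\<^bsub>T_ring\<^esub> x) = \<phi> (x \<otimes>\<^bsub>T_ring\<^esub> T_g)"
      using x g by (simp add: ring_hom_mult[OF hom] comm)
    then show "T_g \<otimes>\<^bsub>T_ring\<^esub> x = x \<otimes>\<^bsub>T_ring\<^esub> T_g"
      using x g inj by (simp add: inj_on_eq_iff)
  qed
qed

section \<open>The skew Laurent ring \<open>S\<close>\<close>

text \<open>This is the i-th power of the automorphism in closed form, y \<mapsto> y + i t, for
  negative i as well.\<close>

definition S_act :: "int \<Rightarrow> 'a::field poly poly \<Rightarrow> 'a poly poly"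
  where "S_act i p = pcompose p [:[:0, of_int i:], 1:]"

lemma S_act_add_index: "S_act i (S_act j p) = S_act (i + j) p"
  by (simp add: S_act_def pcompose_pCons add.commute flip: pcompose_assoc)

lemma S_act_simps [simp]:
  "S_act 0 p = p" "S_act i 0 = 0" "S_act i 1 = 1" "S_act i (- p) = - S_act i p"
  "S_act i (p + q) = S_act i p + S_act i q" "S_act i (p * q) = S_act i p * S_act i q"
  "S_act i (numeral k) = numeral k" "S_act i [:a:] = [:a:]" "S_act i tt = tt"
  "S_act i xx = xx + of_int i * tt"
proof -
  show "S_act 0 p = p"
    using pcompose_idR[of p] by (simp add: S_act_def)
  show "S_act i xx = xx + of_int i * tt"
    by (simp add: S_act_def xx_def tt_def pcompose_pCons of_int_poly)
qed (simp_all add: S_act_def pcompose_uminus pcompose_add pcompose_mult pcompose_pCons tt_def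
    one_pCons numeral_poly)

lemma S_act_eq_zero_iff [simp]: "S_act i p = 0 \<longleftrightarrow> p = 0"
  using S_act_add_index[of "- i" i p] by (auto simp del: S_act_add_index)

lemma aut_power_eq: "aut_power poly2 alpha i = S_act i"
proof -
  have 1: "(alpha :: 'a poly poly \<Rightarrow> _) = S_act 1"
    by (auto simp: alpha_def S_act_def)
  have inv: "inv_into UNIV (S_act 1) = (S_act (- 1) :: 'a poly poly \<Rightarrow> _)"
    by (rule inv_equality) (simp_all add: S_act_add_index)
  have "(S_act j ^^ n) p = S_act (int n * j) (p :: 'a poly poly)" for j n p
    by (induction n) (simp_all add: S_act_add_index algebra_simps)
  then show ?thesis
    by (auto simp: aut_power_def 1 inv)
qed

definition S_shift :: "int \<Rightarrow> (int \<Rightarrow> 'a::field poly poly) \<Rightarrow> int \<Rightarrow> 'a poly poly"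
  where "S_shift i g = (\<lambda>n. S_act i (g (n - i)))"

lemma S_ring_eq: "S_ring = coeff_ring poly2 S_shift"
  by (simp add: S_ring_def skew_laurent_eq aut_power_eq S_shift_def[abs_def])

interpretation S: coeff_mult poly2 S_shift
proof (intro coeff_mult.intro coeff_mult_axioms.intro ring_of_type)
  show "S_shift i f \<in> coeff_funs poly2" if "f \<in> coeff_funs poly2"
    for f :: "int \<Rightarrow> 'a poly poly" and i
  proof -
    have "{n. f (n - i) \<noteq> 0} = (\<lambda>n. n + i) ` {n. f n \<noteq> 0}"
      by (auto simp: image_iff) (metis diff_add_cancel)
    then show ?thesis
      using that by (auto simp: coeff_funs_def S_shift_def)
  qed
qed (simp add: S_shift_def)

abbreviation S_m :: "'a::field poly poly \<Rightarrow> int \<Rightarrow> int \<Rightarrow> 'a poly poly"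
  where "S_m \<equiv> skew_monom poly2"

lemma S_m_closed: "S_m p i \<in> coeff_funs poly2"
  by (rule ring.skew_monom_closed[OF ring_of_type]) simp

lemma coeff_funs_poly2_induct [consumes 1, case_names zero add]:
  fixes f :: "'i \<Rightarrow> 'a::field poly poly"
  assumes "f \<in> coeff_funs poly2" "P (\<lambda>n. 0)"
    "\<And>f p i. \<lbrakk>f \<in> coeff_funs poly2; P f\<rbrakk> \<Longrightarrow> P (\<lambda>n. f n + skew_monom poly2 p i n)"
  shows "P f"
  using ring.coeff_funs_induct[OF ring_of_type, of f P] assms by simp

text \<open>For a monomial f = r x^j the law says that x^i (r x^j g) equals \<alpha>^i(r) x^(i+j) g,
  because powers of \<alpha> add; the rest is additivity in f.\<close>

lemma S_is_ring: "ring (S_ring :: (int \<Rightarrow> 'a::field poly poly) ring)"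
  unfolding S_ring_eq
proof (rule S.coeff_ring_is_ring)
  fix i and f g :: "int \<Rightarrow> 'a poly poly"
  assume f: "f \<in> coeff_funs poly2" and g: "g \<in> coeff_funs poly2"
  show "S_shift i (f \<otimes>\<^bsub>S.C\<^esub> g) = S_shift i f \<otimes>\<^bsub>S.C\<^esub> g"
    using f
  proof (induction rule: coeff_funs_poly2_induct)
    case zero
    have "S_shift i (\<lambda>n. 0) = (\<lambda>n. 0 :: 'a poly poly)"
      by (simp add: S_shift_def)
    then show ?case
      by (simp add: S.mult_zero_left[simplified])
  next
    case (add f r j)
    have "S_shift i (S_m r j) = S_m (S_act i r) (i + j)"
      by (auto simp: S_shift_def skew_monom_def)
    moreover have "S_shift i (\<lambda>n. r * S_shift j g n) = (\<lambda>n. S_act i r * S_shift (i + j) g n)"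
      by (auto simp: S_shift_def S_act_add_index algebra_simps)
    ultimately show ?case
      using add g S.mult_add_left[of f "S_m r j" g] S.mult_closed[of f g] S.L_closed[of f i]
        S.mult_add_left[of "S_shift i f" "S_m (S_act i r) (i + j)" g]
        S.L_add[of "f \<otimes>\<^bsub>S.C\<^esub> g" "S_m r j \<otimes>\<^bsub>S.C\<^esub> g" i]
        S.L_add[of f "S_m r j" i] S.mult_closed[of "S_m r j" g]
      by (simp add: S_m_closed S.monom_mult)
  qed
qed (auto simp: skew_monom_def S_shift_def)

interpretation S: ring S_ring
  by (rule S_is_ring)

lemma S_simps:
  "carrier S_ring = coeff_funs poly2"
  "\<zero>\<^bsub>S_ring\<^esub> = (\<lambda>n. 0)" "\<one>\<^bsub>S_ring\<^esub> = S_m 1 0" "f \<oplus>\<^bsub>S_ring\<^esub> g = (\<lambda>n. f n + g n)"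
  by (simp_all add: S_ring_eq)

lemma S_m_carrier [simp]: "S_m p i \<in> carrier S_ring"
  by (simp add: S_simps S_m_closed)

lemma S_m_mult: "S_m p i \<otimes>\<^bsub>S_ring\<^esub> S_m q j = S_m (p * S_act i q) (i + j)"
  using S.monom_mult[of p "S_m q j" i] S_m_closed[of q j]
  by (simp add: S_ring_eq) (auto simp: skew_monom_def S_shift_def)

lemma S_induct [consumes 1, case_names zero add]:
  assumes "f \<in> carrier S_ring" "P \<zero>\<^bsub>S_ring\<^esub>"
    "\<And>f p i. \<lbrakk>f \<in> carrier S_ring; P f\<rbrakk> \<Longrightarrow> P (f \<oplus>\<^bsub>S_ring\<^esub> S_m p i)"
  shows "P f"
  using coeff_funs_poly2_induct[of f P] assms by (simp add: S_simps)

text \<open>Let i and j be the top exponents of f and g. At exponent i + j only f_i \<alpha>^i(g_j)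
  survives: for k < i the index i + j - k exceeds j. This term is nonzero because \<alpha>^i is
  injective and \<F>[y,t] is a domain.\<close>

lemma S_no_zero_divisors:
  assumes f: "f \<in> carrier S_ring" "f \<noteq> \<zero>\<^bsub>S_ring\<^esub>" and g: "g \<in> carrier S_ring" "g \<noteq> \<zero>\<^bsub>S_ring\<^esub>"
  shows "f \<otimes>\<^bsub>S_ring\<^esub> g \<noteq> \<zero>\<^bsub>S_ring\<^esub>"
proof -
  define i where "i = Max {n. f n \<noteq> 0}"
  define j where "j = Max {n. g n \<noteq> 0}"
  have fin: "finite {n. f n \<noteq> 0}" "finite {n. g n \<noteq> 0}"
    using f g by (simp_all add: S_simps coeff_funs_def)
  have "{n. f n \<noteq> 0} \<noteq> {}" "{n. g n \<noteq> 0} \<noteq> {}"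
    using f g by (auto simp: S_simps)
  then have i: "f i \<noteq> 0" and j: "g j \<noteq> 0"
    using Max_in[OF fin(1)] Max_in[OF fin(2)] by (auto simp: i_def j_def)
  have above: "k \<le> i" if "f k \<noteq> 0" for k
    using Max_ge[OF fin(1)] that by (simp add: i_def)
  have above': "g k = 0" if "k > j" for k
    using Max_ge[OF fin(2), of k] that by (auto simp: j_def)
  have "(f \<otimes>\<^bsub>S_ring\<^esub> g) (i + j) = (\<Sum>k\<in>{n. f n \<noteq> 0}. f k * S_act k (g (i + j - k)))"
    by (simp add: S_ring_eq coeff_ring_def S_shift_def finsum_poly2[OF fin(1)])
  also have "\<dots> = (\<Sum>k\<in>{i}. f k * S_act k (g (i + j - k)))"
  proof (rule sum.mono_neutral_right[OF fin(1)])
    show "\<forall>k\<in>{n. f n \<noteq> 0} - {i}. f k * S_act k (g (i + j - k)) = 0"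
      using above by (auto intro!: above' simp: order_less_le)
  qed (use i in auto)
  finally have "(f \<otimes>\<^bsub>S_ring\<^esub> g) (i + j) \<noteq> 0"
    using i j by simp
  then show ?thesis
    by (auto simp: S_simps)
qed

section \<open>The homomorphism from T to S\<close>

fun S_gen :: "gen \<Rightarrow> int \<Rightarrow> 'a::field poly poly"
  where
    "S_gen Gen_t = S_m tt 0"
  | "S_gen Gen_x1 = S_m (xx * xx) 0"
  | "S_gen Gen_x2 = S_m xx 1 \<oplus>\<^bsub>S_ring\<^esub> S_m (- xx) (- 1)"
  | "S_gen Gen_x3 = S_m 1 1 \<oplus>\<^bsub>S_ring\<^esub> S_m 1 (- 1)"

lemma S_gen_carrier [simp]: "S_gen v \<in> carrier S_ring"
  by (cases v) simp_all

lemma S_m_comm: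
  assumes "\<And>i. S_act i p = p" "f \<in> carrier S_ring"
  shows "f \<otimes>\<^bsub>S_ring\<^esub> S_m p 0 = S_m p 0 \<otimes>\<^bsub>S_ring\<^esub> f"
  using assms(2)
  by (induction rule: S_induct) (simp_all add: S.l_distr S.r_distr S_m_mult assms(1) mult.commute)

interpretation S: free_eval S_ring S_const S_gen
proof (intro free_eval.intro free_eval_axioms.intro S_is_ring)
  show "S_const \<in> ring_hom ring_of_type_algebra S_ring"
    by (rule ring_hom_memI)
      (simp_all add: S_const_def S_m_mult S_simps S_m_closed one_pCons, simp add: fun_eq_iff skew_monom_def)
  show "q \<otimes>\<^bsub>S_ring\<^esub> S_const c = S_const c \<otimes>\<^bsub>S_ring\<^esub> q" if "q \<in> carrier S_ring" for q c
    unfolding S_const_def using that by (intro S_m_comm) simp_all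
qed simp

lemma S_const_numeral: "S_const (numeral k) = S_m (numeral k) 0"
  by (simp add: S_const_def numeral_poly)

lemma S_m_add: "S_m p i \<oplus>\<^bsub>S_ring\<^esub> S_m q i = S_m (p + q) i"
  by (auto simp: S_simps skew_monom_def)

lemmas S_calc = S_const_numeral S_m_mult S.l_distr S.r_distr

text \<open>After expansion by x^i p = \<alpha>^i(p) x^i both sides are explicit Laurent polynomials
  in x, compared coefficient by coefficient.\<close>

lemma S_relations:
  fixes t x1 x2 x3 :: "int \<Rightarrow> 'a::field poly poly"
  defines "t \<equiv> S_gen Gen_t" and "x1 \<equiv> S_gen Gen_x1" and "x2 \<equiv> S_gen Gen_x2" and "x3 \<equiv> S_gen Gen_x3"
  shows "x1 \<otimes>\<^bsub>S_ring\<^esub> t = t \<otimes>\<^bsub>S_ring\<^esub> x1" "x2 \<otimes>\<^bsub>S_ring\<^esub> t = t \<otimes>\<^bsub>S_ring\<^esub> x2"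
      "x3 \<otimes>\<^bsub>S_ring\<^esub> t = t \<otimes>\<^bsub>S_ring\<^esub> x3"
    and "x1 \<otimes>\<^bsub>S_ring\<^esub> x2 \<oplus>\<^bsub>S_ring\<^esub> S_const 2 \<otimes>\<^bsub>S_ring\<^esub> t \<otimes>\<^bsub>S_ring\<^esub> x3 \<otimes>\<^bsub>S_ring\<^esub> x1
      = x2 \<otimes>\<^bsub>S_ring\<^esub> x1 \<oplus>\<^bsub>S_ring\<^esub> S_const 3 \<otimes>\<^bsub>S_ring\<^esub> (t \<otimes>\<^bsub>S_ring\<^esub> t) \<otimes>\<^bsub>S_ring\<^esub> x2
        \<oplus>\<^bsub>S_ring\<^esub> S_const 2 \<otimes>\<^bsub>S_ring\<^esub> (t \<otimes>\<^bsub>S_ring\<^esub> (t \<otimes>\<^bsub>S_ring\<^esub> t)) \<otimes>\<^bsub>S_ring\<^esub> x3"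
    and "x2 \<otimes>\<^bsub>S_ring\<^esub> x3 \<oplus>\<^bsub>S_ring\<^esub> t \<otimes>\<^bsub>S_ring\<^esub> (x3 \<otimes>\<^bsub>S_ring\<^esub> x3)
      = x3 \<otimes>\<^bsub>S_ring\<^esub> x2 \<oplus>\<^bsub>S_ring\<^esub> S_const 4 \<otimes>\<^bsub>S_ring\<^esub> t"
    and "x1 \<otimes>\<^bsub>S_ring\<^esub> x3 \<oplus>\<^bsub>S_ring\<^esub> (t \<otimes>\<^bsub>S_ring\<^esub> t \<otimes>\<^bsub>S_ring\<^esub> x3
        \<oplus>\<^bsub>S_ring\<^esub> S_const 2 \<otimes>\<^bsub>S_ring\<^esub> t \<otimes>\<^bsub>S_ring\<^esub> x2) = x3 \<otimes>\<^bsub>S_ring\<^esub> x1"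
proof -
  show "x1 \<otimes>\<^bsub>S_ring\<^esub> t = t \<otimes>\<^bsub>S_ring\<^esub> x1" "x2 \<otimes>\<^bsub>S_ring\<^esub> t = t \<otimes>\<^bsub>S_ring\<^esub> x2"
    "x3 \<otimes>\<^bsub>S_ring\<^esub> t = t \<otimes>\<^bsub>S_ring\<^esub> x3"
    unfolding x1_def x2_def x3_def t_def S_gen.simps(1) by (rule S_m_comm; simp del: S_gen.simps)+
qed (simp add: t_def x1_def x2_def x3_def S_calc,
     auto simp: fun_eq_iff S_simps(4) skew_monom_def algebra_simps)+

lemma T_to_S:
  obtains \<Psi> where "\<Psi> \<in> ring_hom T_ring S_ring" "\<And>p. \<Psi> (T_class p) = S.ev p"
  using S.T_hom_exists[OF S_relations] by blast

lemma S_ev_T_g: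
  fixes g :: "'a::field free_alg"
  defines "g \<equiv> (4 - free_gen Gen_x3 ^ 2) * free_gen Gen_x1 + free_gen Gen_x2 ^ 2
    + 3 * free_gen Gen_t * free_gen Gen_x3 * free_gen Gen_x2 + free_gen Gen_t ^ 2 * free_gen Gen_x3 ^ 2
    + 4 * free_gen Gen_t ^ 2"
  shows "S.ev g = \<zero>\<^bsub>S_ring\<^esub>"
proof -
  define x1 x2 x3 t where "x1 = (free_gen Gen_x1 :: 'a free_alg)" "x2 = (free_gen Gen_x2 :: 'a free_alg)"
    "x3 = (free_gen Gen_x3 :: 'a free_alg)" "t = (free_gen Gen_t :: 'a free_alg)"
  note vars = this
  \<comment> \<open>The only negative term of g is moved to the other side, so that the comparison
    of coefficients takes place between two sums.\<close>
  have "S.ev (4 * x1 + x2 ^ 2 + 3 * t * x3 * x2 + t ^ 2 * x3 ^ 2 + 4 * t ^ 2)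
      = S.ev (x3 ^ 2 * x1)"
    by (simp add: vars S_calc) (auto simp: fun_eq_iff S_simps skew_monom_def algebra_simps)
  moreover have "g = (4 * x1 + x2 ^ 2 + 3 * t * x3 * x2 + t ^ 2 * x3 ^ 2 + 4 * t ^ 2) - x3 ^ 2 * x1"
    by (simp add: g_def vars algebra_simps)
  ultimately show ?thesis
    by (simp only: S.ev_diff) (simp add: S.minus_eq S.r_neg)
qed

section \<open>Normal forms modulo \<open>g\<close>\<close>

lemma T_class_minus:
  "T_class (- p) = \<ominus>\<^bsub>T_ring\<^esub> T_class p" "T_class (p - q) = T_class p \<ominus>\<^bsub>T_ring\<^esub> T_class q"
proof -
  have neg: "T_class (- p) = \<ominus>\<^bsub>T_ring\<^esub> T_class p" for p
    by (rule T.minus_equality[symmetric]) (simp_all add: T_class_zero flip: T_class_simps)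
  show "T_class (- p) = \<ominus>\<^bsub>T_ring\<^esub> T_class p"
    by (rule neg)
  show "T_class (p - q) = T_class p \<ominus>\<^bsub>T_ring\<^esub> T_class q"
    using T_class_simps(1)[of p "- q"] by (simp add: neg T.minus_eq)
qed

lemma T_class_eqI:
  assumes "p - q = r" "T_class r = \<zero>\<^bsub>T_ring\<^esub>"
  shows "T_class p = T_class q"
proof -
  have "p = r + q"
    using assms(1) by (simp add: algebra_simps)
  then show ?thesis
    using assms(2) by (simp add: T_class_simps)
qed

lemma T_class_relator: "r \<in> T_relators \<Longrightarrow> T_class r = \<zero>\<^bsub>T_ring\<^esub>"
  using T_relation[of r 0] by (simp add: T_class_zero)

text \<open>Only the shape of the right-hand sides matters for spanning, hence the coefficients from
  \<F>[t] are quantified away. The left-hand sides are the products violating the order x1, x2, x3,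
  together with x2^2, which g eliminates.\<close>

lemma T_rewrite:
  fixes x1 x2 x3 :: "'a::field free_alg set"
  defines "x1 \<equiv> T_gen Gen_x1" and "x2 \<equiv> T_gen Gen_x2" and "x3 \<equiv> T_gen Gen_x3"
  shows "\<exists>c d. x3 \<otimes>\<^bsub>T_ring\<^esub> x2
      = x2 \<otimes>\<^bsub>T_ring\<^esub> x3 \<oplus>\<^bsub>T_ring\<^esub> (T_u c \<otimes>\<^bsub>T_ring\<^esub> (x3 \<otimes>\<^bsub>T_ring\<^esub> x3) \<oplus>\<^bsub>T_ring\<^esub> T_u d)"
    and "\<exists>c d. x3 \<otimes>\<^bsub>T_ring\<^esub> x1
      = x1 \<otimes>\<^bsub>T_ring\<^esub> x3 \<oplus>\<^bsub>T_ring\<^esub> (T_u c \<otimes>\<^bsub>T_ring\<^esub> x3 \<oplus>\<^bsub>T_ring\<^esub> T_u d \<otimes>\<^bsub>T_ring\<^esub> x2)"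
    and "\<exists>c d e. x2 \<otimes>\<^bsub>T_ring\<^esub> x1
      = x1 \<otimes>\<^bsub>T_ring\<^esub> x2 \<oplus>\<^bsub>T_ring\<^esub> (T_u c \<otimes>\<^bsub>T_ring\<^esub> (x3 \<otimes>\<^bsub>T_ring\<^esub> x1)
        \<oplus>\<^bsub>T_ring\<^esub> (T_u d \<otimes>\<^bsub>T_ring\<^esub> x2 \<oplus>\<^bsub>T_ring\<^esub> T_u e \<otimes>\<^bsub>T_ring\<^esub> x3))"
    and "\<exists>c d. x2 \<otimes>\<^bsub>T_ring\<^esub> x2
      = T_g \<oplus>\<^bsub>T_ring\<^esub> (x1 \<otimes>\<^bsub>T_ring\<^esub> x3 \<otimes>\<^bsub>T_ring\<^esub> x3
        \<oplus>\<^bsub>T_ring\<^esub> (T_u c \<otimes>\<^bsub>T_ring\<^esub> x1 \<oplus>\<^bsub>T_ring\<^esub> T_u d \<otimes>\<^bsub>T_ring\<^esub> (x2 \<otimes>\<^bsub>T_ring\<^esub> x3)))"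
proof -
  define f1 f2 f3 s where "f1 = (free_gen Gen_x1 :: 'a free_alg)" "f2 = (free_gen Gen_x2 :: 'a free_alg)"
    "f3 = (free_gen Gen_x3 :: 'a free_alg)" "s = (free_gen Gen_t :: 'a free_alg)"
  note vars = this
  have gens: "T_gen Gen_x1 = T_class f1" "T_gen Gen_x2 = T_class f2" "T_gen Gen_x3 = T_class f3"
    by (simp_all add: T_gen_def vars)
  define r3 where "r3 = f3 * s - s * f3"
  define r12 where "r12 = f1 * f2 - (f2 * f1 - 2 * s * f3 * f1 + 3 * s ^ 2 * f2 + 2 * s ^ 3 * f3)"
  define r23 where "r23 = f2 * f3 - (f3 * f2 - s * f3 ^ 2 + 4 * s)"
  define r13 where "r13 = f1 * f3 - (f3 * f1 - s ^ 2 * f3 - 2 * s * f2)"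
  note r_defs = r3_def r12_def r23_def r13_def
  have zero [simp]: "T_class r3 = \<zero>\<^bsub>T_ring\<^esub>" "T_class r12 = \<zero>\<^bsub>T_ring\<^esub>" "T_class r23 = \<zero>\<^bsub>T_ring\<^esub>"
    "T_class r13 = \<zero>\<^bsub>T_ring\<^esub>"
    by (rule T_class_relator; simp add: T_relators_def Let_def vars r_defs)+
  have u: "T_u [:a:] = T_class (free_const a)" "T_u (pCons 0 p) = T_u p \<otimes>\<^bsub>T_ring\<^esub> T_class s" for a :: 'a and p
    by (simp_all add: T_u_def) (simp_all add: T_const_def T_gen_def vars)
  have neg: "free_const (- a) = - free_const a" for a :: 'a
    by (simp add: free_const_def single_uminus)
  have comm: "p * numeral k = numeral k * p" "p * (numeral k * q) = numeral k * (p * q)"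
    for p q :: "'a free_alg" and k
    using numeral_comm[of p k] by (simp_all flip: mult.assoc)
  have three: "3 * p = p + p + p" for p :: "'a free_alg"
    using distrib_right[of 2 1 p] by (simp add: mult_2)
  note to_class = u neg T_class_simps(1,2)[symmetric]
  have "x3 \<otimes>\<^bsub>T_ring\<^esub> x2
      = x2 \<otimes>\<^bsub>T_ring\<^esub> x3 \<oplus>\<^bsub>T_ring\<^esub> (T_u [:0, 1:] \<otimes>\<^bsub>T_ring\<^esub> (x3 \<otimes>\<^bsub>T_ring\<^esub> x3) \<oplus>\<^bsub>T_ring\<^esub> T_u [:0, - 4:])"
    unfolding x2_def x3_def gens to_class
    by (rule T_class_eqI[where r = "- r23"])
      (simp add: r_defs algebra_simps power2_eq_square, simp add: T_class_minus)
  then show "\<exists>c d. x3 \<otimes>\<^bsub>T_ring\<^esub> x2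
      = x2 \<otimes>\<^bsub>T_ring\<^esub> x3 \<oplus>\<^bsub>T_ring\<^esub> (T_u c \<otimes>\<^bsub>T_ring\<^esub> (x3 \<otimes>\<^bsub>T_ring\<^esub> x3) \<oplus>\<^bsub>T_ring\<^esub> T_u d)"
    by blast
  have "x3 \<otimes>\<^bsub>T_ring\<^esub> x1
      = x1 \<otimes>\<^bsub>T_ring\<^esub> x3 \<oplus>\<^bsub>T_ring\<^esub> (T_u [:0, 0, 1:] \<otimes>\<^bsub>T_ring\<^esub> x3 \<oplus>\<^bsub>T_ring\<^esub> T_u [:0, 2:] \<otimes>\<^bsub>T_ring\<^esub> x2)"
    unfolding x1_def x2_def x3_def gens to_class
    by (rule T_class_eqI[where r = "- r13"])
      (simp add: r_defs algebra_simps power2_eq_square, simp add: T_class_minus)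
  then show "\<exists>c d. x3 \<otimes>\<^bsub>T_ring\<^esub> x1
      = x1 \<otimes>\<^bsub>T_ring\<^esub> x3 \<oplus>\<^bsub>T_ring\<^esub> (T_u c \<otimes>\<^bsub>T_ring\<^esub> x3 \<oplus>\<^bsub>T_ring\<^esub> T_u d \<otimes>\<^bsub>T_ring\<^esub> x2)"
    by blast
  have "x2 \<otimes>\<^bsub>T_ring\<^esub> x1
      = x1 \<otimes>\<^bsub>T_ring\<^esub> x2 \<oplus>\<^bsub>T_ring\<^esub> (T_u [:0, 2:] \<otimes>\<^bsub>T_ring\<^esub> (x3 \<otimes>\<^bsub>T_ring\<^esub> x1)
        \<oplus>\<^bsub>T_ring\<^esub> (T_u [:0, 0, - 3:] \<otimes>\<^bsub>T_ring\<^esub> x2 \<oplus>\<^bsub>T_ring\<^esub> T_u [:0, 0, 0, - 2:] \<otimes>\<^bsub>T_ring\<^esub> x3))"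
    unfolding x1_def x2_def x3_def gens to_class
    by (rule T_class_eqI[where r = "- r12"])
      (simp add: r_defs algebra_simps power2_eq_square power3_eq_cube, simp add: T_class_minus)
  then show "\<exists>c d e. x2 \<otimes>\<^bsub>T_ring\<^esub> x1
      = x1 \<otimes>\<^bsub>T_ring\<^esub> x2 \<oplus>\<^bsub>T_ring\<^esub> (T_u c \<otimes>\<^bsub>T_ring\<^esub> (x3 \<otimes>\<^bsub>T_ring\<^esub> x1)
        \<oplus>\<^bsub>T_ring\<^esub> (T_u d \<otimes>\<^bsub>T_ring\<^esub> x2 \<oplus>\<^bsub>T_ring\<^esub> T_u e \<otimes>\<^bsub>T_ring\<^esub> x3))"
    by blast
  have "x2 \<otimes>\<^bsub>T_ring\<^esub> x2
      = T_g \<oplus>\<^bsub>T_ring\<^esub> (x1 \<otimes>\<^bsub>T_ring\<^esub> x3 \<otimes>\<^bsub>T_ring\<^esub> x3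
        \<oplus>\<^bsub>T_ring\<^esub> (T_u [:- 4:] \<otimes>\<^bsub>T_ring\<^esub> x1 \<oplus>\<^bsub>T_ring\<^esub> T_u [:0, 1:] \<otimes>\<^bsub>T_ring\<^esub> (x2 \<otimes>\<^bsub>T_ring\<^esub> x3)))"
    unfolding x1_def x2_def x3_def gens to_class T_g_def Let_def vars[symmetric]
    \<comment> \<open>Exchanging x1 with x3^2 contributes - r13 x3 - x3 r13; the terms with r3 bring
      t to the left of x3, and what remains is t times r23.\<close>
    by (rule T_class_eqI[where r = "s * r23 + (r3 * s + s * r3) * f3 + 2 * r3 * f2 - r13 * f3 - f3 * r13"])
      (simp add: r_defs algebra_simps power2_eq_square comm mult_2 three, simp add: T_class_minus T_class_simps)
  then show "\<exists>c d. x2 \<otimes>\<^bsub>T_ring\<^esub> x2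
      = T_g \<oplus>\<^bsub>T_ring\<^esub> (x1 \<otimes>\<^bsub>T_ring\<^esub> x3 \<otimes>\<^bsub>T_ring\<^esub> x3
        \<oplus>\<^bsub>T_ring\<^esub> (T_u c \<otimes>\<^bsub>T_ring\<^esub> x1 \<oplus>\<^bsub>T_ring\<^esub> T_u d \<otimes>\<^bsub>T_ring\<^esub> (x2 \<otimes>\<^bsub>T_ring\<^esub> x3)))"
    by blast
qed

section \<open>The span of the normal forms modulo g\<close>

abbreviation T_k :: "'a::field poly poly \<Rightarrow> 'a free_alg set"
  where "T_k \<equiv> T_pv (T_gen Gen_x1)"

text \<open>The sum of all a_n(x1) x3^n. In \<open>T_F\<close> the factor x2 stands between the
  coefficient and the power of x3.\<close>

definition T_E :: "'a::field poly poly poly \<Rightarrow> 'a free_alg set"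
  where "T_E = poly_ev T_ring T_k (T_gen Gen_x3)"

definition T_F :: "'a::field poly poly poly \<Rightarrow> 'a free_alg set"
  where "T_F = poly_ev T_ring (\<lambda>b. T_k b \<otimes>\<^bsub>T_ring\<^esub> T_gen Gen_x2) (T_gen Gen_x3)"

interpretation T_E: poly_eval T_ring T_k "T_gen Gen_x3"
  by unfold_locales (simp_all add: T_pv_simps)

interpretation T_F: poly_eval T_ring "\<lambda>b. T_k b \<otimes>\<^bsub>T_ring\<^esub> T_gen Gen_x2" "T_gen Gen_x3"
  by unfold_locales (simp_all add: T_pv_simps T.l_distr)

lemma T_EF_simps [simp]:
  "T_E 0 = \<zero>\<^bsub>T_ring\<^esub>" "T_E (pCons a \<alpha>) = T_k a \<oplus>\<^bsub>T_ring\<^esub> T_E \<alpha> \<otimes>\<^bsub>T_ring\<^esub> T_gen Gen_x3"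
  "T_E \<alpha> \<in> carrier T_ring" "T_E (\<alpha> + \<beta>) = T_E \<alpha> \<oplus>\<^bsub>T_ring\<^esub> T_E \<beta>"
  "T_F 0 = \<zero>\<^bsub>T_ring\<^esub>"
  "T_F (pCons a \<alpha>) = T_k a \<otimes>\<^bsub>T_ring\<^esub> T_gen Gen_x2 \<oplus>\<^bsub>T_ring\<^esub> T_F \<alpha> \<otimes>\<^bsub>T_ring\<^esub> T_gen Gen_x3"
  "T_F \<alpha> \<in> carrier T_ring" "T_F (\<alpha> + \<beta>) = T_F \<alpha> \<oplus>\<^bsub>T_ring\<^esub> T_F \<beta>"
  unfolding T_E_def T_F_def by simp_all

lemma T_EF_smult:
  "T_k a \<otimes>\<^bsub>T_ring\<^esub> T_E \<alpha> = T_E (smult a \<alpha>)" "T_k a \<otimes>\<^bsub>T_ring\<^esub> T_F \<alpha> = T_F (smult a \<alpha>)"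
  unfolding T_E_def T_F_def
  by (rule T_E.poly_ev_smult, simp_all add: T_pv_simps)
    (rule T_F.poly_ev_smult, simp_all add: T_pv_simps T.m_assoc)

lemma T_k_zero [simp]: "T_k 0 = \<zero>\<^bsub>T_ring\<^esub>"
  by (rule T_E.eta_zero)

lemma T_k_const: "T_k [:c:] = T_u c"
  using poly_eval.poly_ev_pCons[OF T_pv_eval[OF T_gen_closed(1)], of Gen_x1 c 0]
    ring_hom_closed[OF T_u_hom, of c]
  by (simp add: T_pv_def poly_eval.poly_ev_zero[OF T_pv_eval])

text \<open>The multiples of g belong to the set because rewriting x2^2 produces one. The goal is
  closure under right multiplication by every generator; since 1 is in the set, it is then all of
  T.\<close>

definition T_spanned :: "'a::field free_alg set set"
  where "T_spanned = {T_g \<otimes>\<^bsub>T_ring\<^esub> q \<oplus>\<^bsub>T_ring\<^esub> (T_E \<alpha> \<oplus>\<^bsub>T_ring\<^esub> T_F \<beta>) | q \<alpha> \<beta>. q \<in> carrier T_ring}"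

lemma T_g_carrier [simp]: "T_g \<in> carrier T_ring"
  by (simp add: T_g_def Let_def)

lemma T_g_comm: "x \<in> carrier T_ring \<Longrightarrow> x \<otimes>\<^bsub>T_ring\<^esub> T_g = T_g \<otimes>\<^bsub>T_ring\<^esub> x"
  using T_g_central by (auto simp: central_def)

lemma T_spanned_I: "q \<in> carrier T_ring \<Longrightarrow>
    m = T_g \<otimes>\<^bsub>T_ring\<^esub> q \<oplus>\<^bsub>T_ring\<^esub> (T_E \<alpha> \<oplus>\<^bsub>T_ring\<^esub> T_F \<beta>) \<Longrightarrow> m \<in> T_spanned"
  unfolding T_spanned_def by blast

lemma T_spanned_E: "T_E \<alpha> \<in> T_spanned"
  by (rule T_spanned_I[of "\<zero>\<^bsub>T_ring\<^esub>" _ \<alpha> 0]) simp_all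

lemma T_spanned_F: "T_F \<beta> \<in> T_spanned"
  by (rule T_spanned_I[of "\<zero>\<^bsub>T_ring\<^esub>" _ 0 \<beta>]) simp_all

lemma T_spanned_g: "q \<in> carrier T_ring \<Longrightarrow> T_g \<otimes>\<^bsub>T_ring\<^esub> q \<in> T_spanned"
  by (rule T_spanned_I[of q _ 0 0]) simp_all

lemma T_spanned_carrier: "m \<in> T_spanned \<Longrightarrow> m \<in> carrier T_ring"
  unfolding T_spanned_def by auto

lemma T_spanned_add:
  assumes "m \<in> T_spanned" "n \<in> T_spanned"
  shows "m \<oplus>\<^bsub>T_ring\<^esub> n \<in> T_spanned"
proof -
  obtain q \<alpha> \<beta> where m: "q \<in> carrier T_ring"
    "m = T_g \<otimes>\<^bsub>T_ring\<^esub> q \<oplus>\<^bsub>T_ring\<^esub> (T_E \<alpha> \<oplus>\<^bsub>T_ring\<^esub> T_F \<beta>)"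
    using assms(1) unfolding T_spanned_def by blast
  obtain q' \<alpha>' \<beta>' where n: "q' \<in> carrier T_ring"
    "n = T_g \<otimes>\<^bsub>T_ring\<^esub> q' \<oplus>\<^bsub>T_ring\<^esub> (T_E \<alpha>' \<oplus>\<^bsub>T_ring\<^esub> T_F \<beta>')"
    using assms(2) unfolding T_spanned_def by blast
  show ?thesis
    by (rule T_spanned_I[of "q \<oplus>\<^bsub>T_ring\<^esub> q'" _ "\<alpha> + \<alpha>'" "\<beta> + \<beta>'"])
      (use m n in \<open>simp_all add: T.r_distr T.a_ac\<close>)
qed

text \<open>Coefficients in x1 multiply from the left without any rewriting; on the multiples of g
  this uses that g is central.\<close>

lemma T_spanned_k:
  assumes "m \<in> T_spanned"
  shows "T_k a \<otimes>\<^bsub>T_ring\<^esub> m \<in> T_spanned"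
proof -
  obtain q \<alpha> \<beta> where m: "q \<in> carrier T_ring"
    "m = T_g \<otimes>\<^bsub>T_ring\<^esub> q \<oplus>\<^bsub>T_ring\<^esub> (T_E \<alpha> \<oplus>\<^bsub>T_ring\<^esub> T_F \<beta>)"
    using assms unfolding T_spanned_def by blast
  have "T_k a \<otimes>\<^bsub>T_ring\<^esub> (T_g \<otimes>\<^bsub>T_ring\<^esub> q) = T_g \<otimes>\<^bsub>T_ring\<^esub> (T_k a \<otimes>\<^bsub>T_ring\<^esub> q)"
    using m(1) T_g_comm[of "T_k a"] by (simp flip: T.m_assoc)
  then show ?thesis
    by (intro T_spanned_I[of "T_k a \<otimes>\<^bsub>T_ring\<^esub> q" _ "smult a \<alpha>" "smult a \<beta>"])
      (use m in \<open>simp_all add: T.r_distr T_EF_smult\<close>)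
qed

lemma T_spanned_u: "m \<in> T_spanned \<Longrightarrow> T_u c \<otimes>\<^bsub>T_ring\<^esub> m \<in> T_spanned"
  using T_spanned_k[of m "[:c:]"] by (simp add: T_k_const)

lemma T_spanned_x3:
  assumes "m \<in> T_spanned"
  shows "m \<otimes>\<^bsub>T_ring\<^esub> T_gen Gen_x3 \<in> T_spanned"
proof -
  obtain q \<alpha> \<beta> where m: "q \<in> carrier T_ring"
    "m = T_g \<otimes>\<^bsub>T_ring\<^esub> q \<oplus>\<^bsub>T_ring\<^esub> (T_E \<alpha> \<oplus>\<^bsub>T_ring\<^esub> T_F \<beta>)"
    using assms unfolding T_spanned_def by blast
  show ?thesis
    by (rule T_spanned_I[of "q \<otimes>\<^bsub>T_ring\<^esub> T_gen Gen_x3" _ "pCons 0 \<alpha>" "pCons 0 \<beta>"])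
      (use m in \<open>simp_all add: T.l_distr T.m_assoc\<close>)
qed

lemma T_u_closed [simp]: "T_u c \<in> carrier T_ring"
  using ring_hom_closed[OF T_u_hom] by simp

lemma T_u_left_comm:
  "\<lbrakk>x \<in> carrier T_ring; y \<in> carrier T_ring\<rbrakk> \<Longrightarrow>
    x \<otimes>\<^bsub>T_ring\<^esub> (T_u c \<otimes>\<^bsub>T_ring\<^esub> y) = T_u c \<otimes>\<^bsub>T_ring\<^esub> (x \<otimes>\<^bsub>T_ring\<^esub> y)"
  using T_u_comm[of x c] by (simp flip: T.m_assoc)

text \<open>
  Moving \<open>x\<^sub>2\<close> or \<open>x\<^sub>1\<close> to the left of a factor \<open>x\<^sub>3\<close> produces only terms
  that stay in \<open>T_spanned\<close>.
\<close>

lemma T_spanned_x3_x2: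
  assumes "m \<in> T_spanned" "m \<otimes>\<^bsub>T_ring\<^esub> T_gen Gen_x2 \<in> T_spanned"
  shows "m \<otimes>\<^bsub>T_ring\<^esub> T_gen Gen_x3 \<otimes>\<^bsub>T_ring\<^esub> T_gen Gen_x2 \<in> T_spanned"
proof -
  obtain c d where cd: "T_gen Gen_x3 \<otimes>\<^bsub>T_ring\<^esub> T_gen Gen_x2
      = T_gen Gen_x2 \<otimes>\<^bsub>T_ring\<^esub> T_gen Gen_x3 \<oplus>\<^bsub>T_ring\<^esub>
        (T_u c \<otimes>\<^bsub>T_ring\<^esub> (T_gen Gen_x3 \<otimes>\<^bsub>T_ring\<^esub> T_gen Gen_x3) \<oplus>\<^bsub>T_ring\<^esub> (T_u d :: 'a free_alg set))"
    using T_rewrite(1) by blast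
  have m: "m \<in> carrier T_ring"
    using assms(1) by (rule T_spanned_carrier)
  have "m \<otimes>\<^bsub>T_ring\<^esub> T_gen Gen_x3 \<otimes>\<^bsub>T_ring\<^esub> T_gen Gen_x2
      = m \<otimes>\<^bsub>T_ring\<^esub> T_gen Gen_x2 \<otimes>\<^bsub>T_ring\<^esub> T_gen Gen_x3 \<oplus>\<^bsub>T_ring\<^esub>
        (T_u c \<otimes>\<^bsub>T_ring\<^esub> (m \<otimes>\<^bsub>T_ring\<^esub> T_gen Gen_x3 \<otimes>\<^bsub>T_ring\<^esub> T_gen Gen_x3)
          \<oplus>\<^bsub>T_ring\<^esub> T_u d \<otimes>\<^bsub>T_ring\<^esub> m)"
    using m by (simp add: T.m_assoc cd T.r_distr T_u_left_comm T_u_comm)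
  then show ?thesis
    using assms by (simp add: T_spanned_add T_spanned_u T_spanned_x3)
qed

lemma T_spanned_x3_x1:
  assumes "m \<in> T_spanned" "m \<otimes>\<^bsub>T_ring\<^esub> T_gen Gen_x2 \<in> T_spanned" "m \<otimes>\<^bsub>T_ring\<^esub> T_gen Gen_x1 \<in> T_spanned"
  shows "m \<otimes>\<^bsub>T_ring\<^esub> T_gen Gen_x3 \<otimes>\<^bsub>T_ring\<^esub> T_gen Gen_x1 \<in> T_spanned"
proof -
  obtain c d where cd: "T_gen Gen_x3 \<otimes>\<^bsub>T_ring\<^esub> T_gen Gen_x1
      = T_gen Gen_x1 \<otimes>\<^bsub>T_ring\<^esub> T_gen Gen_x3 \<oplus>\<^bsub>T_ring\<^esub>
        (T_u c \<otimes>\<^bsub>T_ring\<^esub> T_gen Gen_x3 \<oplus>\<^bsub>T_ring\<^esub> (T_u d \<otimes>\<^bsub>T_ring\<^esub> T_gen Gen_x2 :: 'a free_alg set))"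
    using T_rewrite(2) by blast
  have m: "m \<in> carrier T_ring"
    using assms(1) by (rule T_spanned_carrier)
  have "m \<otimes>\<^bsub>T_ring\<^esub> T_gen Gen_x3 \<otimes>\<^bsub>T_ring\<^esub> T_gen Gen_x1
      = m \<otimes>\<^bsub>T_ring\<^esub> T_gen Gen_x1 \<otimes>\<^bsub>T_ring\<^esub> T_gen Gen_x3 \<oplus>\<^bsub>T_ring\<^esub>
        (T_u c \<otimes>\<^bsub>T_ring\<^esub> (m \<otimes>\<^bsub>T_ring\<^esub> T_gen Gen_x3)
          \<oplus>\<^bsub>T_ring\<^esub> T_u d \<otimes>\<^bsub>T_ring\<^esub> (m \<otimes>\<^bsub>T_ring\<^esub> T_gen Gen_x2))"
    using m by (simp add: T.m_assoc cd T.r_distr T_u_left_comm)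
  then show ?thesis
    using assms by (simp add: T_spanned_add T_spanned_u T_spanned_x3)
qed

lemma T_spanned_k_x2: "T_k a \<otimes>\<^bsub>T_ring\<^esub> T_gen Gen_x2 \<in> T_spanned"
  using T_spanned_F[of "[:a:]"] by simp

lemma T_spanned_k_mem: "T_k a \<in> T_spanned"
  using T_spanned_E[of "[:a:]"] by simp

lemma T_k_x1: "T_k xx = T_gen Gen_x1" "T_k 1 = \<one>\<^bsub>T_ring\<^esub>"
  using ring_hom_one[OF T_pv_hom[OF T_gen_closed(1)], of Gen_x1] by (simp_all add: T_pv_simps)

lemma T_spanned_gens: "T_gen Gen_x1 \<in> T_spanned" "T_gen Gen_x2 \<in> T_spanned" "T_gen Gen_x3 \<in> T_spanned"
  "T_gen Gen_x1 \<otimes>\<^bsub>T_ring\<^esub> T_gen Gen_x2 \<in> T_spanned"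
  using T_spanned_k_mem[of xx] T_spanned_k_x2[of 1] T_spanned_E[of "[:0, 1:]"] T_spanned_k_x2[of xx] by (simp_all add: T_k_x1)

lemma T_spanned_x2_x2: "T_gen Gen_x2 \<otimes>\<^bsub>T_ring\<^esub> T_gen Gen_x2 \<in> T_spanned"
proof -
  obtain c d where cd: "T_gen Gen_x2 \<otimes>\<^bsub>T_ring\<^esub> T_gen Gen_x2
      = T_g \<oplus>\<^bsub>T_ring\<^esub> (T_gen Gen_x1 \<otimes>\<^bsub>T_ring\<^esub> T_gen Gen_x3 \<otimes>\<^bsub>T_ring\<^esub> T_gen Gen_x3
        \<oplus>\<^bsub>T_ring\<^esub> (T_u c \<otimes>\<^bsub>T_ring\<^esub> T_gen Gen_x1
          \<oplus>\<^bsub>T_ring\<^esub> (T_u d \<otimes>\<^bsub>T_ring\<^esub> (T_gen Gen_x2 \<otimes>\<^bsub>T_ring\<^esub> T_gen Gen_x3) :: 'a free_alg set)))"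
    using T_rewrite(4) by blast
  have "T_g \<in> T_spanned"
    using T_spanned_g[of "\<one>\<^bsub>T_ring\<^esub>"] by simp
  then show ?thesis
    unfolding cd by (intro T_spanned_add T_spanned_u T_spanned_x3 T_spanned_gens)
qed

lemma T_spanned_x2_x1: "T_gen Gen_x2 \<otimes>\<^bsub>T_ring\<^esub> T_gen Gen_x1 \<in> T_spanned"
proof -
  obtain c d e where cde: "T_gen Gen_x2 \<otimes>\<^bsub>T_ring\<^esub> T_gen Gen_x1
      = T_gen Gen_x1 \<otimes>\<^bsub>T_ring\<^esub> T_gen Gen_x2 \<oplus>\<^bsub>T_ring\<^esub>
        (T_u c \<otimes>\<^bsub>T_ring\<^esub> (T_gen Gen_x3 \<otimes>\<^bsub>T_ring\<^esub> T_gen Gen_x1)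
        \<oplus>\<^bsub>T_ring\<^esub> (T_u d \<otimes>\<^bsub>T_ring\<^esub> T_gen Gen_x2
          \<oplus>\<^bsub>T_ring\<^esub> (T_u e \<otimes>\<^bsub>T_ring\<^esub> T_gen Gen_x3 :: 'a free_alg set)))"
    using T_rewrite(3) by blast
  have "\<one>\<^bsub>T_ring\<^esub> \<in> T_spanned"
    using T_spanned_k_mem[of 1] by (simp add: T_k_x1)
  then have "T_gen Gen_x3 \<otimes>\<^bsub>T_ring\<^esub> T_gen Gen_x1 \<in> T_spanned"
    using T_spanned_x3_x1[of "\<one>\<^bsub>T_ring\<^esub>"] T_spanned_gens by simp
  then show ?thesis
    unfolding cde by (intro T_spanned_add T_spanned_u T_spanned_gens)
qed

text \<open>Induction along the Horner form a + (...) x3. Right multiplication by x2 is treated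
  before x1, because exchanging x3 with x1 leaves terms that end in x2.\<close>

lemma T_spanned_EF_x2: "T_E \<alpha> \<otimes>\<^bsub>T_ring\<^esub> T_gen Gen_x2 \<in> T_spanned" "T_F \<alpha> \<otimes>\<^bsub>T_ring\<^esub> T_gen Gen_x2 \<in> T_spanned"
proof (induction \<alpha>)
  case 0
  {
    case 1
    then show ?case using T_spanned_E[of 0] by simp
  next
    case 2
    then show ?case using T_spanned_E[of 0] by simp
  }
next
  case (pCons a \<alpha>)
  {
    case 1
    then show ?case
      using pCons(2) by (simp add: T.l_distr T_spanned_add T_spanned_k_x2 T_spanned_x3_x2 T_spanned_E)
  next
    case 2
    then show ?case
      using pCons(3) by (simp add: T.l_distr T.m_assoc[of "T_k a"] T_spanned_add T_spanned_k T_spanned_x2_x2 T_spanned_x3_x2 T_spanned_F)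
  }
qed

lemma T_spanned_x2:
  assumes "m \<in> T_spanned"
  shows "m \<otimes>\<^bsub>T_ring\<^esub> T_gen Gen_x2 \<in> T_spanned"
proof -
  obtain q \<alpha> \<beta> where m: "q \<in> carrier T_ring"
    "m = T_g \<otimes>\<^bsub>T_ring\<^esub> q \<oplus>\<^bsub>T_ring\<^esub> (T_E \<alpha> \<oplus>\<^bsub>T_ring\<^esub> T_F \<beta>)"
    using assms unfolding T_spanned_def by blast
  then show ?thesis
    by (simp add: T.l_distr T.m_assoc[of T_g] T_spanned_add T_spanned_g T_spanned_EF_x2)
qed

lemma T_spanned_EF_x1: "T_E \<alpha> \<otimes>\<^bsub>T_ring\<^esub> T_gen Gen_x1 \<in> T_spanned" "T_F \<alpha> \<otimes>\<^bsub>T_ring\<^esub> T_gen Gen_x1 \<in> T_spanned"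
proof (induction \<alpha>)
  case 0
  {
    case 1
    then show ?case using T_spanned_E[of 0] by simp
  next
    case 2
    then show ?case using T_spanned_E[of 0] by simp
  }
next
  case (pCons a \<alpha>)
  {
    case 1
    have "T_k a \<otimes>\<^bsub>T_ring\<^esub> T_gen Gen_x1 \<in> T_spanned"
      using T_spanned_k[OF T_spanned_gens(1)] .
    then show ?case
      using pCons(2) by (simp add: T.l_distr T_spanned_add T_spanned_x3_x1 T_spanned_x2 T_spanned_E)
  next
    case 2
    then show ?case
      using pCons(3) by (simp add: T.l_distr T.m_assoc[of "T_k a"] T_spanned_add T_spanned_k T_spanned_x2_x1 T_spanned_x3_x1
          T_spanned_x2 T_spanned_F)
  }
qed

lemma T_spanned_x1:
  assumes "m \<in> T_spanned"
  shows "m \<otimes>\<^bsub>T_ring\<^esub> T_gen Gen_x1 \<in> T_spanned"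
proof -
  obtain q \<alpha> \<beta> where m: "q \<in> carrier T_ring"
    "m = T_g \<otimes>\<^bsub>T_ring\<^esub> q \<oplus>\<^bsub>T_ring\<^esub> (T_E \<alpha> \<oplus>\<^bsub>T_ring\<^esub> T_F \<beta>)"
    using assms unfolding T_spanned_def by blast
  then show ?thesis
    by (simp add: T.l_distr T.m_assoc[of T_g] T_spanned_add T_spanned_g T_spanned_EF_x1)
qed

text \<open>The induction shows that right multiplication by x preserves the span. Unlike mere
  membership of x, this property passes to products at once; applied to 1 it gives
  membership.\<close>

theorem T_normal_form:
  assumes "x \<in> carrier T_ring"
  shows "\<exists>q\<in>carrier T_ring. \<exists>\<alpha> \<beta>.
    x = T_g \<otimes>\<^bsub>T_ring\<^esub> q \<oplus>\<^bsub>T_ring\<^esub> (T_E \<alpha> \<oplus>\<^bsub>T_ring\<^esub> T_F \<beta>)"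
proof -
  have "\<forall>m\<in>T_spanned. m \<otimes>\<^bsub>T_ring\<^esub> x \<in> T_spanned"
    using assms
  proof (induction rule: T_induct)
    case (const c)
    show ?case
      using T_spanned_k[of _ "[:[:c:]:]"] by (auto simp: T_pv_simps T_const_comm T_spanned_carrier)
  next
    case (gen v)
    show ?case
      using T_spanned_k[of _ tt]
      by (cases v) (auto simp: T_pv_simps T_t_comm T_spanned_carrier T_spanned_x1 T_spanned_x2 T_spanned_x3)
  next
    case (add x y)
    then show ?case
      by (auto simp: T.r_distr T_spanned_carrier T_spanned_add)
  next
    case (mult x y)
    then show ?case
      by (auto simp: T_spanned_carrier simp flip: T.m_assoc)
  qed
  then have "x \<in> T_spanned"
    using T_spanned_k_mem[of 1] assms by (auto simp: T_k_x1 dest: bspec[of _ _ "\<one>\<^bsub>T_ring\<^esub>"])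
  then show ?thesis
    unfolding T_spanned_def by blast
qed

section \<open>The isomorphism with the fixed ring\<close>

definition sq :: "'a::field poly poly \<Rightarrow> 'a poly poly"
  where "sq a = pcompose a (xx * xx)"

lemma sq_simps [simp]:
  "sq 0 = 0" "sq (pCons c a) = pCons c (pCons 0 (sq a))" "sq 1 = 1" "sq xx = xx * xx" "sq tt = tt"
  by (simp_all add: sq_def xx_def tt_def pcompose_pCons) (simp add: one_pCons pcompose_pCons)

lemma sq_add: "sq (a + b) = sq a + sq b" and sq_mult: "sq (a * b) = sq a * sq b"
  by (simp_all add: sq_def pcompose_add pcompose_mult)

lemma xx_mult: "xx * p = pCons 0 p"
  by (simp add: xx_def)

text \<open>Multiplication by y exchanges the even and the odd part, and the new constant term joins
  the even one.\<close>

lemma parity_split: "\<exists>a b. p = sq a + xx * sq b"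
proof (induction p)
  case 0
  then show ?case
    by (intro exI[of _ 0]) simp
next
  case (pCons c p)
  then obtain a b where "p = sq a + xx * sq b"
    by blast
  then have "pCons c p = sq (pCons c b) + xx * sq a"
    by (simp add: xx_mult)
  then show ?case
    by blast
qed

lemma parity_unique: "sq a + xx * sq b = 0 \<longleftrightarrow> a = 0 \<and> b = 0"
  by (induction a b rule: poly_induct2) (auto simp: xx_mult simp del: mult_pCons_right)

definition refl_y :: "'a::field poly poly \<Rightarrow> 'a poly poly"
  where "refl_y p = pcompose p [:0, - 1:]"

lemma refl_y_simps [simp]:
  "refl_y 0 = 0" "refl_y 1 = 1" "refl_y (p + q) = refl_y p + refl_y q" "refl_y (- p) = - refl_y p"
  "refl_y (p * q) = refl_y p * refl_y q" "refl_y xx = - xx" "refl_y tt = tt" "refl_y [:a:] = [:a:]"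
  by (simp_all add: refl_y_def pcompose_add pcompose_mult pcompose_uminus xx_def tt_def
      pcompose_pCons one_pCons)

lemma refl_y_sq [simp]: "refl_y (sq a) = sq a"
  by (induction a) (simp_all add: refl_y_def pcompose_pCons)

lemma refl_y_eq_zero_iff [simp]: "refl_y p = 0 \<longleftrightarrow> p = 0"
proof -
  have "refl_y (refl_y p) = p"
    by (simp add: refl_y_def pcompose_pCons flip: pcompose_assoc)
  then show ?thesis
    by (metis refl_y_simps(1))
qed

section \<open>Top coefficients of the normal forms in S\<close>

lemma S_hom_T_k:
  assumes hom: "\<Psi> \<in> ring_hom T_ring S_ring" and cls: "\<And>p. \<Psi> (T_class p) = S.ev p"
  shows "\<Psi> (T_k a) = S_m (sq a) 0"
proof (induction a rule: poly_poly_induct)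
  case (const c)
  then show ?case
    by (simp add: T_pv_simps T_const_def cls S_const_def)
next
  case (add p q)
  then show ?case
    by (simp add: T_pv_simps ring_hom_add[OF hom] S_m_add sq_add)
next
  case (mult p q)
  then show ?case
    by (simp add: T_pv_simps ring_hom_mult[OF hom] S_m_mult sq_mult)
qed (simp_all add: T_pv_simps T_gen_def cls)

lemma S_mult_shift:
  "f \<in> carrier S_ring \<Longrightarrow> f \<otimes>\<^bsub>S_ring\<^esub> S_m 1 j = (\<lambda>n. f (n - j))"
  by (induction rule: S_induct)
    (simp_all add: S.l_distr S_m_mult, simp_all add: S_simps fun_eq_iff skew_monom_def)

lemma S_mult_x3:
  "f \<in> carrier S_ring \<Longrightarrow> (f \<otimes>\<^bsub>S_ring\<^esub> S_gen Gen_x3) n = f (n - 1) + f (n + 1)"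
  by (simp add: S.r_distr S_mult_shift) (simp add: S_simps)

text \<open>Multiplication by x3 adds the two neighbouring coefficients. The hypothesis is an
  inequality so that induction applies both at the top exponent and two places above it, where it
  yields zero. In \<open>T_F\<close> exponents are one higher because x2 contributes a factor
  x.\<close>

lemma S_hom_top:
  fixes \<Psi> :: "'a::field free_alg set \<Rightarrow> int \<Rightarrow> 'a poly poly"
  assumes hom: "\<Psi> \<in> ring_hom T_ring S_ring" and cls: "\<And>p. \<Psi> (T_class p) = S.ev p"
  shows "degree \<alpha> \<le> n \<Longrightarrow> \<Psi> (T_E \<alpha>) (int n) = sq (coeff \<alpha> n)"
    and "degree \<alpha> \<le> n \<Longrightarrow> \<Psi> (T_F \<alpha>) (int n + 1) = xx * sq (coeff \<alpha> n)"
proof -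
  have zero: "\<Psi> \<zero>\<^bsub>T_ring\<^esub> = (\<lambda>n. 0)"
    using ring_hom_zero[OF hom T.ring_axioms S_is_ring] by (simp add: S_simps)
  have gen: "\<Psi> (T_gen v) = S_gen v" for v
    by (simp add: T_gen_def cls del: S_gen.simps)
  have closed: "\<Psi> x \<in> carrier S_ring" if "x \<in> carrier T_ring" for x
    using hom that by (rule ring_hom_closed)
  have E: "\<Psi> (T_E (pCons a \<alpha>)) n = (if n = 0 then sq a else 0) + (\<Psi> (T_E \<alpha>) (n - 1) + \<Psi> (T_E \<alpha>) (n + 1))"
    for a \<alpha> n
    by (simp add: ring_hom_add[OF hom] ring_hom_mult[OF hom] S_hom_T_k[OF assms] gen S_simps(4)
        S_mult_x3 closed del: S_gen.simps) (simp add: skew_monom_def)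
  have F: "\<Psi> (T_F (pCons a \<alpha>)) n = (if n = 1 then xx * sq a else if n = - 1 then - (xx * sq a) else 0)
      + (\<Psi> (T_F \<alpha>) (n - 1) + \<Psi> (T_F \<alpha>) (n + 1))" for a \<alpha> n
  proof -
    have "S_m (sq a) 0 \<otimes>\<^bsub>S_ring\<^esub> S_gen Gen_x2
        = (\<lambda>n. if n = 1 then xx * sq a else if n = - 1 then - (xx * sq a) else 0)"
      by (simp add: S.r_distr S_m_mult) (auto simp: S_simps skew_monom_def)
    then show ?thesis
      by (simp add: ring_hom_add[OF hom] ring_hom_mult[OF hom] S_hom_T_k[OF assms] gen S_simps(4)
          S_mult_x3 closed del: S_gen.simps)
  qed
  show "degree \<alpha> \<le> n \<Longrightarrow> \<Psi> (T_E \<alpha>) (int n) = sq (coeff \<alpha> n)"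
  proof (induction \<alpha> arbitrary: n)
    case 0
    then show ?case
      by (simp add: zero)
  next
    case (pCons a \<alpha>)
    show ?case
    proof (cases "\<alpha> = 0")
      case True
      then show ?thesis
        by (cases n) (simp_all add: E zero del: T_EF_simps(2) of_nat_Suc)
    next
      case False
      then obtain k where n: "n = Suc k" and k: "degree \<alpha> \<le> k"
        using pCons.prems by (cases n) auto
      have "\<Psi> (T_E \<alpha>) (int k) = sq (coeff \<alpha> k)" "\<Psi> (T_E \<alpha>) (int (k + 2)) = sq (coeff \<alpha> (k + 2))"
        using k by (intro pCons.IH; simp)+
      moreover have "coeff \<alpha> (k + 2) = 0"
        using k by (intro coeff_eq_0) simp
      ultimately show ?thesis
        by (simp add: E n algebra_simps del: T_EF_simps(2))
    qed
  qed
  show "degree \<alpha> \<le> n \<Longrightarrow> \<Psi> (T_F \<alpha>) (int n + 1) = xx * sq (coeff \<alpha> n)"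
  proof (induction \<alpha> arbitrary: n)
    case 0
    then show ?case
      by (simp add: zero)
  next
    case (pCons a \<alpha>)
    show ?case
    proof (cases "\<alpha> = 0")
      case True
      then show ?thesis
        by (cases n) (simp_all add: F zero del: T_EF_simps(6))
    next
      case False
      then obtain k where n: "n = Suc k" and k: "degree \<alpha> \<le> k"
        using pCons.prems by (cases n) auto
      have "\<Psi> (T_F \<alpha>) (int k + 1) = xx * sq (coeff \<alpha> k)"
        "\<Psi> (T_F \<alpha>) (int (k + 2) + 1) = xx * sq (coeff \<alpha> (k + 2))"
        using k by (intro pCons.IH; simp)+
      moreover have "coeff \<alpha> (k + 2) = 0"
        using k by (intro coeff_eq_0) simp
      ultimately show ?thesis
        by (simp add: F n algebra_simps del: T_EF_simps(6))
    qed
  qed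
qed

lemma S_hom_injective:
  fixes \<Psi> :: "'a::field free_alg set \<Rightarrow> int \<Rightarrow> 'a poly poly"
  assumes hom: "\<Psi> \<in> ring_hom T_ring S_ring" and cls: "\<And>p. \<Psi> (T_class p) = S.ev p"
    and zero: "\<Psi> (T_E \<alpha> \<oplus>\<^bsub>T_ring\<^esub> T_F \<beta>) = \<zero>\<^bsub>S_ring\<^esub>"
  shows "\<alpha> = 0 \<and> \<beta> = 0"
proof -
  have sum: "\<Psi> (T_E \<alpha>) n + \<Psi> (T_F \<beta>) n = 0" for n
    using zero by (simp add: ring_hom_add[OF hom]) (simp add: S_simps fun_eq_iff)
  have zero_T: "\<Psi> \<zero>\<^bsub>T_ring\<^esub> = (\<lambda>n. 0)"
    using ring_hom_zero[OF hom T.ring_axioms S_is_ring] by (simp add: S_simps)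
  \<comment> \<open>N is where the highest possible terms of the two sums meet. It is positive even
    when \<beta> = 0, so N - 1 is a genuine predecessor.\<close>
  define N where "N = max (degree \<alpha>) (degree \<beta> + 1)"
  define M where "M = N - 1"
  have M: "N = Suc M"
    by (simp add: M_def N_def)
  have N: "N = Suc M" "degree \<alpha> \<le> Suc M" "degree \<beta> \<le> M"
    using N_def unfolding M by auto
  have "sq (coeff \<alpha> (Suc M)) + xx * sq (coeff \<beta> M) = 0"
    using sum[of "int M + 1"] S_hom_top(1)[OF hom cls N(2)] S_hom_top(2)[OF hom cls N(3)]
    by (simp add: add.commute)
  then have top: "coeff \<alpha> (Suc M) = 0" "coeff \<beta> M = 0"
    by (simp_all add: parity_unique)
  have "degree \<alpha> \<noteq> Suc M"
    using top(1) by (metis leading_coeff_0_iff degree_0 nat.distinct(1))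
  then have "degree \<beta> = M"
    using N by (auto simp: N_def max_def split: if_splits)
  then have beta: "\<beta> = 0"
    using top(2) by auto
  \<comment> \<open>The zero polynomial has degree 0, hence M = 0 and N = 1; so \<alpha> is
    constant, and the coefficient at exponent 0 decides.\<close>
  with \<open>degree \<beta> = M\<close> N(2) \<open>degree \<alpha> \<noteq> Suc M\<close> have "degree \<alpha> \<le> 0"
    by simp
  then have "sq (coeff \<alpha> 0) + xx * sq 0 = 0"
    using sum[of 0] S_hom_top(1)[OF hom cls, of \<alpha> 0] by (simp add: beta zero_T)
  then have "coeff \<alpha> 0 = 0"
    unfolding parity_unique by simp
  then have "\<alpha> = 0"
    using \<open>degree \<alpha> \<le> 0\<close> by (metis le_zero_eq leading_coeff_0_iff)
  with beta show ?thesis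
    by simp
qed

text \<open>\<theta> is determined by its values on generators: it sends p x^i to p(-y) x^(-i), with
  the coefficient still on the left. Being fixed thereby becomes a condition on
  coefficients.\<close>

lemma theta_formula:
  fixes \<theta> :: "(int \<Rightarrow> 'a::field poly poly) \<Rightarrow> (int \<Rightarrow> 'a poly poly)"
  assumes iso: "\<theta> \<in> alg_iso S_const S_ring S_const S_ring"
    and x: "\<theta> S_x = S_x_inv" and y: "\<theta> S_y = \<ominus>\<^bsub>S_ring\<^esub> S_y" and t: "\<theta> S_t = S_t"
    and f: "f \<in> carrier S_ring"
  shows "\<theta> f = (\<lambda>n. refl_y (f (- n)))"
proof -
  have hom: "\<theta> \<in> ring_hom S_ring S_ring" and const: "\<And>c. \<theta> (S_const c) = S_const c"
    using iso by (auto simp: alg_iso_def ring_iso_def)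
  have x: "\<theta> (S_m 1 1) = S_m 1 (- 1)"
    using x by (simp add: S_x_def S_x_inv_def)
  \<comment> \<open>Inserting 1 = x^(-1) x and using \<theta>(x) = x^(-1) gives \<theta>(x^(-1)) =
    \<theta>(x^(-1)) \<theta>(x) x = x.\<close>
  have "\<theta> (S_m 1 (- 1)) = \<theta> (S_m 1 (- 1)) \<otimes>\<^bsub>S_ring\<^esub> (S_m 1 (- 1) \<otimes>\<^bsub>S_ring\<^esub> S_m 1 1)"
    using ring_hom_closed[OF hom S_m_carrier] S.r_one by (simp add: S_m_mult S_simps(3)[symmetric])
  also have "\<dots> = \<theta> (S_m 1 (- 1)) \<otimes>\<^bsub>S_ring\<^esub> \<theta> (S_m 1 1) \<otimes>\<^bsub>S_ring\<^esub> S_m 1 1"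
    using ring_hom_closed[OF hom S_m_carrier] by (simp add: x S.m_assoc)
  also have "\<theta> (S_m 1 (- 1)) \<otimes>\<^bsub>S_ring\<^esub> \<theta> (S_m 1 1) = \<theta> (S_m 1 0)"
    by (simp add: S_m_mult flip: ring_hom_mult[OF hom])
  also have "\<theta> (S_m 1 0) = S_m 1 0"
    using ring_hom_one[OF hom] by (simp add: S_simps)
  finally have x_inv: "\<theta> (S_m 1 (- 1)) = S_m 1 1"
    by (simp add: S_m_mult)
  have pow: "\<theta> (S_m 1 i) = S_m 1 (- i)" for i
  proof (induction i rule: int_induct[of _ 0])
    case base
    then show ?case
      using ring_hom_one[OF hom] by (simp add: S_simps)
  next
    case (step1 i)
    then show ?case
      using ring_hom_mult[OF hom, of "S_m 1 i" "S_m 1 1"] x by (simp add: S_m_mult)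
  next
    case (step2 i)
    then show ?case
      using ring_hom_mult[OF hom, of "S_m 1 i" "S_m 1 (- 1)"] x_inv by (simp add: S_m_mult)
  qed
  have "\<ominus>\<^bsub>S_ring\<^esub> S_m xx 0 = S_m (- xx :: 'a poly poly) (0 :: int)"
    by (rule S.minus_equality) (simp_all add: S_m_add, simp add: S_simps fun_eq_iff skew_monom_def)
  then have y: "\<theta> (S_m xx 0) = S_m (- xx) 0"
    using y by (simp add: S_y_def xx_def)
  have const_y: "\<theta> (S_m p 0) = S_m (refl_y p) 0" for p
  proof (induction p rule: poly_poly_induct)
    case (const c)
    then show ?case
      using \<open>\<And>c. \<theta> (S_const c) = S_const c\<close> by (simp add: S_const_def)
  next
    case t
    then show ?case
      using \<open>\<theta> S_t = S_t\<close> by (simp add: S_t_def flip: tt_def)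
  next
    case x
    then show ?case
      by (simp add: y)
  next
    case (add p q)
    then show ?case
      using ring_hom_add[OF hom, of "S_m p 0" "S_m q 0"] by (simp add: S_m_add)
  next
    case (mult p q)
    then show ?case
      using ring_hom_mult[OF hom, of "S_m p 0" "S_m q 0"] by (simp add: S_m_mult)
  qed
  have monom: "\<theta> (S_m p i) = S_m (refl_y p) (- i)" for p i
    using ring_hom_mult[OF hom, of "S_m p 0" "S_m 1 i"] by (simp add: S_m_mult const_y pow)
  show ?thesis
    using f
  proof (induction rule: S_induct)
    case zero
    then show ?case
      using ring_hom_zero[OF hom S_is_ring S_is_ring] by (simp add: S_simps)
  next
    case (add f p i)
    then show ?case
      by (simp add: ring_hom_add[OF hom] monom) (auto simp: S_simps fun_eq_iff skew_monom_def)
  qed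
qed

section \<open>Generation of the fixed ring\<close>

definition S_fixed :: "(int \<Rightarrow> 'a::field poly poly) set"
  where "S_fixed = {f \<in> carrier S_ring. \<forall>n. f n = refl_y (f (- n))}"

lemma S_fixed_gen: "S_gen v \<in> S_fixed"
  unfolding S_fixed_def mem_Collect_eq
  by (intro conjI S_gen_carrier, cases v) (auto simp: S_simps(4) skew_monom_def)

lemma S_symmetric_sum:
  fixes I :: "(int \<Rightarrow> 'a::field poly poly) set"
  assumes I_add: "\<And>f g. \<lbrakk>f \<in> I; g \<in> I\<rbrakk> \<Longrightarrow> f \<oplus>\<^bsub>S_ring\<^esub> g \<in> I"
    and I_mult: "\<And>f g. \<lbrakk>f \<in> I; g \<in> I\<rbrakk> \<Longrightarrow> f \<otimes>\<^bsub>S_ring\<^esub> g \<in> I"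
    and I_sq: "\<And>a. S_m (sq a) 0 \<in> I"
    and x3: "S_gen Gen_x3 \<in> I" and x2: "S_gen Gen_x2 \<in> I"
  shows "S_m p (int n) \<oplus>\<^bsub>S_ring\<^esub> S_m (refl_y p) (- int n) \<in> I"
proof -
  \<comment> \<open>The set I is only closed under sums and products, so the minus sign of the
    recursion has to come from -1, seen as a constant polynomial in y^2.\<close>
  have minus: "S_m (- 1) 0 \<in> I"
  proof -
    have "sq (- 1) = - sq (1 :: 'a poly poly)"
      by (simp only: sq_def pcompose_uminus)
    then show ?thesis
      using I_sq[of "- 1"] by simp
  qed
  define e where "e n = S_m (1 :: 'a poly poly) (int n) \<oplus>\<^bsub>S_ring\<^esub> S_m 1 (- int n)" for n
  define d where "d n = S_m (xx :: 'a poly poly) (int n) \<oplus>\<^bsub>S_ring\<^esub> S_m (- xx) (- int n)" for n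
  have rec: "e (Suc (Suc n)) = e (Suc n) \<otimes>\<^bsub>S_ring\<^esub> S_gen Gen_x3 \<oplus>\<^bsub>S_ring\<^esub> S_m (- 1) 0 \<otimes>\<^bsub>S_ring\<^esub> e n"
    "d (Suc (Suc n)) = d (Suc n) \<otimes>\<^bsub>S_ring\<^esub> S_gen Gen_x3 \<oplus>\<^bsub>S_ring\<^esub> S_m (- 1) 0 \<otimes>\<^bsub>S_ring\<^esub> d n" for n
    by (simp_all add: e_def d_def S_calc) (auto simp: fun_eq_iff S_simps(4) skew_monom_def)
  \<comment> \<open>The recursion starts at 2 and 0, both of which are polynomials in y^2.\<close>
  have two: "e 0 = S_m (sq (1 + 1)) 0" "d 0 = S_m (sq 0) 0"
    unfolding sq_add by (simp_all add: e_def d_def S_m_add)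
  have e: "e n \<in> I \<and> e (Suc n) \<in> I" for n
  proof (induction n)
    case 0
    then show ?case
      unfolding two using x3 I_sq by (simp add: e_def)
  next
    case (Suc n)
    then show ?case
      unfolding rec by (intro conjI I_add I_mult x3 minus) auto
  qed
  have d: "d n \<in> I \<and> d (Suc n) \<in> I" for n
  proof (induction n)
    case 0
    then show ?case
      unfolding two using x2 I_sq[of 0] by (simp add: d_def)
  next
    case (Suc n)
    then show ?case
      unfolding rec by (intro conjI I_add I_mult x3 minus) auto
  qed
  obtain a b where p: "p = sq a + xx * sq b"
    using parity_split by blast
  \<comment> \<open>Reflection negates only the odd part y b(y^2), so the even part collects x^n +
    x^(-n) and the odd part y (x^n - x^(-n)).\<close>
  have "S_m p (int n) \<oplus>\<^bsub>S_ring\<^esub> S_m (refl_y p) (- int n)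
      = S_m (sq a) 0 \<otimes>\<^bsub>S_ring\<^esub> e n \<oplus>\<^bsub>S_ring\<^esub> S_m (sq b) 0 \<otimes>\<^bsub>S_ring\<^esub> d n"
    by (simp add: p e_def d_def S_calc) (auto simp: fun_eq_iff S_simps(4) skew_monom_def)
  then show ?thesis
    using e d I_sq by (simp add: I_add I_mult)
qed

text \<open>Induction on a bound for the absolute values of the exponents: a fixed element loses its
  outermost pair of terms, which is a symmetric sum. For a single term at exponent 0 the odd part
  equals its own negative, and the characteristic makes it vanish.\<close>

lemma S_fixed_generated:
  fixes I :: "(int \<Rightarrow> 'a::field poly poly) set"
  assumes char: "CHAR('a) \<noteq> 2"
    and I_add: "\<And>f g. \<lbrakk>f \<in> I; g \<in> I\<rbrakk> \<Longrightarrow> f \<oplus>\<^bsub>S_ring\<^esub> g \<in> I"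
    and I_mult: "\<And>f g. \<lbrakk>f \<in> I; g \<in> I\<rbrakk> \<Longrightarrow> f \<otimes>\<^bsub>S_ring\<^esub> g \<in> I"
    and I_sq: "\<And>a. S_m (sq a) 0 \<in> I"
    and x3: "S_gen Gen_x3 \<in> I" and x2: "S_gen Gen_x2 \<in> I"
    and f: "f \<in> S_fixed"
  shows "f \<in> I"
proof -
  have bounded: "f \<in> I" if "f \<in> S_fixed" "\<And>n. \<bar>n\<bar> > int N \<Longrightarrow> f n = 0" for N f
    using that
  proof (induction N arbitrary: f)
    case 0
    have "CHAR('a) \<noteq> 1"
      by simp
    then have "\<not> CHAR('a) dvd 2"
      using char by (metis prime_nat_iff two_is_prime_nat)
    then have two: "(2 :: 'a) \<noteq> 0"
      using of_nat_eq_0_iff_char_dvd[where ?'a = 'a, of 2] by simp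
    obtain a b where ab: "f 0 = sq a + xx * sq b"
      using parity_split by blast
    have "refl_y (f 0) = f 0"
    proof -
      have "f 0 = refl_y (f (- 0))"
        using 0(1) unfolding S_fixed_def by blast
      then show ?thesis
        by (simp only: minus_zero)
    qed
    then have "- (xx * sq b) = xx * sq b"
      by (simp add: ab)
    then have "2 * (xx * sq b) = 0"
      unfolding mult_2 by (metis add.left_inverse)
    moreover have "(2 :: 'a poly poly) \<noteq> 0"
      using two by (simp add: numeral_poly)
    ultimately have "xx * sq b = 0"
      using mult_eq_0_iff by blast
    then have "f 0 = sq a"
      unfolding ab by (metis add.right_neutral)
    moreover have "f = S_m (f 0) 0"
      using 0(2) by (auto simp: skew_monom_def fun_eq_iff)
    ultimately show ?case
      using I_sq[of a] by metis
  next
    case (Suc N)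
    \<comment> \<open>Both exponents N + 1 and -(N + 1) are deleted together, which keeps the
      element fixed.\<close>
    define f' where "f' n = (if \<bar>n\<bar> = int (Suc N) then 0 else f n)" for n
    have f: "f \<in> coeff_funs poly2" "\<And>n. f n = refl_y (f (- n))"
      using Suc.prems(1) unfolding S_fixed_def S_simps(1) by blast+
    have "{n. f' n \<noteq> 0} \<subseteq> {n. f n \<noteq> 0}"
      by (auto simp: f'_def)
    then have "f' \<in> coeff_funs poly2"
      using f(1) by (auto simp: coeff_funs_def intro: finite_subset)
    moreover have "f' n = refl_y (f' (- n))" for n
      by (simp add: f'_def f(2)[symmetric])
    ultimately have "f' \<in> S_fixed"
      unfolding S_fixed_def S_simps(1) by blast
    moreover have "f' n = 0" if "\<bar>n\<bar> > int N" for n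
      using that Suc.prems(2)[of n] by (auto simp: f'_def)
    ultimately have f': "f' \<in> I"
      by (rule Suc.IH)
    have f_eq: "f = f' \<oplus>\<^bsub>S_ring\<^esub>
        (S_m (f (int (Suc N))) (int (Suc N)) \<oplus>\<^bsub>S_ring\<^esub> S_m (refl_y (f (int (Suc N)))) (- int (Suc N)))"
    proof -
      have "f (- int (Suc N)) = refl_y (f (- (- int (Suc N))))"
        using Suc.prems(1) unfolding S_fixed_def by blast
      then have "refl_y (f (int (Suc N))) = f (- int (Suc N))"
        by (simp only: minus_minus)
      moreover have "\<bar>n\<bar> = int (Suc N) \<longleftrightarrow> n = int (Suc N) \<or> n = - int (Suc N)" for n
        by arith
      ultimately show ?thesis
        unfolding S_simps(4) f'_def skew_monom_def by (intro ext) (simp del: of_nat_Suc)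
    qed
    have sum: "S_m p (int n) \<oplus>\<^bsub>S_ring\<^esub> S_m (refl_y p) (- int n) \<in> I" for p n
      by (rule S_symmetric_sum; rule I_add I_mult I_sq x3 x2; assumption)
    have "f' \<oplus>\<^bsub>S_ring\<^esub>
        (S_m (f (int (Suc N))) (int (Suc N)) \<oplus>\<^bsub>S_ring\<^esub> S_m (refl_y (f (int (Suc N)))) (- int (Suc N))) \<in> I"
      by (rule I_add[OF f' sum])
    then show ?case
      unfolding f_eq[symmetric] .
  qed
  have "f \<in> coeff_funs poly2"
    using f unfolding S_fixed_def S_simps(1) by blast
  then have fin: "finite {n. f n \<noteq> 0}"
    by (simp add: coeff_funs_def)
  then obtain N where "\<And>n. f n \<noteq> 0 \<Longrightarrow> nat \<bar>n\<bar> \<le> N"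
    using finite_nat_set_iff_bounded_le[of "(\<lambda>n. nat \<bar>n\<bar>) ` {n. f n \<noteq> 0}"] by auto
  then have "f n = 0" if "\<bar>n\<bar> > int N" for n
    using that by fastforce
  then show ?thesis
    by (rule bounded[OF f])
qed

text \<open>The first isomorphism theorem for the map from T to S. That \<open>gT\<close>, a set of
  right multiples, is an ideal is obtained by recognizing it as the kernel, and so the quotient is a
  ring.\<close>

theorem fixed_ring_quotient:
  fixes \<theta> :: "(int \<Rightarrow> 'a::field poly poly) \<Rightarrow> (int \<Rightarrow> 'a poly poly)"
  assumes char: "CHAR('a) \<noteq> 2"
    and theta_aut: "\<theta> \<in> alg_iso S_const S_ring S_const S_ring"
    and theta_x: "\<theta> S_x = S_x_inv"
    and theta_y: "\<theta> S_y = \<ominus>\<^bsub>S_ring\<^esub> S_y"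
    and theta_t: "\<theta> S_t = S_t"
  obtains \<Xi> where "\<Xi> \<in> ring_iso TgT_ring (fixed_ring \<theta> S_ring)"
    "\<And>c. \<Xi> (TgT_const c) = S_const c" "ring (TgT_ring :: 'a free_alg set set ring)"
proof -
  obtain \<Psi> :: "'a free_alg set \<Rightarrow> int \<Rightarrow> 'a poly poly"
    where hom: "\<Psi> \<in> ring_hom T_ring S_ring" and cls: "\<And>p. \<Psi> (T_class p) = S.ev p"
    using T_to_S by blast
  interpret H: ring_hom_ring T_ring S_ring \<Psi>
    using hom by (intro ring_hom_ringI2 T.ring_axioms S_is_ring)
  have gen: "\<Psi> (T_gen v) = S_gen v" and const: "\<Psi> (T_const c) = S_const c" for v c
    by (simp_all add: T_gen_def T_const_def cls del: S_gen.simps)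
  have g: "\<Psi> T_g = \<zero>\<^bsub>S_ring\<^esub>"
    using S_ev_T_g[where ?'a = 'a] by (simp add: T_g_def Let_def cls del: S.ev_add S.ev_mult S.ev_diff)
  have fixed: "carrier (fixed_ring \<theta> S_ring) = S_fixed"
  proof -
    have "\<theta> f = f \<longleftrightarrow> (\<forall>n. f n = refl_y (f (- n)))" if "f \<in> carrier S_ring" for f
      unfolding theta_formula[OF theta_aut theta_x theta_y theta_t that] fun_eq_iff by metis
    then have "{f \<in> carrier S_ring. \<theta> f = f} = S_fixed"
      unfolding S_fixed_def by blast
    then show ?thesis
      by (simp add: fixed_ring_def)
  qed
  have theta_hom: "\<theta> \<in> ring_hom S_ring S_ring" and theta_const: "\<And>c. \<theta> (S_const c) = S_const c"
    using theta_aut by (auto simp: alg_iso_def ring_iso_def)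
  have fixed_iff: "f \<in> S_fixed \<longleftrightarrow> f \<in> carrier S_ring \<and> \<theta> f = f" for f
    using fixed by (auto simp: fixed_ring_def)
  have image: "\<Psi> ` carrier T_ring = S_fixed"
  proof
    have "\<Psi> x \<in> S_fixed" if "x \<in> carrier T_ring" for x
      using that
    proof (induction rule: T_induct)
      case (const c)
      then show ?case
        by (simp add: \<open>\<And>c. \<Psi> (T_const c) = S_const c\<close> fixed_iff theta_const)
    next
      case (gen v)
      then show ?case
        by (simp only: \<open>\<And>v. \<Psi> (T_gen v) = S_gen v\<close> S_fixed_gen)
    next
      case (add x y)
      then show ?case
        by (simp add: fixed_iff ring_hom_add[OF theta_hom])
    next
      case (mult x y)
      then show ?case
        by (simp add: fixed_iff ring_hom_mult[OF theta_hom])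
    qed
    then show "\<Psi> ` carrier T_ring \<subseteq> S_fixed"
      by blast
    show "S_fixed \<subseteq> \<Psi> ` carrier T_ring"
    proof
      fix f :: "int \<Rightarrow> 'a poly poly"
      assume "f \<in> S_fixed"
      then show "f \<in> \<Psi> ` carrier T_ring"
      proof (rule S_fixed_generated[OF char, rotated -1])
        show "f \<oplus>\<^bsub>S_ring\<^esub> g \<in> \<Psi> ` carrier T_ring" "f \<otimes>\<^bsub>S_ring\<^esub> g \<in> \<Psi> ` carrier T_ring"
          if "f \<in> \<Psi> ` carrier T_ring" "g \<in> \<Psi> ` carrier T_ring" for f g
          using that by (auto simp flip: H.hom_add H.hom_mult)
        show "S_m (sq a) 0 \<in> \<Psi> ` carrier T_ring" for a
          unfolding S_hom_T_k[OF hom cls, symmetric] by simp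
        show "S_gen Gen_x3 \<in> \<Psi> ` carrier T_ring" "S_gen Gen_x2 \<in> \<Psi> ` carrier T_ring"
          unfolding gen[symmetric] by simp_all
      qed
    qed
  qed
  have kernel: "a_kernel T_ring S_ring \<Psi> = gT"
  proof -
    \<comment> \<open>Modulo g the element x is a normal form, whose image is still zero;
      independence in S makes the normal form trivial.\<close>
    have "x \<in> gT" if x: "x \<in> carrier T_ring" "\<Psi> x = \<zero>\<^bsub>S_ring\<^esub>" for x
    proof -
      obtain q \<alpha> \<beta> where q: "q \<in> carrier T_ring"
        "x = T_g \<otimes>\<^bsub>T_ring\<^esub> q \<oplus>\<^bsub>T_ring\<^esub> (T_E \<alpha> \<oplus>\<^bsub>T_ring\<^esub> T_F \<beta>)"
        using T_normal_form[OF x(1)] by blast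
      then have "\<Psi> (T_E \<alpha> \<oplus>\<^bsub>T_ring\<^esub> T_F \<beta>) = \<zero>\<^bsub>S_ring\<^esub>"
        using x(2) by (simp add: g)
      then have "\<alpha> = 0 \<and> \<beta> = 0"
        by (rule S_hom_injective[OF hom cls])
      then show ?thesis
        using q by (auto simp: gT_def l_coset_def)
    qed
    moreover have "x \<in> carrier T_ring \<and> \<Psi> x = \<zero>\<^bsub>S_ring\<^esub>" if "x \<in> gT" for x
      using that by (auto simp: gT_def l_coset_def g)
    ultimately show ?thesis
      unfolding a_kernel_def' by blast
  qed
  \<comment> \<open>On a coset of the kernel \<Psi> is constant, so the image has exactly one
    element.\<close>
  define \<Xi> where "\<Xi> A = the_elem (\<Psi> ` A)" for A
  have fixed_eq: "S_ring\<lparr>carrier := \<Psi> ` carrier T_ring\<rparr> = fixed_ring \<theta> S_ring"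
    using fixed by (simp add: image fixed_ring_def)
  have "\<Xi> \<in> ring_iso TgT_ring (fixed_ring \<theta> S_ring)"
    using H.FactRing_iso_set_aux unfolding \<Xi>_def[abs_def] TgT_ring_def kernel fixed_eq .
  moreover have "\<Xi> (TgT_const c) = S_const c" for c
    using H.the_elem_simp[OF T_gen_closed(2)] unfolding \<Xi>_def TgT_const_def kernel const .
  moreover have "ring (TgT_ring :: 'a free_alg set set ring)"
    using ideal.quotient_is_ring[OF H.kernel_is_ideal] unfolding TgT_ring_def kernel .
  ultimately show ?thesis
    using that by blast
qed

text \<open>Some \<theta> is supplied by \<open>theta_exists\<close>; the quotient then embeds into
  S through the fixed ring and inherits the absence of zero divisors.\<close>

theorem TgT_domain:
  assumes "CHAR('a::field) \<noteq> 2"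
  shows "nc_domain (TgT_ring :: 'a free_alg set set ring)"
proof -
  obtain \<theta> :: "(int \<Rightarrow> 'a poly poly) \<Rightarrow> int \<Rightarrow> 'a poly poly"
    where \<theta>: "\<theta> \<in> alg_iso S_const S_ring S_const S_ring"
      "\<theta> S_x = S_x_inv" "\<theta> S_y = \<ominus>\<^bsub>S_ring\<^esub> S_y" "\<theta> S_t = S_t"
    using theta_exists by blast
  obtain \<Xi> :: "'a free_alg set set \<Rightarrow> int \<Rightarrow> 'a poly poly" where iso: "\<Xi> \<in> ring_iso TgT_ring (fixed_ring \<theta> S_ring)"
    and "\<And>c. \<Xi> (TgT_const c) = S_const c" and ring: "ring (TgT_ring :: 'a free_alg set set ring)"
    by (rule fixed_ring_quotient[OF assms \<theta>]) (rule that)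
  interpret Q: ring "TgT_ring :: 'a free_alg set set ring"
    by (rule ring)
  have hom: "\<Xi> \<in> ring_hom TgT_ring (fixed_ring \<theta> S_ring)" and inj: "inj_on \<Xi> (carrier TgT_ring)"
    using iso by (auto simp: ring_iso_def bij_betw_def)
  have closed: "\<Xi> a \<in> carrier S_ring" if "a \<in> carrier TgT_ring" for a
    using ring_hom_closed[OF hom that] by (simp add: fixed_ring_def)
  have mult: "\<Xi> (a \<otimes>\<^bsub>TgT_ring\<^esub> b) = \<Xi> a \<otimes>\<^bsub>S_ring\<^esub> \<Xi> b" if "a \<in> carrier TgT_ring" "b \<in> carrier TgT_ring" for a b
    using ring_hom_mult[OF hom that] by (simp add: fixed_ring_def)
  have "\<Xi> \<zero>\<^bsub>TgT_ring\<^esub> \<oplus>\<^bsub>S_ring\<^esub> \<Xi> \<zero>\<^bsub>TgT_ring\<^esub> = \<Xi> \<zero>\<^bsub>TgT_ring\<^esub>"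
    using ring_hom_add[OF hom Q.zero_closed Q.zero_closed] by (simp add: fixed_ring_def)
  then have zero: "\<Xi> \<zero>\<^bsub>TgT_ring\<^esub> = \<zero>\<^bsub>S_ring\<^esub>"
    using closed[OF Q.zero_closed] by (simp add: S.add.l_cancel_one')
  have one: "\<Xi> \<one>\<^bsub>TgT_ring\<^esub> = \<one>\<^bsub>S_ring\<^esub>"
    using ring_hom_one[OF hom] by (simp add: fixed_ring_def)
  have eq_zero: "a = \<zero>\<^bsub>TgT_ring\<^esub>" if "a \<in> carrier TgT_ring" "\<Xi> a = \<zero>\<^bsub>S_ring\<^esub>" for a
    using inj that zero by (auto simp: inj_on_def)
  have "\<one>\<^bsub>S_ring\<^esub> \<noteq> (\<zero>\<^bsub>S_ring\<^esub> :: int \<Rightarrow> 'a poly poly)"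
    by (auto simp: S_simps skew_monom_def fun_eq_iff)
  then have "\<one>\<^bsub>TgT_ring\<^esub> \<noteq> (\<zero>\<^bsub>TgT_ring\<^esub> :: 'a free_alg set set)"
    using zero one by metis
  moreover have "a = \<zero>\<^bsub>TgT_ring\<^esub> \<or> b = \<zero>\<^bsub>TgT_ring\<^esub>"
    if ab: "a \<in> carrier TgT_ring" "b \<in> carrier TgT_ring" "a \<otimes>\<^bsub>TgT_ring\<^esub> b = \<zero>\<^bsub>TgT_ring\<^esub>"
    for a b :: "'a free_alg set set"
    using S_no_zero_divisors[OF closed[OF ab(1)] _ closed[OF ab(2)]] eq_zero[OF ab(1)] eq_zero[OF ab(2)]
      mult[OF ab(1,2)] ab(3) zero by auto
  ultimately show ?thesis
    unfolding nc_domain_def using ring by blast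
qed

theorem proposition5p1:
  fixes \<theta> :: "(int \<Rightarrow> 'a::field poly poly) \<Rightarrow> (int \<Rightarrow> 'a poly poly)"
  assumes char: "CHAR('a) \<noteq> 2"
    and theta_aut: "\<theta> \<in> alg_iso S_const S_ring S_const S_ring"
    and theta_x: "\<theta> S_x = S_x_inv"
    and theta_y: "\<theta> S_y = \<ominus>\<^bsub>S_ring\<^esub> S_y"
    and theta_t: "\<theta> S_t = S_t"
  shows
    "\<comment> \<open>(i)\<close>
     (\<exists>(\<delta> :: 'a poly poly \<Rightarrow> 'a poly poly) \<sigma> \<delta>\<^sub>1 A B \<phi>.
        skew_derivation poly2 id \<delta> \<and>
        A = skew_poly poly2 id \<delta> \<and>
        \<sigma> \<in> ring_iso A A \<and>
        skew_derivation A \<sigma> \<delta>\<^sub>1 \<and>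
        B = skew_poly A \<sigma> \<delta>\<^sub>1 \<and>
        \<phi> \<in> alg_iso T_const T_ring (\<lambda>c. skew_monom A (skew_monom poly2 [:[:c:]:] 0) 0) B \<and>
        \<phi> (T_gen Gen_t) = skew_monom A (skew_monom poly2 [:[:0, 1:]:] 0) 0 \<and>
        \<phi> (T_gen Gen_x3) = skew_monom A (skew_monom poly2 [:0, 1:] 0) 0 \<and>
        \<phi> (T_gen Gen_x2) = skew_monom A (skew_monom poly2 1 1) 0 \<and>
        \<phi> (T_gen Gen_x1) = skew_monom A \<one>\<^bsub>A\<^esub> 1) \<and>
     \<comment> \<open>(ii)\<close>
     (central (T_ring :: 'a free_alg set ring) T_g \<and>
      nc_domain (TgT_ring :: 'a free_alg set set ring)) \<and>
     \<comment> \<open>(iii)\<close>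
     alg_iso S_const (fixed_ring \<theta> S_ring) TgT_const TgT_ring \<noteq> {}"
proof (intro conjI T_iterated_skew_poly T_g_central TgT_domain char)
  obtain \<Xi> :: "'a free_alg set set \<Rightarrow> int \<Rightarrow> 'a poly poly" where iso: "\<Xi> \<in> ring_iso TgT_ring (fixed_ring \<theta> S_ring)"
    and const: "\<And>c. \<Xi> (TgT_const c) = S_const c" and ring: "ring (TgT_ring :: 'a free_alg set set ring)"
    by (rule fixed_ring_quotient[OF assms]) (rule that)
  have closed: "TgT_const c \<in> carrier (TgT_ring :: 'a free_alg set set ring)" for c
    by (auto simp: TgT_const_def TgT_ring_def FactRing_def A_RCOSETS_def')
  have "inj_on \<Xi> (carrier TgT_ring)"
    using iso by (auto simp: ring_iso_def bij_betw_def)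
  then have "inv_into (carrier TgT_ring) \<Xi> (S_const c) = TgT_const c" for c
    using inv_into_f_f[OF _ closed, of \<Xi> c] by (simp add: const)
  \<comment> \<open>The required isomorphism starts from the fixed ring, hence the inverse of
    \<Xi>.\<close>
  then have "inv_into (carrier TgT_ring) \<Xi>
      \<in> alg_iso S_const (fixed_ring \<theta> S_ring) TgT_const TgT_ring"
    using ring_iso_set_sym[OF ring iso] by (simp add: alg_iso_def)
  then show "alg_iso S_const (fixed_ring \<theta> S_ring) TgT_const TgT_ring \<noteq> {}"
    by blast
qed

end
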